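(* Let $(M,\eta)$ be a contact manifold with Reeb vector field $\xi$, let $\Pi:M\to N$ be a fibration and let $H:M\to\mathbb{R}$ be a smooth function such that $\xi(H)$ is a non-vanishing function. If a bi-isotropic complete solution $\Sigma$ of the $\Pi$-HJE for the contact field $X_H$ is known, then the integral curves of $X_H$ can be constructed up to quadratures.
   Context: All manifolds are finite-dimensional and smooth, all maps smooth. A contact manifold $(M,\eta)$ is a $(2n+1)$-dimensional manifold $M$ with a 1-form $\eta$ such that $(d\eta)^n\wedge\eta$ is nowhere zero. Its Reeb vector field $\xi$ is the unique vector field with $i_\xi d\eta=0$ and $i_\xi\eta=1$. For $H\in C^\infty(M)$ the contact field $X_H$ is the unique vector field with $i_{X_H}d\eta=-dH+\xi(H)\,\eta$ and $i_{X_H}\eta=H$. A fibration $\Pi:M\to N$ is a surjective submersion. For a vector field $X$ on $M$, a section $\sigma:N\to M$ of $\Pi$ is a solution of the $\Pi$-Hamilton-Jacobi equation ($\Pi$-HJE) for $X$ if $\sigma_*\circ\Pi_*\circ X\circ\sigma=X\circ\sigma$. A complete solution of the $\Pi$-HJE for $X$ is a surjective local diffeomorphism $\Sigma:N\times\Lambda\to M$, where $\Lambda$ is a manifold with $\dim\Lambda+\dim N=\dim M$, such that for every $\lambda\in\Lambda$ the map $\sigma_\lambda:=\Sigma(\cdot,\lambda):N\to M$ (a partial solution) is a section of $\Pi$ solving the $\Pi$-HJE for $X$. Restrictions: given an $X$-invariant submanifold $M'\subset M$ (i.e. $X$ is tangent to $M'$), $\Sigma$ restricts to $M'$ if there are submanifolds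 $N'\subset N$, $\Lambda'\subset\Lambda$ such that $\Pi|_{M'}:M'\to N'$ is a fibration, $\Sigma(N'\times\Lambda')\subset M'$ and $\Sigma_{M'}:=\Sigma|_{N'\times\Lambda'}:N'\times\Lambda'\to M'$ is a complete solution of the $\Pi|_{M'}$-HJE for $X|_{M'}$; $\Sigma_{M'}$ is then called a restriction of $\Sigma$ to $M'$. Bi-isotropy: let $\xi(H)$ be non-vanishing, $M_0:=H^{-1}(0)$ (a closed regular submanifold, which is $X_H$-invariant), $M_1:=\{m\in M:H(m)\neq0\}$ (open), with inclusions $\mathfrak{i}_0,\mathfrak{i}_1$ into $M$, $\eta_0:=\mathfrak{i}_0^*\eta$, $\eta_1:=\mathfrak{i}_1^*\eta$, $H_1:=\mathfrak{i}_1^*H$. A complete solution $\Sigma$ of the $\Pi$-HJE for $X_H$ is bi-isotropic if: (1) $\Sigma$ restricts to $M_0$ and for some restriction $\Sigma_0:=\Sigma_{M_0}$ all its partial solutions $\sigma_{0\lambda}$ satisfy $(\sigma_{0\lambda})^*\eta_0=0$; and (2) $\Sigma$ restricts to $M_1$ and for some restriction $\Sigma_1:=\Sigma_{M_1}$ all its partial solutions $\sigma_{1\lambda}$ satisfy $(\sigma_{1\lambda})^*d\left(\eta_1/H_1\right)=0$. "The integral curves of $X$ can be constructed up to quadratures" has its usual meaning: starting from the known data ($M$, $\eta$, $H$, $\Pi$, and the known complete solution), the integral curves can be obtained (locally, around each point) by a finite number of operations consisting of algebraic operations, differentiation, solving of algebraic (i.e. finite, non-differential) equations via inversion of known local diffeomorphisms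 or immersions, and quadratures (computing integrals, i.e. primitives, of known functions or known closed 1-forms). *)

theory Defs
  imports "HOL-Analysis.Analysis"
begin

section \<open>Smooth manifolds\<close>

primrec Ck_on :: "nat \<Rightarrow> ('e::real_normed_vector \<Rightarrow> 'f::real_normed_vector) \<Rightarrow> 'e set \<Rightarrow> bool" where
  "Ck_on 0 f S \<longleftrightarrow> continuous_on S f"
| "Ck_on (Suc k) f S \<longleftrightarrow>
     f differentiable_on S \<and> (\<forall>v. Ck_on k (\<lambda>x. frechet_derivative f (at x) v) S)"

text \<open>Used on open sets only.\<close>

definition smooth_on :: "'e::real_normed_vector set \<Rightarrow> ('e \<Rightarrow> 'f::real_normed_vector) \<Rightarrow> bool" where
  "smooth_on S f \<longleftrightarrow> (\<forall>k. Ck_on k f S)"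

text \<open>
  The underlying set of a manifold is a whole type, whose class instance carries the topology;
  the smooth structure is given by an atlas with values in a Euclidean space \<open>'e\<close>, so the
  dimension is \<open>DIM('e)\<close>. The atlas is not required to be maximal: it is the collection of charts
  in which the manifold is given.
\<close>

type_synonym ('a, 'e) chart = "'a set \<times> ('a \<Rightarrow> 'e)"
type_synonym ('a, 'e) atlas = "('a, 'e) chart set"

definition is_chart :: "('a::topological_space, 'e::euclidean_space) chart \<Rightarrow> bool" where
  "is_chart = (\<lambda>(U, \<phi>). open U \<and> open (\<phi> ` U) \<and> homeomorphism U (\<phi> ` U) \<phi> (inv_into U \<phi>))"

definition compatible ::
    "('a::topological_space, 'e::euclidean_space) chart \<Rightarrow> ('a, 'e) chart \<Rightarrow> bool" where
  "compatible = (\<lambda>(U, \<phi>) (V, \<psi>).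
     smooth_on (\<phi> ` (U \<inter> V)) (\<psi> \<circ> inv_into U \<phi>) \<and>
     smooth_on (\<psi> ` (U \<inter> V)) (\<phi> \<circ> inv_into V \<psi>))"

definition manifold ::
    "('a::{t2_space,second_countable_topology}, 'e::euclidean_space) atlas \<Rightarrow> bool" where
  "manifold M \<longleftrightarrow> (\<forall>c\<in>M. is_chart c) \<and> (\<Union>c\<in>M. fst c) = UNIV \<and> (\<forall>c\<in>M. \<forall>d\<in>M. compatible c d)"

definition maximal_atlas :: "('a::topological_space, 'e::euclidean_space) atlas \<Rightarrow> ('a, 'e) atlas" where
  "maximal_atlas M = {c. is_chart c \<and> (\<forall>d\<in>M. compatible c d)}"

definition euclidean_atlas :: "('e::euclidean_space, 'e) atlas" where
  "euclidean_atlas = {(UNIV, id)}"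

definition prod_atlas :: "('a, 'e) atlas \<Rightarrow> ('b, 'f) atlas \<Rightarrow> ('a \<times> 'b, 'e \<times> 'f) atlas" where
  "prod_atlas M N = {(U \<times> V, map_prod \<phi> \<psi>) | U \<phi> V \<psi>. (U, \<phi>) \<in> M \<and> (V, \<psi>) \<in> N}"

definition smooth_map_on ::
    "('a::topological_space, 'e::euclidean_space) atlas \<Rightarrow>
     ('b::topological_space, 'f::euclidean_space) atlas \<Rightarrow> 'a set \<Rightarrow> ('a \<Rightarrow> 'b) \<Rightarrow> bool" where
  "smooth_map_on M N W F \<longleftrightarrow> open W \<and> continuous_on W F \<and>
     (\<forall>(U, \<phi>)\<in>M. \<forall>(V, \<psi>)\<in>N. smooth_on (\<phi> ` (U \<inter> W \<inter> F -` V)) (\<psi> \<circ> F \<circ> inv_into U \<phi>))"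

abbreviation smooth_map where "smooth_map M N F \<equiv> smooth_map_on M N UNIV F"

abbreviation smooth_fun_on ::
    "('a::topological_space, 'e::euclidean_space) atlas \<Rightarrow> 'a set \<Rightarrow> ('a \<Rightarrow> real) \<Rightarrow> bool" where
  "smooth_fun_on M W f \<equiv> smooth_map_on M euclidean_atlas W f"

definition smooth_near ::
    "('a::topological_space, 'e::euclidean_space) atlas \<Rightarrow> 'a \<Rightarrow> ('a \<Rightarrow> real) \<Rightarrow> bool" where
  "smooth_near M p f \<longleftrightarrow> (\<exists>W. p \<in> W \<and> smooth_fun_on M W f)"


section \<open>Tangent vectors, vector fields and differential forms\<close>

text \<open>
  A tangent vector at \<open>p\<close> is a derivation on functions that are smooth near \<open>p\<close>; it is made unique
  as a HOL function by being 0 on all other functions. \<open>coord_vec M c p w\<close> is the derivation with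
  components \<open>w\<close> in the chart \<open>c\<close>.
\<close>

type_synonym 'a tvec = "('a \<Rightarrow> real) \<Rightarrow> real"

definition coord_vec ::
    "('a::topological_space, 'e::euclidean_space) atlas \<Rightarrow> ('a, 'e) chart \<Rightarrow> 'a \<Rightarrow> 'e \<Rightarrow> 'a tvec" where
  "coord_vec M = (\<lambda>(U, \<phi>) p w f.
     if smooth_near M p f then frechet_derivative (f \<circ> inv_into U \<phi>) (at (\<phi> p)) w else 0)"

definition tangent_space ::
    "('a::topological_space, 'e::euclidean_space) atlas \<Rightarrow> 'a \<Rightarrow> 'a tvec set" where
  "tangent_space M p = {coord_vec M c p w | c w. c \<in> M \<and> p \<in> fst c}"

text \<open>\<open>components c v\<close> are the components of \<open>v\<close> in the chart \<open>c\<close>.\<close>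

definition components :: "('a, 'e::euclidean_space) chart \<Rightarrow> 'a tvec \<Rightarrow> 'e" where
  "components = (\<lambda>(U, \<phi>) v. \<Sum>b\<in>Basis. v (\<lambda>q. \<phi> q \<bullet> b) *\<^sub>R b)"

text \<open>The differential of \<open>F\<close> at \<open>p\<close>; \<open>N\<close> is the atlas of the target.\<close>

definition pushforward ::
    "('b::topological_space, 'f::euclidean_space) atlas \<Rightarrow> ('a \<Rightarrow> 'b) \<Rightarrow> 'a \<Rightarrow> 'a tvec \<Rightarrow> 'b tvec" where
  "pushforward N F p v = (\<lambda>g. if smooth_near N (F p) g then v (g \<circ> F) else 0)"

definition vector_field ::
    "('a::topological_space, 'e::euclidean_space) atlas \<Rightarrow> ('a \<Rightarrow> 'a tvec) \<Rightarrow> bool" where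
  "vector_field M X \<longleftrightarrow> (\<forall>p. X p \<in> tangent_space M p) \<and>
     (\<forall>W f. smooth_fun_on M W f \<longrightarrow> smooth_fun_on M W (\<lambda>p. X p f))"

definition one_form ::
    "('a::topological_space, 'e::euclidean_space) atlas \<Rightarrow> ('a \<Rightarrow> 'a tvec \<Rightarrow> real) \<Rightarrow> bool" where
  "one_form M \<eta> \<longleftrightarrow>
     (\<forall>p. \<forall>u\<in>tangent_space M p. \<forall>v\<in>tangent_space M p. \<forall>a b.
        \<eta> p (\<lambda>f. a * u f + b * v f) = a * \<eta> p u + b * \<eta> p v) \<and>
     (\<forall>c\<in>M. \<forall>w. smooth_fun_on M (fst c) (\<lambda>p. \<eta> p (coord_vec M c p w)))"

definition chart_at :: "('a, 'e) atlas \<Rightarrow> 'a \<Rightarrow> ('a, 'e) chart" where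
  "chart_at M p = (SOME c. c \<in> M \<and> p \<in> fst c)"

definition form_in_chart ::
    "('a::topological_space, 'e::euclidean_space) atlas \<Rightarrow> ('a \<Rightarrow> 'a tvec \<Rightarrow> real) \<Rightarrow>
     ('a, 'e) chart \<Rightarrow> 'e \<Rightarrow> 'e \<Rightarrow> real" where
  "form_in_chart M \<eta> c w x = (let p = inv_into (fst c) (snd c) x in \<eta> p (coord_vec M c p w))"

text \<open>
  The value of \<open>d\<eta>\<close> at \<open>p\<close>, normalised by \<open>d\<eta>(X,Y) = X(\<eta>(Y)) - Y(\<eta>(X)) - \<eta>([X,Y])\<close>. It is computed
  with the constant-coefficient extensions of the two vectors in a chart, and does not depend on
  the chart.
\<close>

definition ext_deriv ::
    "('a::topological_space, 'e::euclidean_space) atlas \<Rightarrow> ('a \<Rightarrow> 'a tvec \<Rightarrow> real) \<Rightarrow>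
     'a \<Rightarrow> 'a tvec \<Rightarrow> 'a tvec \<Rightarrow> real" where
  "ext_deriv M \<eta> p u v =
     (let c = chart_at M p; x = snd c p; a = components c u; b = components c v in
        frechet_derivative (form_in_chart M \<eta> c b) (at x) a -
        frechet_derivative (form_in_chart M \<eta> c a) (at x) b)"

text \<open>
  An alternating \<open>k\<close>-form on a vector space is a function of a sequence of vectors that depends
  only on the entries \<open>0, \<dots>, k - 1\<close>.
\<close>

definition wedge :: "nat \<Rightarrow> nat \<Rightarrow> ((nat \<Rightarrow> 'v) \<Rightarrow> real) \<Rightarrow> ((nat \<Rightarrow> 'v) \<Rightarrow> real) \<Rightarrow> (nat \<Rightarrow> 'v) \<Rightarrow> real" where
  "wedge k l \<alpha> \<beta> v =
     (\<Sum>\<pi> | \<pi> permutes {..<k + l}.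
        of_int (sign \<pi>) * \<alpha> (\<lambda>i. v (\<pi> i)) * \<beta> (\<lambda>i. v (\<pi> (k + i)))) / (fact k * fact l)"

primrec wedge_power :: "((nat \<Rightarrow> 'v) \<Rightarrow> real) \<Rightarrow> nat \<Rightarrow> (nat \<Rightarrow> 'v) \<Rightarrow> real" where
  "wedge_power \<omega> 0 = (\<lambda>v. 1)"
| "wedge_power \<omega> (Suc n) = wedge (2 * n) 2 (wedge_power \<omega> n) \<omega>"


section \<open>Contact manifolds\<close>

definition contact_manifold ::
    "nat \<Rightarrow> ('a::{t2_space,second_countable_topology}, 'e::euclidean_space) atlas \<Rightarrow>
     ('a \<Rightarrow> 'a tvec \<Rightarrow> real) \<Rightarrow> bool" where
  "contact_manifold n M \<eta> \<longleftrightarrow> manifold M \<and> DIM('e) = 2 * n + 1 \<and> one_form M \<eta> \<and>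
     (\<forall>p. \<exists>v. (\<forall>i. v i \<in> tangent_space M p) \<and>
        wedge (2 * n) 1 (wedge_power (\<lambda>v. ext_deriv M \<eta> p (v 0) (v 1)) n) (\<lambda>v. \<eta> p (v 0)) v \<noteq> 0)"

definition reeb_field ::
    "('a::topological_space, 'e::euclidean_space) atlas \<Rightarrow> ('a \<Rightarrow> 'a tvec \<Rightarrow> real) \<Rightarrow>
     ('a \<Rightarrow> 'a tvec) \<Rightarrow> bool" where
  "reeb_field M \<eta> \<xi> \<longleftrightarrow> vector_field M \<xi> \<and>
     (\<forall>p. (\<forall>v\<in>tangent_space M p. ext_deriv M \<eta> p (\<xi> p) v = 0) \<and> \<eta> p (\<xi> p) = 1)"

text \<open>A tangent vector \<open>v\<close> acts on functions, so \<open>v H\<close> is \<open>dH(v)\<close> and \<open>\<xi> p H\<close> is \<open>\<xi>(H)\<close> at \<open>p\<close>.\<close>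

definition contact_field ::
    "('a::topological_space, 'e::euclidean_space) atlas \<Rightarrow> ('a \<Rightarrow> 'a tvec \<Rightarrow> real) \<Rightarrow>
     ('a \<Rightarrow> 'a tvec) \<Rightarrow> ('a \<Rightarrow> real) \<Rightarrow> ('a \<Rightarrow> 'a tvec) \<Rightarrow> bool" where
  "contact_field M \<eta> \<xi> H X \<longleftrightarrow> vector_field M X \<and>
     (\<forall>p. (\<forall>v\<in>tangent_space M p. ext_deriv M \<eta> p (X p) v = - v H + \<xi> p H * \<eta> p v) \<and> \<eta> p (X p) = H p)"


section \<open>Submanifolds\<close>

definition slice_chart ::
    "('a::topological_space, 'e::euclidean_space) atlas \<Rightarrow> 'a set \<Rightarrow> 'e set \<Rightarrow> ('a, 'e) chart \<Rightarrow> bool" where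
  "slice_chart M S V c \<longleftrightarrow> c \<in> maximal_atlas M \<and> subspace V \<and>
     snd c ` (fst c \<inter> S) = snd c ` fst c \<inter> V"

definition submanifold ::
    "('a::topological_space, 'e::euclidean_space) atlas \<Rightarrow> nat \<Rightarrow> 'a set \<Rightarrow> bool" where
  "submanifold M k S \<longleftrightarrow> (\<forall>p\<in>S. \<exists>c V. slice_chart M S V c \<and> dim V = k \<and> p \<in> fst c)"

text \<open>The image of the tangent space of the submanifold \<open>S\<close> under the differential of the inclusion.\<close>

definition tangent_to ::
    "('a::topological_space, 'e::euclidean_space) atlas \<Rightarrow> 'a set \<Rightarrow> 'a \<Rightarrow> 'a tvec set" where
  "tangent_to M S p = {coord_vec M c p w | c V w. slice_chart M S V c \<and> p \<in> fst c \<inter> S \<and> w \<in> V}"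

definition smooth_map_on_subset ::
    "('a::topological_space, 'e::euclidean_space) atlas \<Rightarrow>
     ('b::topological_space, 'f::euclidean_space) atlas \<Rightarrow> 'a set \<Rightarrow> ('a \<Rightarrow> 'b) \<Rightarrow> bool" where
  "smooth_map_on_subset M N S F \<longleftrightarrow>
     (\<forall>p\<in>S. \<exists>W G. p \<in> W \<and> smooth_map_on M N W G \<and> (\<forall>q\<in>W \<inter> S. G q = F q))"


section \<open>Hamilton-Jacobi equations and complete solutions\<close>

text \<open>
  The notions below are relative to submanifolds \<open>M'\<close>, \<open>N'\<close>, \<open>L'\<close> of \<open>M\<close>, \<open>N\<close>, \<open>L\<close>; taking these to
  be \<open>UNIV\<close> gives the absolute notions. The maps involved are smooth on the ambient manifolds and
  are restricted implicitly, and tangent vectors of a submanifold are identified with their images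
  in the ambient tangent space, so the differential of a restriction is a restriction of the
  ambient differential.
\<close>

definition fibration ::
    "('a::topological_space, 'm::euclidean_space) atlas \<Rightarrow>
     ('b::topological_space, 'n::euclidean_space) atlas \<Rightarrow> ('a \<Rightarrow> 'b) \<Rightarrow> 'a set \<Rightarrow> 'b set \<Rightarrow> bool" where
  "fibration M N pr M' N' \<longleftrightarrow> smooth_map M N pr \<and> pr ` M' = N' \<and>
     (\<forall>p\<in>M'. pushforward N pr p ` tangent_to M M' p = tangent_to N N' (pr p))"

definition local_diffeo ::
    "('a::topological_space, 'm::euclidean_space) atlas \<Rightarrow>
     ('b::topological_space, 'n::euclidean_space) atlas \<Rightarrow> ('a \<Rightarrow> 'b) \<Rightarrow> 'a set \<Rightarrow> 'b set \<Rightarrow> bool" where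
  "local_diffeo M N F S T \<longleftrightarrow> smooth_map M N F \<and>
     (\<forall>p\<in>S. \<exists>W W'. open W \<and> p \<in> W \<and> open W' \<and>
        F ` (W \<inter> S) = W' \<inter> T \<and> inj_on F (W \<inter> S) \<and>
        smooth_map_on_subset N M (W' \<inter> T) (inv_into (W \<inter> S) F))"

definition HJE_solution ::
    "('a::topological_space, 'm::euclidean_space) atlas \<Rightarrow>
     ('b::topological_space, 'n::euclidean_space) atlas \<Rightarrow> ('a \<Rightarrow> 'b) \<Rightarrow> ('a \<Rightarrow> 'a tvec) \<Rightarrow>
     'a set \<Rightarrow> 'b set \<Rightarrow> ('b \<Rightarrow> 'a) \<Rightarrow> bool" where
  "HJE_solution M N pr X M' N' \<sigma> \<longleftrightarrow>
     smooth_map N M \<sigma> \<and> \<sigma> ` N' \<subseteq> M' \<and> (\<forall>n\<in>N'. pr (\<sigma> n) = n) \<and>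
     (\<forall>n\<in>N'. pushforward M \<sigma> n (pushforward N pr (\<sigma> n) (X (\<sigma> n))) = X (\<sigma> n))"

abbreviation partial_solution :: "('b \<times> 'c \<Rightarrow> 'a) \<Rightarrow> 'c \<Rightarrow> 'b \<Rightarrow> 'a" where
  "partial_solution \<Sigma> l \<equiv> (\<lambda>n. \<Sigma> (n, l))"

definition complete_solution ::
    "('a::topological_space, 'm::euclidean_space) atlas \<Rightarrow>
     ('b::topological_space, 'n::euclidean_space) atlas \<Rightarrow>
     ('c::topological_space, 'l::euclidean_space) atlas \<Rightarrow> ('a \<Rightarrow> 'b) \<Rightarrow> ('a \<Rightarrow> 'a tvec) \<Rightarrow>
     'a set \<Rightarrow> 'b set \<Rightarrow> 'c set \<Rightarrow> ('b \<times> 'c \<Rightarrow> 'a) \<Rightarrow> bool" where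
  "complete_solution M N L pr X M' N' L' \<Sigma> \<longleftrightarrow>
     (\<exists>i j. submanifold N i N' \<and> submanifold L j L' \<and> submanifold M (i + j) M') \<and>
     local_diffeo (prod_atlas N L) M \<Sigma> (N' \<times> L') M' \<and> \<Sigma> ` (N' \<times> L') = M' \<and>
     (\<forall>l\<in>L'. HJE_solution M N pr X M' N' (partial_solution \<Sigma> l))"

definition invariant_submanifold ::
    "('a::topological_space, 'm::euclidean_space) atlas \<Rightarrow> ('a \<Rightarrow> 'a tvec) \<Rightarrow> 'a set \<Rightarrow> bool" where
  "invariant_submanifold M X M' \<longleftrightarrow>
     (\<exists>k. submanifold M k M') \<and> (\<forall>p\<in>M'. X p \<in> tangent_to M M' p)"

text \<open>\<open>\<Sigma>\<close> restricts to \<open>M'\<close>, with restriction \<open>N' \<times> L' \<rightarrow> M'\<close>.\<close>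

definition restricts_to ::
    "('a::topological_space, 'm::euclidean_space) atlas \<Rightarrow>
     ('b::topological_space, 'n::euclidean_space) atlas \<Rightarrow>
     ('c::topological_space, 'l::euclidean_space) atlas \<Rightarrow> ('a \<Rightarrow> 'b) \<Rightarrow> ('a \<Rightarrow> 'a tvec) \<Rightarrow>
     ('b \<times> 'c \<Rightarrow> 'a) \<Rightarrow> 'a set \<Rightarrow> 'b set \<Rightarrow> 'c set \<Rightarrow> bool" where
  "restricts_to M N L pr X \<Sigma> M' N' L' \<longleftrightarrow>
     invariant_submanifold M X M' \<and> fibration M N pr M' N' \<and>
     complete_solution M N L pr X M' N' L' \<Sigma>"

text \<open>
  In the second part, \<open>\<eta>/H\<close> is only meaningful on the open set where \<open>H \<noteq> 0\<close>; its exterior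
  derivative is local and is evaluated at points of that set only.
\<close>

definition bi_isotropic ::
    "('a::topological_space, 'm::euclidean_space) atlas \<Rightarrow>
     ('b::topological_space, 'n::euclidean_space) atlas \<Rightarrow>
     ('c::topological_space, 'l::euclidean_space) atlas \<Rightarrow>
     ('a \<Rightarrow> 'a tvec \<Rightarrow> real) \<Rightarrow> ('a \<Rightarrow> real) \<Rightarrow> ('a \<Rightarrow> 'b) \<Rightarrow> ('a \<Rightarrow> 'a tvec) \<Rightarrow>
     ('b \<times> 'c \<Rightarrow> 'a) \<Rightarrow> bool" where
  "bi_isotropic M N L \<eta> H pr X \<Sigma> \<longleftrightarrow>
     (\<exists>N\<^sub>0 L\<^sub>0. restricts_to M N L pr X \<Sigma> {m. H m = 0} N\<^sub>0 L\<^sub>0 \<and>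
        (\<forall>l\<in>L\<^sub>0. \<forall>n\<in>N\<^sub>0. \<forall>v\<in>tangent_to N N\<^sub>0 n.
           let \<sigma> = partial_solution \<Sigma> l in \<eta> (\<sigma> n) (pushforward M \<sigma> n v) = 0)) \<and>
     (\<exists>N\<^sub>1 L\<^sub>1. restricts_to M N L pr X \<Sigma> {m. H m \<noteq> 0} N\<^sub>1 L\<^sub>1 \<and>
        (\<forall>l\<in>L\<^sub>1. \<forall>n\<in>N\<^sub>1. \<forall>u\<in>tangent_to N N\<^sub>1 n. \<forall>v\<in>tangent_to N N\<^sub>1 n.
           let \<sigma> = partial_solution \<Sigma> l in
             ext_deriv M (\<lambda>p v. \<eta> p v / H p) (\<sigma> n)
               (pushforward M \<sigma> n u) (pushforward M \<sigma> n v) = 0))"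


section \<open>Constructibility up to quadratures\<close>

text \<open>
  A local function of \<open>k\<close> variables is a triple of \<open>k\<close>, an open subset of \<open>\<real>\<^sup>k\<close> (the sequences that
  vanish from \<open>k\<close> on, as in \<^term>\<open>Euclidean_space k\<close>) and a function whose values matter on that set.
\<close>

type_synonym local_fun = "nat \<times> (nat \<Rightarrow> real) set \<times> ((nat \<Rightarrow> real) \<Rightarrow> real)"

definition partial_deriv :: "nat \<Rightarrow> ((nat \<Rightarrow> real) \<Rightarrow> real) \<Rightarrow> (nat \<Rightarrow> real) \<Rightarrow> real" where
  "partial_deriv i f x = deriv (\<lambda>t. f (x(i := t))) (x i)"

definition tuple :: "nat \<Rightarrow> (nat \<Rightarrow> (nat \<Rightarrow> real) \<Rightarrow> real) \<Rightarrow> (nat \<Rightarrow> real) \<Rightarrow> nat \<Rightarrow> real" where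
  "tuple m g x = (\<lambda>j. if j < m then g j x else 0)"

definition immersive :: "nat \<Rightarrow> nat \<Rightarrow> (nat \<Rightarrow> (nat \<Rightarrow> real) \<Rightarrow> real) \<Rightarrow> (nat \<Rightarrow> real) \<Rightarrow> bool" where
  "immersive k m g x \<longleftrightarrow>
     (\<forall>c. (\<forall>j<m. (\<Sum>i<k. c i * partial_deriv i (g j) x) = 0) \<longrightarrow> (\<forall>i<k. c i = 0))"

text \<open>
  The functions obtained from the data \<open>D\<close> by finitely many admissible operations.

  \<open>inversion\<close>: \<open>h\<close> solves \<open>g(h(w)) = y(w)\<close> for a known injective immersion \<open>g\<close> and a known \<open>y\<close>;
  inverses of known diffeomorphisms are the case where \<open>m = k\<close> and \<open>y\<close> is the identity.

  \<open>quadrature\<close>: \<open>F\<close> is a primitive of the closed 1-form \<open>\<Sum>i\<in>I. f i dx\<^sub>i\<close> in the variables \<open>x\<^sub>i\<close>,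
  \<open>i \<in> I\<close>, the other variables being parameters. A primitive is determined only up to a function of
  the parameters, and an arbitrary such function must not become known, so \<open>F\<close> is normalised to
  vanish at a base point \<open>a\<close>; the condition on \<open>U\<close> says that each slice is star-shaped about \<open>a\<close>,
  which makes \<open>F\<close> unique. For \<open>I = {i}\<close> this is the integral of \<open>f i\<close> over \<open>x\<^sub>i\<close> from \<open>a i\<close>.
\<close>

inductive known :: "local_fun set \<Rightarrow> nat \<Rightarrow> (nat \<Rightarrow> real) set \<Rightarrow> ((nat \<Rightarrow> real) \<Rightarrow> real) \<Rightarrow> bool"
  for D where
  data: "(k, U, f) \<in> D \<Longrightarrow> known D k U f"
| const: "openin (Euclidean_space k) U \<Longrightarrow> known D k U (\<lambda>x. c)"
| coordinate: "openin (Euclidean_space k) U \<Longrightarrow> i < k \<Longrightarrow> known D k U (\<lambda>x. x i)"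
| restriction: "known D k U f \<Longrightarrow> openin (Euclidean_space k) V \<Longrightarrow> V \<subseteq> U \<Longrightarrow>
    (\<And>x. x \<in> V \<Longrightarrow> g x = f x) \<Longrightarrow> known D k V g"
| add: "known D k U f \<Longrightarrow> known D k U g \<Longrightarrow> known D k U (\<lambda>x. f x + g x)"
| mult: "known D k U f \<Longrightarrow> known D k U g \<Longrightarrow> known D k U (\<lambda>x. f x * g x)"
| divide: "known D k U f \<Longrightarrow> known D k U g \<Longrightarrow> (\<And>x. x \<in> U \<Longrightarrow> g x \<noteq> 0) \<Longrightarrow>
    known D k U (\<lambda>x. f x / g x)"
| compose: "known D m V f \<Longrightarrow> openin (Euclidean_space k) U \<Longrightarrow>
    (\<And>j. j < m \<Longrightarrow> known D k U (g j)) \<Longrightarrow>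
    (\<And>x. x \<in> U \<Longrightarrow> tuple m g x \<in> V) \<Longrightarrow> known D k U (\<lambda>x. f (tuple m g x))"
| differentiation: "known D k U f \<Longrightarrow> i < k \<Longrightarrow> known D k U (partial_deriv i f)"
| inversion: "(\<And>j. j < m \<Longrightarrow> known D k V (g j)) \<Longrightarrow>
    openin (Euclidean_space k) V \<Longrightarrow> inj_on (tuple m g) V \<Longrightarrow>
    (\<And>x. x \<in> V \<Longrightarrow> immersive k m g x) \<Longrightarrow>
    openin (Euclidean_space l) W \<Longrightarrow> (\<And>j. j < m \<Longrightarrow> known D l W (y j)) \<Longrightarrow>
    (\<And>i. i < k \<Longrightarrow> continuous_map (subtopology (Euclidean_space l) W) euclideanreal (h i)) \<Longrightarrow>
    (\<And>w. w \<in> W \<Longrightarrow> tuple k h w \<in> V \<and> tuple m g (tuple k h w) = tuple m y w) \<Longrightarrow>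
    i < k \<Longrightarrow> known D l W (h i)"
| quadrature: "(\<And>i. i \<in> I \<Longrightarrow> known D k U (f i)) \<Longrightarrow> I \<subseteq> {..<k} \<Longrightarrow>
    openin (Euclidean_space k) U \<Longrightarrow>
    (\<And>x s. x \<in> U \<Longrightarrow> s \<in> {0..1} \<Longrightarrow> (\<lambda>i. if i \<in> I then a i + s * (x i - a i) else x i) \<in> U) \<Longrightarrow>
    (\<And>x i. x \<in> U \<Longrightarrow> i \<in> I \<Longrightarrow> ((\<lambda>t. F (x(i := t))) has_real_derivative f i x) (at (x i))) \<Longrightarrow>
    (\<And>x. x \<in> U \<Longrightarrow> (\<And>i. i \<in> I \<Longrightarrow> x i = a i) \<Longrightarrow> F x = 0) \<Longrightarrow> known D k U F"

text \<open>Identification of a Euclidean space with \<open>\<real>\<^sup>k\<close> by an arbitrary enumeration of its basis.\<close>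

definition basis_list :: "'e::euclidean_space list" where
  "basis_list = (SOME bs. distinct bs \<and> set bs = Basis)"

definition to_coords :: "'e::euclidean_space \<Rightarrow> nat \<Rightarrow> real" where
  "to_coords x = (\<lambda>i. if i < DIM('e) then x \<bullet> (basis_list ! i) else 0)"

definition of_coords :: "(nat \<Rightarrow> real) \<Rightarrow> 'e::euclidean_space" where
  "of_coords y = (\<Sum>i<DIM('e). y i *\<^sub>R (basis_list ! i))"

definition component_funs ::
    "'e::euclidean_space set \<Rightarrow> ('e \<Rightarrow> 'f::euclidean_space) \<Rightarrow> local_fun set" where
  "component_funs S f = {(DIM('e), to_coords ` S, \<lambda>y. f (of_coords y) \<bullet> b) | b. b \<in> Basis}"

definition map_data ::
    "('a::topological_space, 'e::euclidean_space) atlas \<Rightarrow>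
     ('b::topological_space, 'f::euclidean_space) atlas \<Rightarrow> ('a \<Rightarrow> 'b) \<Rightarrow> local_fun set" where
  "map_data M N F =
     (\<Union>(U, \<phi>)\<in>M. \<Union>(V, \<psi>)\<in>N. component_funs (\<phi> ` (U \<inter> F -` V)) (\<psi> \<circ> F \<circ> inv_into U \<phi>))"

definition form_data ::
    "('a::topological_space, 'e::euclidean_space) atlas \<Rightarrow> ('a \<Rightarrow> 'a tvec \<Rightarrow> real) \<Rightarrow> local_fun set" where
  "form_data M \<eta> =
     (\<Union>c\<in>M. component_funs (snd c ` fst c) (\<lambda>x. \<Sum>b\<in>Basis. form_in_chart M \<eta> c b x *\<^sub>R b))"

text \<open>
  The known data: the manifolds (through the transition maps of their given atlases), the contact
  form, the Hamiltonian, the fibration and the complete solution, all in the given charts.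
\<close>

definition known_data ::
    "('a::topological_space, 'm::euclidean_space) atlas \<Rightarrow>
     ('b::topological_space, 'n::euclidean_space) atlas \<Rightarrow>
     ('c::topological_space, 'l::euclidean_space) atlas \<Rightarrow>
     ('a \<Rightarrow> 'a tvec \<Rightarrow> real) \<Rightarrow> ('a \<Rightarrow> real) \<Rightarrow> ('a \<Rightarrow> 'b) \<Rightarrow> ('b \<times> 'c \<Rightarrow> 'a) \<Rightarrow> local_fun set" where
  "known_data M N L \<eta> H pr \<Sigma> =
     map_data M M id \<union> map_data N N id \<union> map_data L L id \<union>
     form_data M \<eta> \<union> map_data M euclidean_atlas H \<union>
     map_data M N pr \<union> map_data (prod_atlas N L) M \<Sigma>"

definition integral_curve ::
    "('a::topological_space, 'e::euclidean_space) atlas \<Rightarrow> ('a \<Rightarrow> 'a tvec) \<Rightarrow>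
     real set \<Rightarrow> (real \<Rightarrow> 'a) \<Rightarrow> bool" where
  "integral_curve M X J \<gamma> \<longleftrightarrow> smooth_map_on euclidean_atlas M J \<gamma> \<and>
     (\<forall>t\<in>J. \<forall>f. smooth_near M (\<gamma> t) f \<longrightarrow> ((\<lambda>s. f (\<gamma> s)) has_real_derivative X (\<gamma> t) f) (at t))"

text \<open>
  Through every point there is a local integral curve whose components, in any given chart around
  the point, are functions of time constructible from \<open>D\<close>.
\<close>

definition integrable_by_quadratures ::
    "local_fun set \<Rightarrow> ('a::topological_space, 'e::euclidean_space) atlas \<Rightarrow> ('a \<Rightarrow> 'a tvec) \<Rightarrow> bool" where
  "integrable_by_quadratures D M X \<longleftrightarrow>
     (\<forall>p. \<forall>(U, \<phi>)\<in>M. p \<in> U \<longrightarrow>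
        (\<exists>\<epsilon>>0. \<exists>\<gamma>. \<gamma> 0 = p \<and> integral_curve M X {-\<epsilon><..<\<epsilon>} \<gamma> \<and> \<gamma> ` {-\<epsilon><..<\<epsilon>} \<subseteq> U \<and>
           (\<forall>b\<in>Basis. known D 1 {y \<in> topspace (Euclidean_space 1). y 0 \<in> {-\<epsilon><..<\<epsilon>}}
              (\<lambda>y. \<phi> (\<gamma> (y 0)) \<bullet> b))))"

end

theory Submission
  imports Defs
begin

text \<open>
  Let \<open>X\<close> be the contact field of \<open>H\<close>. The partial solutions \<open>\<Sigma>(\<cdot>, \<lambda>)\<close> are tangent to \<open>X\<close>, so in the coordinates
  \<open>(x, y)\<close> that \<open>\<Sigma>\<close> and charts of \<open>N\<close> and \<open>\<Lambda>\<close> put on \<open>M\<close> the field is \<open>(u(x, y), 0)\<close>: an integral curve keeps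
  \<open>y = y0\<close>, and what remains is \<open>x' = u(x, y0)\<close> in an open set of a Euclidean space. This is solved by finding
  constructible functions \<open>g\<^sub>i\<close> of \<open>x\<close> that together form an immersion and whose evolution along \<open>X\<close> is
  known. If \<open>l\<^sub>i\<close> is the differential of \<open>g\<^sub>i\<close> at the initial point, then \<open>G = \<Sum>\<^sub>i g\<^sub>i l\<^sub>i\<close> is a local
  diffeomorphism (\<open>normal_map_kernel\<close>), it maps the curve to a straight line, and inverting \<open>G\<close> on that
  line constructs the curve (\<open>line_preimage\<close>).

  Where \<open>H \<noteq> 0\<close>, put \<open>\<theta> = \<eta>/H\<close>. From \<open>i\<^sub>X d\<eta> = -dH + \<xi>(H) \<eta>\<close> and \<open>i\<^sub>X \<eta> = H\<close> one gets \<open>X(H) = \<xi>(H) H\<close>, hence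
  \<open>i\<^sub>X \<theta> = 1\<close> and \<open>i\<^sub>X d\<theta> = 0\<close>. Isotropy says that \<open>\<theta>\<close> is closed on each leaf \<open>y = const\<close>. So on the leaf
  through the initial point \<open>\<theta> = dW\<close>, and the derivative of \<open>\<theta>\<close> in a direction \<open>w\<close> of the parameters is
  closed there too, say \<open>dP\<^sub>w\<close>; both primitives are quadratures. The functions \<open>p\<^sub>w = \<theta>(\<partial>\<^sub>w) - P\<^sub>w\<close> satisfy
  \<open>dp\<^sub>w = d\<theta>(\<cdot>, \<partial>\<^sub>w)\<close> on the leaf. Hence \<open>X(W) = 1\<close> and \<open>X(p\<^sub>w) = 0\<close>, and a vector that is annihilated by \<open>dW\<close>
  and all \<open>dp\<^sub>w\<close> is annihilated by \<open>\<theta>\<close> and \<open>d\<theta>\<close>, so it vanishes because \<open>\<eta>\<close> is a contact form. The line is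
  run through at constant speed (\<open>solved_where_K_nonzero\<close>).

  Where \<open>H = 0\<close>, the zero level is locally a product of a subset of \<open>N\<close> and one of \<open>\<Lambda>\<close>, one of the two being
  open (\<open>zero_set_splits\<close>). The functions \<open>p\<^sub>w = \<eta>(\<partial>\<^sub>w)\<close>, \<open>w\<close> tangent to the second factor, satisfy
  \<open>X(p\<^sub>w) = \<xi>(H) p\<^sub>w\<close> on the zero level, because \<open>\<eta>\<close> vanishes on the leaves in it. Together with \<open>H\<close> they form
  an immersion of the leaf, since \<open>d\<eta>\<close> is nondegenerate on the tangent spaces of the zero level. Thus the
  vector \<open>p\<close> moves along a ray, \<open>p = r p(0)\<close> with \<open>r' = \<xi>(H) r\<close>, which gives the curve \<open>h(r)\<close> as a set
  (\<open>solved_by_scaling_integrals\<close>). The value of \<open>1/(r \<xi>(H))\<close> along it can be read off from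
  \<open>i\<^sub>X d\<eta> = -dH + \<xi>(H) \<eta>\<close> with \<open>X = r \<xi>(H) h'\<close>, so time is a quadrature in \<open>r\<close>, and its inverse is one more
  inversion (\<open>solved_by_time_change\<close>).

  The two arguments take place in a product of Euclidean spaces, in the locale \<open>contact_coords\<close>. The
  locale \<open>complete_solution_chart\<close> provides the passage from the manifolds to it: pulling \<open>\<eta>\<close> back along \<open>\<Sigma>\<close>
  commutes with the exterior derivative (\<open>ext_deriv_push_vec\<close>), the contact condition means that no
  nonzero vector is annihilated by \<open>\<eta>\<close> and \<open>d\<eta>\<close> (\<open>contact_nondegenerate\<close>), and the integral curve is smooth
  because \<open>(f \<circ> \<gamma>)' = X(f) \<circ> \<gamma>\<close> for every smooth \<open>f\<close> (\<open>integral_curve_smooth\<close>).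
\<close>

section \<open>Calculus of smooth functions\<close>

abbreviation dirder :: "('e::real_normed_vector \<Rightarrow> 'f::real_normed_vector) \<Rightarrow> 'e \<Rightarrow> 'e \<Rightarrow> 'f" where
  "dirder f x v \<equiv> frechet_derivative f (at x) v"

lemma dirder_eq: "(f has_derivative f') (at x) \<Longrightarrow> dirder f x v = f' v"
  by (drule frechet_derivative_at) simp

lemma Ck_on_Suc_has_derivative:
  assumes "Ck_on (Suc k) f S" "open S" "x \<in> S"
  shows "(f has_derivative dirder f x) (at x)"
proof -
  have "f differentiable (at x)"
    using assms(1,3) at_within_open[OF assms(3,2)] by (auto simp: differentiable_on_def)
  then show ?thesis by (simp add: frechet_derivative_works)
qed

lemma Ck_on_cong:
  assumes "open S" "\<And>x. x \<in> S \<Longrightarrow> f x = g x" "Ck_on k f S"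
  shows "Ck_on k g S"
  using assms
proof (induction k arbitrary: f g)
  case 0
  then show ?case by (simp cong: continuous_on_cong)
next
  case (Suc k)
  have "g differentiable_on S"
    unfolding differentiable_on_def
  proof
    fix x assume "x \<in> S"
    then have "f differentiable (at x within S)"
      using Suc.prems(3) by (simp add: differentiable_on_def)
    then show "g differentiable (at x within S)"
      by (rule differentiable_transform_within[OF _ zero_less_one \<open>x \<in> S\<close>]) (use Suc.prems(2) in auto)
  qed
  moreover have "dirder f x v = dirder g x v" if "x \<in> S" for x v
  proof -
    have "(f has_derivative dirder f x) (at x)"
      by (rule Ck_on_Suc_has_derivative[OF Suc.prems(3,1) that])
    then have "(g has_derivative dirder f x) (at x)"
      using has_derivative_transform_within_open[where f = f and g = g and s = S, OF _ Suc.prems(1) that]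
        Suc.prems(2) by simp
    then show ?thesis by (rule dirder_eq[symmetric])
  qed
  then have "Ck_on k (\<lambda>x. dirder g x v) S" for v
    using Suc.IH[of "\<lambda>x. dirder f x v" "\<lambda>x. dirder g x v", OF Suc.prems(1)] Suc.prems(3)
    by (simp only: Ck_on.simps)
  ultimately show ?case by simp
qed

lemma Ck_on_subset: "Ck_on k f S \<Longrightarrow> T \<subseteq> S \<Longrightarrow> Ck_on k f T"
proof (induction k arbitrary: f)
  case 0
  then show ?case using continuous_on_subset[of S f T] by simp
next
  case (Suc k)
  have "f differentiable_on S" and "Ck_on k (\<lambda>x. dirder f x v) S" for v
    using Suc.prems(1) by auto
  then show ?case
    using Suc.IH[OF _ Suc.prems(2)] differentiable_on_subset[OF _ Suc.prems(2)] by simp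
qed

lemma Ck_on_local:
  assumes "\<And>x. x \<in> S \<Longrightarrow> \<exists>T. open T \<and> x \<in> T \<and> Ck_on k f T"
  shows "Ck_on k f S"
  using assms
proof (induction k arbitrary: f)
  case 0
  have "isCont f x" if "x \<in> S" for x
    using 0[OF that] by (auto simp: continuous_on_eq_continuous_at)
  then show ?case by (simp add: continuous_at_imp_continuous_on)
next
  case (Suc k)
  have "f differentiable_on S"
    unfolding differentiable_on_def
  proof
    fix x assume "x \<in> S"
    then obtain T where T: "open T" "x \<in> T" "Ck_on (Suc k) f T" using Suc.prems by blast
    then have "f differentiable (at x)"
      using Ck_on_Suc_has_derivative[OF T(3,1,2)] unfolding differentiable_def by blast
    then show "f differentiable (at x within S)" by (rule differentiable_at_withinI)
  qed
  moreover have "Ck_on k (\<lambda>x. dirder f x v) S" for v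
  proof (rule Suc.IH)
    fix x assume "x \<in> S"
    then obtain T where T: "open T" "x \<in> T" "Ck_on (Suc k) f T" using Suc.prems by blast
    then show "\<exists>T. open T \<and> x \<in> T \<and> Ck_on k (\<lambda>x. dirder f x v) T" by auto
  qed
  ultimately show ?case by simp
qed

lemma Ck_on_const: "Ck_on k (\<lambda>x. c) S"
  by (induction k arbitrary: c) (simp_all add: frechet_derivative_const)

lemma Ck_on_bounded_linear:
  assumes "bounded_linear f" shows "Ck_on k f S"
proof (cases k)
  case 0
  then show ?thesis using assms by (simp add: linear_continuous_on)
next
  case (Suc j)
  have *: "(f has_derivative f) (at x)" for x
    using assms by (rule bounded_linear_imp_has_derivative)
  have "f differentiable_on S"
    unfolding differentiable_on_def
    by (rule ballI, rule differentiable_at_withinI, rule differentiableI[OF *])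
  moreover have "(\<lambda>x. dirder f x v) = (\<lambda>x. f v)" for v
    using dirder_eq[OF *] by auto
  ultimately show ?thesis using Suc by (simp add: Ck_on_const)
qed

lemma Ck_on_SucD: "Ck_on (Suc k) f S \<Longrightarrow> Ck_on k f S"
proof (induction k arbitrary: f)
  case 0
  then show ?case using differentiable_imp_continuous_on by auto
next
  case (Suc k)
  have "Ck_on (Suc k) (\<lambda>x. dirder f x v) S" for v
    using Suc.prems by (subst (asm) Ck_on.simps(2)) blast
  then have "Ck_on k (\<lambda>x. dirder f x v) S" for v
    by (rule Suc.IH)
  moreover have "f differentiable_on S"
    using Suc.prems by (subst (asm) Ck_on.simps(2)) blast
  ultimately show ?case by simp
qed

lemma Ck_on_SucI:
  assumes "open S" "\<And>x. x \<in> S \<Longrightarrow> (f has_derivative f' x) (at x)"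
    "\<And>v. Ck_on k (\<lambda>x. f' x v) S"
  shows "Ck_on (Suc k) f S"
proof -
  have "f differentiable_on S"
    unfolding differentiable_on_def
    by (rule ballI, rule differentiable_at_withinI, rule differentiableI[OF assms(2)])
  moreover have "Ck_on k (\<lambda>x. dirder f x v) S" for v
    using Ck_on_cong[of S "\<lambda>x. f' x v" "\<lambda>x. dirder f x v", OF assms(1) dirder_eq[OF assms(2), symmetric] assms(3)]
    by simp
  ultimately show ?thesis by simp
qed

lemma Ck_on_add:
  assumes "open S" "Ck_on k f S" "Ck_on k g S"
  shows "Ck_on k (\<lambda>x. f x + g x) S"
  using assms(2,3)
proof (induction k arbitrary: f g)
  case (Suc k)
  show ?case
  proof (rule Ck_on_SucI[OF assms(1), where f' = "\<lambda>x v. dirder f x v + dirder g x v"])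
    show "((\<lambda>x. f x + g x) has_derivative (\<lambda>v. dirder f x v + dirder g x v)) (at x)"
      if "x \<in> S" for x
      by (rule has_derivative_add[OF Ck_on_Suc_has_derivative[OF Suc.prems(1) assms(1) that]
            Ck_on_Suc_has_derivative[OF Suc.prems(2) assms(1) that]])
    show "Ck_on k (\<lambda>x. dirder f x v + dirder g x v) S" for v
      using Suc.prems by (intro Suc.IH) simp_all
  qed
qed (simp add: continuous_on_add)

lemma Ck_on_sum:
  assumes "open S" "\<And>i. i \<in> I \<Longrightarrow> Ck_on k (f i) S"
  shows "Ck_on k (\<lambda>x. \<Sum>i\<in>I. f i x) S"
  using assms(2) by (induction I rule: infinite_finite_induct) (auto intro!: Ck_on_const Ck_on_add assms(1))

lemma Ck_on_bilinear:
  assumes "bounded_bilinear B" and S: "open S" and "Ck_on k f S" "Ck_on k g S"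
  shows "Ck_on k (\<lambda>x. B (f x) (g x)) S"
  using assms(3,4)
proof (induction k arbitrary: f g)
  case 0
  then show ?case using bounded_bilinear.continuous_on[OF assms(1)] by simp
next
  case (Suc k)
  show ?case
  proof (rule Ck_on_SucI[OF S, where f' = "\<lambda>x v. B (f x) (dirder g x v) + B (dirder f x v) (g x)"])
    show "((\<lambda>x. B (f x) (g x)) has_derivative (\<lambda>v. B (f x) (dirder g x v) + B (dirder f x v) (g x))) (at x)"
      if "x \<in> S" for x
      by (rule bounded_bilinear.FDERIV[OF assms(1) Ck_on_Suc_has_derivative[OF Suc.prems(1) S that]
            Ck_on_Suc_has_derivative[OF Suc.prems(2) S that]])
    show "Ck_on k (\<lambda>x. B (f x) (dirder g x v) + B (dirder f x v) (g x)) S" for v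
      using Suc.prems Ck_on_SucD[OF Suc.prems(1)] Ck_on_SucD[OF Suc.prems(2)]
      by (intro Ck_on_add[OF S] Suc.IH) auto
  qed
qed

lemma Ck_on_linear_compose:
  assumes "bounded_linear L" and S: "open S" and "Ck_on k f S"
  shows "Ck_on k (\<lambda>x. L (f x)) S"
  using assms(3)
proof (induction k arbitrary: f)
  case 0
  then show ?case using bounded_linear.continuous_on[OF assms(1)] by simp
next
  case (Suc k)
  show ?case
  proof (rule Ck_on_SucI[OF S, where f' = "\<lambda>x v. L (dirder f x v)"])
    show "((\<lambda>x. L (f x)) has_derivative (\<lambda>v. L (dirder f x v))) (at x)" if "x \<in> S" for x
      by (rule bounded_linear.has_derivative[OF assms(1) Ck_on_Suc_has_derivative[OF Suc.prems S that]])
  qed (use Suc in auto)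
qed

lemma Ck_on_inverse:
  fixes f :: "'e::real_normed_vector \<Rightarrow> real"
  assumes S: "open S" and "Ck_on k f S" and nz: "\<And>x. x \<in> S \<Longrightarrow> f x \<noteq> 0"
  shows "Ck_on k (\<lambda>x. inverse (f x)) S"
  using assms(2)
proof (induction k)
  case 0
  then show ?case using nz by (simp add: continuous_on_inverse)
next
  case (Suc k)
  have IH: "Ck_on k (\<lambda>x. inverse (f x)) S"
    using Suc.IH Ck_on_SucD[OF Suc.prems] by simp
  show ?case
  proof (rule Ck_on_SucI[OF S, where f' = "\<lambda>x v. - (inverse (f x) * dirder f x v * inverse (f x))"])
    show "((\<lambda>x. inverse (f x)) has_derivative (\<lambda>v. - (inverse (f x) * dirder f x v * inverse (f x)))) (at x)"
      if "x \<in> S" for x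
      by (rule Deriv.has_derivative_inverse[OF nz[OF that] Ck_on_Suc_has_derivative[OF Suc.prems S that]])
    show "Ck_on k (\<lambda>x. - (inverse (f x) * dirder f x v * inverse (f x))) S" for v
      using Suc.prems IH
      by (intro Ck_on_linear_compose[OF bounded_linear_minus[OF bounded_linear_ident] S]
          Ck_on_bilinear[OF bounded_bilinear_mult S]) auto
  qed
qed

lemma linear_euclidean_sum:
  assumes "linear f" shows "f v = (\<Sum>b\<in>Basis. (v \<bullet> b) *\<^sub>R f b)"
proof -
  have "f v = f (\<Sum>b\<in>Basis. (v \<bullet> b) *\<^sub>R b)" by (simp add: euclidean_representation)
  also have "\<dots> = (\<Sum>b\<in>Basis. (v \<bullet> b) *\<^sub>R f b)"
    by (simp add: linear_sum[OF assms] linear_scale[OF assms])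
  finally show ?thesis .
qed

text \<open>
  Expanding the chain rule in the basis of the middle space exhibits the derivative as a sum of
  products of functions to which the induction hypothesis and the product rule apply.
\<close>

lemma Ck_on_compose:
  fixes g :: "'d::real_normed_vector \<Rightarrow> 'e::euclidean_space"
  assumes S: "open S" and T: "open T" and "g ` S \<subseteq> T" "Ck_on k g S" "Ck_on k f T"
  shows "Ck_on k (\<lambda>x. f (g x)) S"
  using assms(4,5)
proof (induction k arbitrary: f)
  case 0
  then show ?case using continuous_on_compose2[of T f S g] assms(3) by simp
next
  case (Suc k)
  have gk: "Ck_on k g S" by (rule Ck_on_SucD[OF Suc.prems(1)])
  show ?case
  proof (rule Ck_on_SucI[OF S, where f' = "\<lambda>x v. \<Sum>b\<in>Basis. (dirder g x v \<bullet> b) *\<^sub>R dirder f (g x) b"])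
    fix x assume x: "x \<in> S"
    have f: "(f has_derivative dirder f (g x)) (at (g x))"
      using x assms(3) by (intro Ck_on_Suc_has_derivative[OF Suc.prems(2) T]) auto
    have "((\<lambda>x. f (g x)) has_derivative (\<lambda>v. dirder f (g x) (dirder g x v))) (at x)"
      by (rule has_derivative_compose[OF Ck_on_Suc_has_derivative[OF Suc.prems(1) S x] f])
    then show "((\<lambda>x. f (g x)) has_derivative (\<lambda>v. \<Sum>b\<in>Basis. (dirder g x v \<bullet> b) *\<^sub>R dirder f (g x) b)) (at x)"
      unfolding linear_euclidean_sum[OF has_derivative_linear[OF f], of "dirder g x _"] .
  next
    show "Ck_on k (\<lambda>x. \<Sum>b\<in>Basis. (dirder g x v \<bullet> b) *\<^sub>R dirder f (g x) b) S" for v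
    proof (rule Ck_on_sum[OF S], rule Ck_on_bilinear[OF bounded_bilinear_scaleR S])
      fix b :: 'e
      have "Ck_on k (\<lambda>x. dirder g x v) S" using Suc.prems(1) by simp
      then show "Ck_on k (\<lambda>x. dirder g x v \<bullet> b) S"
        by (rule Ck_on_linear_compose[OF bounded_linear_inner_left S])
      show "Ck_on k (\<lambda>x. dirder f (g x) b) S"
        using Suc.IH[of "\<lambda>y. dirder f y b", OF gk] Suc.prems(2) by simp
    qed
  qed
qed

lemma Ck_on_componentwise:
  fixes f :: "'d::real_normed_vector \<Rightarrow> 'e::euclidean_space"
  assumes S: "open S" and "\<And>b. b \<in> Basis \<Longrightarrow> Ck_on k (\<lambda>x. f x \<bullet> b) S"
  shows "Ck_on k f S"
proof -
  have "Ck_on k (\<lambda>x. \<Sum>b\<in>Basis. (f x \<bullet> b) *\<^sub>R b) S"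
    by (intro Ck_on_sum[OF S] Ck_on_linear_compose[OF bounded_linear_scaleR_left S] assms(2))
  then show ?thesis by (simp add: euclidean_representation)
qed

lemma smooth_on_cong: "open S \<Longrightarrow> (\<And>x. x \<in> S \<Longrightarrow> f x = g x) \<Longrightarrow> smooth_on S f \<Longrightarrow> smooth_on S g"
  unfolding smooth_on_def using Ck_on_cong[of S f g] by simp

lemma smooth_on_subset: "smooth_on S f \<Longrightarrow> T \<subseteq> S \<Longrightarrow> smooth_on T f"
  unfolding smooth_on_def using Ck_on_subset[of _ f S T] by simp

lemma smooth_on_local:
  assumes "\<And>x. x \<in> S \<Longrightarrow> \<exists>T. open T \<and> x \<in> T \<and> smooth_on T f"
  shows "smooth_on S f"
  unfolding smooth_on_def
proof
  fix k
  show "Ck_on k f S" by (rule Ck_on_local) (use assms in \<open>auto simp: smooth_on_def\<close>)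
qed

lemma smooth_on_const: "smooth_on S (\<lambda>x. c)"
  by (simp add: smooth_on_def Ck_on_const)

lemma smooth_on_bounded_linear: "bounded_linear f \<Longrightarrow> smooth_on S f"
  by (simp add: smooth_on_def Ck_on_bounded_linear)

lemma smooth_on_add: "open S \<Longrightarrow> smooth_on S f \<Longrightarrow> smooth_on S g \<Longrightarrow> smooth_on S (\<lambda>x. f x + g x)"
  by (simp add: smooth_on_def Ck_on_add)

lemma smooth_on_sum: "open S \<Longrightarrow> (\<And>i. i \<in> I \<Longrightarrow> smooth_on S (f i)) \<Longrightarrow> smooth_on S (\<lambda>x. \<Sum>i\<in>I. f i x)"
  by (simp add: smooth_on_def Ck_on_sum)

lemma smooth_on_mult:
  fixes f g :: "_ \<Rightarrow> real"
  shows "open S \<Longrightarrow> smooth_on S f \<Longrightarrow> smooth_on S g \<Longrightarrow> smooth_on S (\<lambda>x. f x * g x)"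
  by (simp add: smooth_on_def Ck_on_bilinear[OF bounded_bilinear_mult])

lemma smooth_on_divide:
  fixes f g :: "_ \<Rightarrow> real"
  shows "open S \<Longrightarrow> smooth_on S f \<Longrightarrow> smooth_on S g \<Longrightarrow> (\<And>x. x \<in> S \<Longrightarrow> g x \<noteq> 0)
    \<Longrightarrow> smooth_on S (\<lambda>x. f x / g x)"
  unfolding smooth_on_def divide_inverse
  by (rule allI, rule Ck_on_bilinear[OF bounded_bilinear_mult]) (auto intro: Ck_on_inverse)

lemma smooth_on_linear_compose:
  "bounded_linear L \<Longrightarrow> open S \<Longrightarrow> smooth_on S f \<Longrightarrow> smooth_on S (\<lambda>x. L (f x))"
  by (simp add: smooth_on_def Ck_on_linear_compose)

lemma smooth_on_diff: "open S \<Longrightarrow> smooth_on S f \<Longrightarrow> smooth_on S g \<Longrightarrow> smooth_on S (\<lambda>x. f x - g x)"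
  using smooth_on_add[of S f "\<lambda>x. - g x"]
    smooth_on_linear_compose[OF bounded_linear_minus[OF bounded_linear_ident], of S g] by simp

lemma smooth_on_compose:
  fixes g :: "'d::real_normed_vector \<Rightarrow> 'e::euclidean_space"
  assumes "open S" "open T" "g ` S \<subseteq> T" and g: "smooth_on S g" and f: "smooth_on T f"
  shows "smooth_on S (\<lambda>x. f (g x))"
  unfolding smooth_on_def
  by (rule allI, rule Ck_on_compose[OF assms(1-3)]) (use f g in \<open>simp_all add: smooth_on_def\<close>)

lemma smooth_on_componentwise:
  fixes f :: "'d::real_normed_vector \<Rightarrow> 'e::euclidean_space"
  assumes "open S" "\<And>b. b \<in> Basis \<Longrightarrow> smooth_on S (\<lambda>x. f x \<bullet> b)"
  shows "smooth_on S f"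
  unfolding smooth_on_def
  by (rule allI, rule Ck_on_componentwise[OF assms(1)]) (use assms(2) in \<open>simp add: smooth_on_def\<close>)

lemma smooth_on_dirder: 
  assumes "smooth_on S f" shows "smooth_on S (\<lambda>x. dirder f x v)"
  unfolding smooth_on_def
proof
  fix k
  have "Ck_on (Suc k) f S" using assms unfolding smooth_on_def by blast
  then show "Ck_on k (\<lambda>x. dirder f x v) S" by simp
qed

lemma smooth_on_has_derivative:
  assumes "smooth_on S f" "open S" "x \<in> S"
  shows "(f has_derivative dirder f x) (at x)"
proof -
  have "Ck_on (Suc 0) f S" using assms(1) by (simp only: smooth_on_def)
  then show ?thesis using assms(2,3) by (rule Ck_on_Suc_has_derivative)
qed

lemma smooth_on_continuous_on: 
  assumes "smooth_on S f" shows "continuous_on S f"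
proof -
  have "Ck_on 0 f S" using assms unfolding smooth_on_def by blast
  then show ?thesis by simp
qed

lemma smooth_on_Pair:
  fixes f :: "'d::real_normed_vector \<Rightarrow> 'e::euclidean_space" and g :: "'d \<Rightarrow> 'f::euclidean_space"
  assumes "open S" "smooth_on S f" "smooth_on S g"
  shows "smooth_on S (\<lambda>x. (f x, g x))"
proof -
  have "smooth_on S (\<lambda>x. (f x, 0) + (0, g x))"
    by (rule smooth_on_add[OF assms(1)
          smooth_on_linear_compose[OF bounded_linear_Pair[OF bounded_linear_ident bounded_linear_zero] assms(1,2)]
          smooth_on_linear_compose[OF bounded_linear_Pair[OF bounded_linear_zero bounded_linear_ident] assms(1,3)]])
  then show ?thesis by simp
qed

lemma smooth_on_dirder_linear:
  assumes "smooth_on S f" "open S" "x \<in> S"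
  shows "linear (dirder f x)"
  by (rule has_derivative_linear[OF smooth_on_has_derivative[OF assms]])

section \<open>Second derivatives\<close>

text \<open>
  The mean value theorem, applied to \<open>r \<mapsto> f (x + t b + r a) - f (x + r a)\<close> and then to the
  derivative of \<open>f\<close> along \<open>a\<close>.
\<close>

lemma second_difference:
  fixes f :: "'e::real_normed_vector \<Rightarrow> real"
  assumes S: "open S" "convex S" and f: "smooth_on S f"
    and mem: "x \<in> S" "x + s *\<^sub>R a \<in> S" "x + t *\<^sub>R b \<in> S" "x + s *\<^sub>R a + t *\<^sub>R b \<in> S"
    and pos: "0 < s" "0 < t"
  shows "\<exists>p q. 0 < p \<and> p < s \<and> 0 < q \<and> q < t \<and>
    f (x + s *\<^sub>R a + t *\<^sub>R b) - f (x + s *\<^sub>R a) - f (x + t *\<^sub>R b) + f x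
      = s * t * dirder (\<lambda>y. dirder f y a) (x + p *\<^sub>R a + q *\<^sub>R b) b"
proof -
  have inS: "x + p *\<^sub>R a + q *\<^sub>R b \<in> S" if "0 \<le> p" "p \<le> s" "0 \<le> q" "q \<le> t" for p q
  proof -
    have seg: "u + r *\<^sub>R v \<in> S" if "u \<in> S" "u + l *\<^sub>R v \<in> S" "0 \<le> r" "r \<le> l" "0 < l" for u v r l
    proof -
      have "(1 - r / l) *\<^sub>R u + (r / l) *\<^sub>R (u + l *\<^sub>R v) \<in> S"
        using that S(2) by (intro convexD) auto
      moreover have "(1 - r / l) *\<^sub>R u + (r / l) *\<^sub>R (u + l *\<^sub>R v) = u + r *\<^sub>R v"
        using that by (simp add: algebra_simps)
      ultimately show ?thesis by simp
    qed
    have 1: "x + p *\<^sub>R a \<in> S" using seg[of x s a p] mem that pos by auto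
    have "(x + t *\<^sub>R b) + p *\<^sub>R a \<in> S"
      using seg[of "x + t *\<^sub>R b" s a p] mem that pos by (auto simp: algebra_simps)
    then show ?thesis using seg[of "x + p *\<^sub>R a" t b q] 1 that pos by (auto simp: algebra_simps)
  qed
  have line: "((\<lambda>r. g (u + r *\<^sub>R v)) has_real_derivative dirder g (u + r *\<^sub>R v) v) (at r)"
    if "smooth_on S g" "u + r *\<^sub>R v \<in> S" for g :: "'e \<Rightarrow> real" and u v r
  proof -
    have g: "(g has_derivative dirder g (u + r *\<^sub>R v)) (at (u + r *\<^sub>R v))"
      by (rule smooth_on_has_derivative[OF that(1) S(1) that(2)])
    have "((\<lambda>r. u + r *\<^sub>R v) has_derivative (\<lambda>r. r *\<^sub>R v)) (at r)"
      by (auto intro!: derivative_eq_intros)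
    from has_derivative_compose[OF this g]
    have "((\<lambda>r. g (u + r *\<^sub>R v)) has_derivative (\<lambda>h. dirder g (u + r *\<^sub>R v) (h *\<^sub>R v))) (at r)" .
    then show ?thesis
      using linear_scale[OF has_derivative_linear[OF g]]
      by (auto simp: has_field_derivative_def mult.commute[of _ "dirder g _ _"])
  qed
  define G where "G = (\<lambda>r. f (x + t *\<^sub>R b + r *\<^sub>R a) - f (x + r *\<^sub>R a))"
  have "\<exists>p. 0 < p \<and> p < s \<and> G s - G 0 = (s - 0) * (dirder f (x + t *\<^sub>R b + p *\<^sub>R a) a - dirder f (x + p *\<^sub>R a) a)"
    unfolding G_def
  proof (rule MVT2[OF pos(1)])
    fix r assume "0 \<le> r" "r \<le> s"
    then show "((\<lambda>r. f (x + t *\<^sub>R b + r *\<^sub>R a) - f (x + r *\<^sub>R a)) has_real_derivative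
        dirder f (x + t *\<^sub>R b + r *\<^sub>R a) a - dirder f (x + r *\<^sub>R a) a) (at r)"
      using inS[of r t] inS[of r 0] pos f by (intro DERIV_diff line) (auto simp: algebra_simps)
  qed
  then obtain p where p: "0 < p" "p < s"
    "G s - G 0 = s * (dirder f (x + t *\<^sub>R b + p *\<^sub>R a) a - dirder f (x + p *\<^sub>R a) a)" by auto
  have "\<exists>q. 0 < q \<and> q < t \<and> dirder f (x + p *\<^sub>R a + t *\<^sub>R b) a - dirder f (x + p *\<^sub>R a + 0 *\<^sub>R b) a
      = (t - 0) * dirder (\<lambda>y. dirder f y a) (x + p *\<^sub>R a + q *\<^sub>R b) b"
  proof (rule MVT2[OF pos(2)])
    fix r assume "0 \<le> r" "r \<le> t"
    then show "((\<lambda>r. dirder f (x + p *\<^sub>R a + r *\<^sub>R b) a) has_real_derivative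
        dirder (\<lambda>y. dirder f y a) (x + p *\<^sub>R a + r *\<^sub>R b) b) (at r)"
      using inS[of p r] p by (intro line[OF smooth_on_dirder[OF f]]) auto
  qed
  then obtain q where "0 < q" "q < t" "dirder f (x + p *\<^sub>R a + t *\<^sub>R b) a - dirder f (x + p *\<^sub>R a) a
      = t * dirder (\<lambda>y. dirder f y a) (x + p *\<^sub>R a + q *\<^sub>R b) b" by auto
  note q = this
  have "f (x + s *\<^sub>R a + t *\<^sub>R b) - f (x + s *\<^sub>R a) - f (x + t *\<^sub>R b) + f x = G s - G 0"
    by (simp add: G_def algebra_simps)
  also have "\<dots> = s * t * dirder (\<lambda>y. dirder f y a) (x + p *\<^sub>R a + q *\<^sub>R b) b"
    using p(3) q(3) by (simp add: algebra_simps)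
  finally show ?thesis using p(1,2) q(1,2) by blast
qed

text \<open>
  The second difference does not change when its two increments are exchanged, so the two iterated
  derivatives agree at suitable points arbitrarily close to \<open>x\<close>; they are continuous.
\<close>

lemma dirder_symmetric_real:
  fixes f :: "'e::real_normed_vector \<Rightarrow> real"
  assumes S: "open S" and f: "smooth_on S f" and x: "x \<in> S"
  shows "dirder (\<lambda>y. dirder f y a) x b = dirder (\<lambda>y. dirder f y b) x a"
proof (rule ccontr)
  define A where "A = (\<lambda>y. dirder (\<lambda>y. dirder f y a) y b)"
  define B where "B = (\<lambda>y. dirder (\<lambda>y. dirder f y b) y a)"
  assume ne: "dirder (\<lambda>y. dirder f y a) x b \<noteq> dirder (\<lambda>y. dirder f y b) x a"
  define e where "e = \<bar>A x - B x\<bar> / 2"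
  have e: "e > 0" using ne by (simp add: e_def A_def B_def)
  have cA: "continuous_on S A" and cB: "continuous_on S B"
    unfolding A_def B_def by (intro smooth_on_continuous_on smooth_on_dirder f)+
  obtain d1 where d1: "d1 > 0" "ball x d1 \<subseteq> S" using S x open_contains_ball by blast
  obtain d2 where d2: "d2 > 0" "\<And>y. y \<in> S \<Longrightarrow> dist y x < d2 \<Longrightarrow> dist (A y) (A x) < e"
    using cA x e unfolding continuous_on_iff by meson
  obtain d3 where d3: "d3 > 0" "\<And>y. y \<in> S \<Longrightarrow> dist y x < d3 \<Longrightarrow> dist (B y) (B x) < e"
    using cB x e unfolding continuous_on_iff by meson
  define d where "d = min d1 (min d2 d3)"
  have d: "d > 0" using d1 d2 d3 by (simp add: d_def)
  define s where "s = d / (2 * (norm a + norm b + 1))"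
  have s: "s > 0" using d by (simp add: s_def add_nonneg_pos)
  have near: "x + p *\<^sub>R a + q *\<^sub>R b \<in> ball x d" if "0 \<le> p" "p \<le> s" "0 \<le> q" "q \<le> s" for p q
  proof -
    have "norm (p *\<^sub>R a + q *\<^sub>R b) \<le> p * norm a + q * norm b"
      using norm_triangle_ineq[of "p *\<^sub>R a" "q *\<^sub>R b"] that by simp
    also have "\<dots> \<le> s * norm a + s * norm b" using that by (intro add_mono mult_right_mono) auto
    also have "\<dots> < s * (norm a + norm b + 1)" using s by (simp add: algebra_simps)
    also have "\<dots> = d / 2"
      using norm_ge_zero[of a] norm_ge_zero[of b] by (simp add: s_def field_simps add_nonneg_eq_0_iff)
    also have "\<dots> < d" using d by simp
    finally have "norm (x - (x + p *\<^sub>R a + q *\<^sub>R b)) < d"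
      using norm_minus_cancel[of "p *\<^sub>R a + q *\<^sub>R b"] by (simp add: algebra_simps)
    then show ?thesis by (simp add: dist_norm)
  qed
  have sub: "ball x d \<subseteq> S" using d1 by (auto simp: d_def)
  have fb: "smooth_on (ball x d) f" by (rule smooth_on_subset[OF f sub])
  have m: "x \<in> ball x d" "x + s *\<^sub>R a \<in> ball x d" "x + s *\<^sub>R b \<in> ball x d"
      "x + s *\<^sub>R a + s *\<^sub>R b \<in> ball x d" "x + s *\<^sub>R b + s *\<^sub>R a \<in> ball x d"
    using near[of 0 0] near[of s 0] near[of 0 s] near[of s s] s
    by (simp_all add: add.assoc add.commute[of "s *\<^sub>R b"] del: mem_ball)
  obtain p q where pq: "0 < p" "p < s" "0 < q" "q < s"
    "f (x + s *\<^sub>R a + s *\<^sub>R b) - f (x + s *\<^sub>R a) - f (x + s *\<^sub>R b) + f x = s * s * A (x + p *\<^sub>R a + q *\<^sub>R b)"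
    using second_difference[OF open_ball convex_ball fb m(1,2,3,4) s s] unfolding A_def by blast
  obtain p' q' where pq': "0 < p'" "p' < s" "0 < q'" "q' < s"
    "f (x + s *\<^sub>R b + s *\<^sub>R a) - f (x + s *\<^sub>R b) - f (x + s *\<^sub>R a) + f x = s * s * B (x + p' *\<^sub>R b + q' *\<^sub>R a)"
    using second_difference[OF open_ball convex_ball fb m(1,3,2,5) s s] unfolding B_def by blast
  have "s * s * A (x + p *\<^sub>R a + q *\<^sub>R b) = s * s * B (x + p' *\<^sub>R b + q' *\<^sub>R a)"
    using pq(5) pq'(5) by (simp add: algebra_simps)
  then have AB: "A (x + p *\<^sub>R a + q *\<^sub>R b) = B (x + q' *\<^sub>R a + p' *\<^sub>R b)"
    using s by (simp add: algebra_simps)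
  have "dist (A (x + p *\<^sub>R a + q *\<^sub>R b)) (A x) < e"
    using near[of p q] pq sub by (intro d2(2)) (auto simp: d_def dist_commute)
  moreover have "dist (B (x + q' *\<^sub>R a + p' *\<^sub>R b)) (B x) < e"
    using near[of q' p'] pq' sub by (intro d3(2)) (auto simp: d_def dist_commute)
  ultimately show False using AB unfolding e_def dist_real_def by (auto simp: abs_if split: if_splits)
qed

lemma dirder_inner:
  assumes "(f has_derivative f') (at x)"
  shows "dirder (\<lambda>y. f y \<bullet> b) x v = f' v \<bullet> b"
  using dirder_eq[OF bounded_linear.has_derivative[OF bounded_linear_inner_left assms]] .

lemma dirder_symmetric:
  fixes f :: "'e::real_normed_vector \<Rightarrow> 'f::euclidean_space"
  assumes S: "open S" and f: "smooth_on S f" and x: "x \<in> S"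
  shows "dirder (\<lambda>y. dirder f y a) x b = dirder (\<lambda>y. dirder f y b) x a"
proof (rule euclidean_eqI)
  fix i :: 'f assume "i \<in> Basis"
  have s: "smooth_on S (\<lambda>y. f y \<bullet> i)"
    by (rule smooth_on_linear_compose[OF bounded_linear_inner_left S f])
  have *: "dirder (\<lambda>y. dirder (\<lambda>y. f y \<bullet> i) y a) x b = dirder (\<lambda>y. dirder f y a) x b \<bullet> i" for a b
  proof -
    have d: "((\<lambda>y. dirder f y a \<bullet> i) has_derivative (\<lambda>v. dirder (\<lambda>y. dirder f y a) x v \<bullet> i)) (at x)"
      by (rule bounded_linear.has_derivative[OF bounded_linear_inner_left
           smooth_on_has_derivative[OF smooth_on_dirder[OF f] S x]])
    have "dirder (\<lambda>y. f y \<bullet> i) y a = dirder f y a \<bullet> i" if "y \<in> S" for y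
      by (rule dirder_inner[OF smooth_on_has_derivative[OF f S that]])
    then have "((\<lambda>y. dirder (\<lambda>y. f y \<bullet> i) y a) has_derivative (\<lambda>v. dirder (\<lambda>y. dirder f y a) x v \<bullet> i)) (at x)"
      using has_derivative_transform_within_open[OF d S x] by simp
    then show ?thesis by (rule dirder_eq)
  qed
  show "dirder (\<lambda>y. dirder f y a) x b \<bullet> i = dirder (\<lambda>y. dirder f y b) x a \<bullet> i"
    using dirder_symmetric_real[OF S s x] * by simp
qed

section \<open>Closed forms, local inverses and level sets\<close>

lemma linear_real_euclidean_sum:
  fixes f :: "'e::euclidean_space \<Rightarrow> real"
  assumes "linear f" shows "f v = (\<Sum>b\<in>Basis. (v \<bullet> b) * f b)"
  using linear_euclidean_sum[OF assms, of v] by simp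

text \<open>
  The primitive is the integral of the form along the rays from \<open>x0\<close>. Closedness identifies the
  derivative of the integrand in the direction \<open>v\<close> with the \<open>t\<close>-derivative of \<open>t\<close> times the value of the form
  on \<open>v\<close> at the point of the ray with parameter \<open>t\<close>, whose integral over \<open>{0..1}\<close> is the value at \<open>x\<close>.
\<close>

lemma Poincare_lemma:
  fixes A :: "'e::euclidean_space \<Rightarrow> 'e \<Rightarrow> real"
  assumes S: "open S" and cS: "convex S" and x0: "x0 \<in> S"
    and A: "\<And>b. b \<in> Basis \<Longrightarrow> smooth_on S (A b)"
    and closed: "\<And>b c x. b \<in> Basis \<Longrightarrow> c \<in> Basis \<Longrightarrow> x \<in> S \<Longrightarrow> dirder (A b) x c = dirder (A c) x b"
  obtains F where "F x0 = 0" "\<And>x. x \<in> S \<Longrightarrow> (F has_derivative (\<lambda>v. \<Sum>b\<in>Basis. (v \<bullet> b) * A b x)) (at x)"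
proof -
  \<comment> \<open>the ray, the integrand and its derivative in \<open>x\<close>\<close>
  define g where "g = (\<lambda>x t. x0 + t *\<^sub>R (x - x0))"
  have gS: "g x t \<in> S" if "x \<in> S" "t \<in> {0..1}" for x t
  proof -
    have "(1 - t) *\<^sub>R x0 + t *\<^sub>R x \<in> S"
      using that by (intro convexD[OF cS x0]) auto
    then show ?thesis by (simp add: g_def algebra_simps)
  qed
  define f where "f = (\<lambda>x t. \<Sum>b\<in>Basis. ((x - x0) \<bullet> b) * A b (g x t))"
  define D where "D = (\<lambda>x t v. \<Sum>b\<in>Basis. ((x - x0) \<bullet> b) * (t * dirder (A b) (g x t) v) + (v \<bullet> b) * A b (g x t))"
  have lin: "linear (dirder (A b) (g x t))" if "b \<in> Basis" "x \<in> S" "t \<in> {0..1}" for b x t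
    by (rule smooth_on_dirder_linear[OF A[OF that(1)] S gS[OF that(2,3)]])
  have linD: "linear (D x t)" if "x \<in> S" "t \<in> {0..1}" for x t
    unfolding D_def
  proof (rule linear_compose_sum, rule ballI)
    fix b :: 'e assume b: "b \<in> Basis"
    note l = lin[OF b that]
    show "linear (\<lambda>v. ((x - x0) \<bullet> b) * (t * dirder (A b) (g x t) v) + (v \<bullet> b) * A b (g x t))"
      by (rule linearI) (simp_all add: linear_add[OF l] linear_scale[OF l] algebra_simps)
  qed
  have bD: "blinfun_apply (Blinfun (D x t)) = D x t" if "x \<in> S" "t \<in> {0..1}" for x t
    using linD[OF that] by (intro bounded_linear_Blinfun_apply linear_conv_bounded_linear[THEN iffD1])
  have der: "((\<lambda>x. f x t) has_derivative D x t) (at x)" if x: "x \<in> S" and t: "t \<in> {0..1}" for x t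
    unfolding f_def D_def
  proof (rule has_derivative_sum)
    fix b :: 'e assume b: "b \<in> Basis"
    have g': "((\<lambda>x. g x t) has_derivative (\<lambda>v. t *\<^sub>R v)) (at x)"
      unfolding g_def by (auto intro!: derivative_eq_intros)
    have A': "((\<lambda>x. A b (g x t)) has_derivative (\<lambda>v. t * dirder (A b) (g x t) v)) (at x)"
      using has_derivative_compose[OF g' smooth_on_has_derivative[OF A[OF b] S gS[OF x t]]]
      by (simp add: linear_scale[OF lin[OF b x t]])
    have i: "((\<lambda>x. (x - x0) \<bullet> b) has_derivative (\<lambda>v. v \<bullet> b)) (at x)"
      by (auto intro!: derivative_eq_intros)
    show "((\<lambda>x. ((x - x0) \<bullet> b) * A b (g x t)) has_derivative
        (\<lambda>v. ((x - x0) \<bullet> b) * (t * dirder (A b) (g x t) v) + (v \<bullet> b) * A b (g x t))) (at x)"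
      by (rule has_derivative_mult[OF i A'])
  qed
  have cg: "continuous_on (S \<times> {0..1}) (\<lambda>p. g (fst p) (snd p))"
    unfolding g_def by (intro continuous_intros)
  have cA: "continuous_on (S \<times> {0..1}) (\<lambda>p. h (g (fst p) (snd p)))" if "continuous_on S h" for h :: "'e \<Rightarrow> real"
    by (rule continuous_on_compose2[OF that cg]) (auto intro: gS)
  have cD: "continuous_on (S \<times> {0..1}) (\<lambda>p. D (fst p) (snd p) v)" for v
    unfolding D_def
  proof (rule continuous_on_sum)
    fix b :: 'e assume b: "b \<in> Basis"
    show "continuous_on (S \<times> {0..1}) (\<lambda>p. ((fst p - x0) \<bullet> b) * (snd p * dirder (A b) (g (fst p) (snd p)) v)
        + (v \<bullet> b) * A b (g (fst p) (snd p)))"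
      by (intro continuous_intros cA smooth_on_continuous_on smooth_on_dirder A b)
  qed
  have cf: "continuous_on {0..1} (f x)" if x: "x \<in> S" for x
    unfolding f_def
  proof (rule continuous_on_sum)
    fix b :: 'e assume b: "b \<in> Basis"
    have "continuous_on {0..1} (\<lambda>t. A b (g x t))"
      by (rule continuous_on_compose2[OF smooth_on_continuous_on[OF A[OF b]], of _ "g x"])
         (use gS[OF x] in \<open>auto simp: g_def intro!: continuous_intros\<close>)
    then show "continuous_on {0..1} (\<lambda>t. ((x - x0) \<bullet> b) * A b (g x t))"
      by (intro continuous_intros)
  qed
  define F where "F = (\<lambda>x. integral (cbox 0 1) (f x))"
  have cB: "continuous_on (S \<times> cbox 0 1) (\<lambda>(x, t). Blinfun (D x t))"
  proof (rule continuous_on_blinfun_componentwise)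
    fix i :: 'e assume "i \<in> Basis"
    have "continuous_on (S \<times> {0..1}) (\<lambda>p. blinfun_apply (case p of (x, t) \<Rightarrow> Blinfun (D x t)) i)"
      by (rule continuous_on_eq[OF cD[of i]]) (auto simp: bD)
    then show "continuous_on (S \<times> cbox 0 1) (\<lambda>p. blinfun_apply (case p of (x, t) \<Rightarrow> Blinfun (D x t)) i)"
      by simp
  qed
  have F': "(F has_derivative integral (cbox 0 1) (\<lambda>t. Blinfun (D x t))) (at x)" if x: "x \<in> S" for x
  proof -
    have "((\<lambda>x. integral (cbox 0 1) (f x)) has_derivative integral (cbox 0 1) (\<lambda>t. Blinfun (D x t))) (at x within S)"
    proof (rule leibniz_rule[where fx = "\<lambda>x t. Blinfun (D x t)" and U = S, OF _ _ cB x cS])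
      fix x and t :: real assume xt: "x \<in> S" "t \<in> cbox 0 1"
      then show "((\<lambda>x. f x t) has_derivative blinfun_apply (Blinfun (D x t))) (at x within S)"
        using der[of x t] bD[of x t] by (simp add: has_derivative_at_withinI)
    next
      fix x assume "x \<in> S"
      then show "f x integrable_on cbox 0 1"
        using cf[of x] by (intro integrable_continuous) simp
    qed
    then show ?thesis using at_within_open[OF x S] by (simp add: F_def)
  qed
  have Dv: "((\<lambda>t. D x t v) has_integral (\<Sum>b\<in>Basis. (v \<bullet> b) * A b x)) {0..1}" if x: "x \<in> S" for x v
  proof -
    \<comment> \<open>an antiderivative of \<open>t \<mapsto> D x t v\<close>, by closedness\<close>
    define P where "P = (\<lambda>t. \<Sum>b\<in>Basis. (v \<bullet> b) * (t * A b (g x t)))"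
    have P': "(P has_real_derivative D x t v) (at t)" if t: "t \<in> {0..1}" for t
    proof -
      have "(P has_real_derivative (\<Sum>b\<in>Basis. (v \<bullet> b) * (A b (g x t) + dirder (A b) (g x t) (x - x0) * t))) (at t)"
        unfolding P_def
      proof (rule DERIV_sum)
        fix b :: 'e assume b: "b \<in> Basis"
        have g': "(g x has_derivative (\<lambda>s. s *\<^sub>R (x - x0))) (at t)"
          unfolding g_def by (auto intro!: derivative_eq_intros)
        have "((\<lambda>t. A b (g x t)) has_real_derivative dirder (A b) (g x t) (x - x0)) (at t)"
          using has_derivative_compose[OF g' smooth_on_has_derivative[OF A[OF b] S gS[OF x t]]]
          by (simp add: linear_scale[OF lin[OF b x t]] has_field_derivative_def mult.commute[of _ "dirder _ _ _"])
        from DERIV_cmult[OF DERIV_mult[OF DERIV_ident this], of "v \<bullet> b"]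
        show "((\<lambda>t. (v \<bullet> b) * (t * A b (g x t))) has_real_derivative
            (v \<bullet> b) * (A b (g x t) + dirder (A b) (g x t) (x - x0) * t)) (at t)"
          by simp
      qed
      also have "(\<Sum>b\<in>Basis. (v \<bullet> b) * (A b (g x t) + dirder (A b) (g x t) (x - x0) * t)) = D x t v"
      proof -
        have "(\<Sum>b\<in>Basis. (v \<bullet> b) * dirder (A b) (g x t) (x - x0))
            = (\<Sum>b\<in>Basis. \<Sum>c\<in>Basis. (v \<bullet> b) * ((x - x0) \<bullet> c) * dirder (A b) (g x t) c)"
        proof (rule sum.cong[OF refl])
          fix b :: 'e assume b: "b \<in> Basis"
          show "(v \<bullet> b) * dirder (A b) (g x t) (x - x0)
            = (\<Sum>c\<in>Basis. (v \<bullet> b) * ((x - x0) \<bullet> c) * dirder (A b) (g x t) c)"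
            by (subst linear_real_euclidean_sum[OF lin[OF b x t]]) (simp add: sum_distrib_left mult.assoc)
        qed
        also have "\<dots> = (\<Sum>b\<in>Basis. \<Sum>c\<in>Basis. (v \<bullet> b) * ((x - x0) \<bullet> c) * dirder (A c) (g x t) b)"
          by (intro sum.cong refl) (simp add: closed[OF _ _ gS[OF x t]])
        also have "\<dots> = (\<Sum>c\<in>Basis. \<Sum>b\<in>Basis. (v \<bullet> b) * ((x - x0) \<bullet> c) * dirder (A c) (g x t) b)"
          by (rule sum.swap)
        also have "\<dots> = (\<Sum>c\<in>Basis. ((x - x0) \<bullet> c) * dirder (A c) (g x t) v)"
        proof (rule sum.cong[OF refl])
          fix c :: 'e assume c: "c \<in> Basis"
          show "(\<Sum>b\<in>Basis. (v \<bullet> b) * ((x - x0) \<bullet> c) * dirder (A c) (g x t) b) = ((x - x0) \<bullet> c) * dirder (A c) (g x t) v"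
            by (subst (2) linear_real_euclidean_sum[OF lin[OF c x t]]) (simp add: sum_distrib_left mult_ac)
        qed
        finally have e: "(\<Sum>b\<in>Basis. (v \<bullet> b) * dirder (A b) (g x t) (x - x0))
            = (\<Sum>c\<in>Basis. ((x - x0) \<bullet> c) * dirder (A c) (g x t) v)" .
        have "(\<Sum>b\<in>Basis. (v \<bullet> b) * (A b (g x t) + dirder (A b) (g x t) (x - x0) * t))
           = (\<Sum>b\<in>Basis. (v \<bullet> b) * A b (g x t)) + t * (\<Sum>b\<in>Basis. (v \<bullet> b) * dirder (A b) (g x t) (x - x0))"
          by (simp add: sum.distrib sum_distrib_left algebra_simps)
        also have "\<dots> = D x t v"
          unfolding e D_def by (simp add: sum.distrib sum_subtractf sum_distrib_left algebra_simps)
        finally show ?thesis .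
      qed
      finally show ?thesis .
    qed
    have "((\<lambda>t. D x t v) has_integral (P 1 - P 0)) {0..1}"
    proof (rule fundamental_theorem_of_calculus)
      fix t :: real assume "t \<in> {0..1}"
      from P'[OF this] show "(P has_vector_derivative D x t v) (at t within {0..1})"
        by (simp add: has_real_derivative_iff_has_vector_derivative has_vector_derivative_at_within)
    qed simp
    then show ?thesis by (simp add: P_def g_def)
  qed
  show ?thesis
  proof
    show "F x0 = 0" by (simp add: F_def f_def)
  next
    fix x assume x: "x \<in> S"
    have "continuous_on {0..1} (\<lambda>t. Blinfun (D x t))"
      by (rule continuous_on_compose2[OF cB, where f = "\<lambda>t. (x, t)", simplified])
         (use x in \<open>auto intro!: continuous_intros\<close>)
    then have int: "(\<lambda>t. Blinfun (D x t)) integrable_on cbox 0 1"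
      by (intro integrable_continuous) simp
    have "blinfun_apply (integral (cbox 0 1) (\<lambda>t. Blinfun (D x t))) v = (\<Sum>b\<in>Basis. (v \<bullet> b) * A b x)" for v
    proof -
      have "blinfun_apply (integral (cbox 0 1) (\<lambda>t. Blinfun (D x t))) v = integral (cbox 0 1) (\<lambda>t. blinfun_apply (Blinfun (D x t)) v)"
        using integral_linear[OF int blinfun.bounded_linear_left, of v] by (simp add: o_def)
      also have "\<dots> = integral (cbox 0 1) (\<lambda>t. D x t v)"
        by (rule integral_cong) (simp add: bD x)
      also have "\<dots> = (\<Sum>b\<in>Basis. (v \<bullet> b) * A b x)"
        using integral_unique[OF Dv[OF x]] by simp
      finally show ?thesis .
    qed
    then show "(F has_derivative (\<lambda>v. \<Sum>b\<in>Basis. (v \<bullet> b) * A b x)) (at x)"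
      using F'[OF x] by (metis (no_types, lifting) ext)
  qed
qed

text \<open>
  The inverse function theorem for maps whose differential is injective at one point. The derivative
  of the inverse is recorded as a right inverse of \<open>G'\<close>, which together with the injectivity of \<open>G'\<close>
  determines it.
\<close>

lemma local_inverse:
  fixes G :: "'e::euclidean_space \<Rightarrow> 'e"
  assumes S: "open S" and x0: "x0 \<in> S"
    and G': "\<And>x. x \<in> S \<Longrightarrow> (G has_derivative G' x) (at x)"
    and cont: "\<And>v. continuous_on S (\<lambda>x. G' x v)"
    and inj: "\<And>v. G' x0 v = 0 \<Longrightarrow> v = 0"
  obtains U V h where "open U" "U \<subseteq> S" "x0 \<in> U" "open V" "G x0 \<in> V" "homeomorphism U V G h"
    "\<And>x v. x \<in> U \<Longrightarrow> G' x v = 0 \<Longrightarrow> v = 0"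
    "\<And>y. y \<in> V \<Longrightarrow> \<exists>h'. (h has_derivative h') (at y) \<and> (\<forall>w. G' (h y) (h' w) = w)"
proof -
  have b: "blinfun_apply (Blinfun (G' x)) = G' x" if "x \<in> S" for x
    using has_derivative_bounded_linear[OF G'[OF that]] by (rule bounded_linear_Blinfun_apply)
  have lin: "linear (G' x)" if "x \<in> S" for x
    by (rule has_derivative_linear[OF G'[OF that]])
  have c: "continuous_on S (\<lambda>x. Blinfun (G' x))"
  proof (rule continuous_on_blinfun_componentwise)
    fix i :: 'e assume "i \<in> Basis"
    show "continuous_on S (\<lambda>x. blinfun_apply (Blinfun (G' x)) i)"
      using cont[of i] by (rule continuous_on_eq) (simp add: b)
  qed
  have "inj (G' x0)"
    using inj linear_injective_0[OF lin[OF x0]] by blast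
  then obtain g where g: "linear g" "g \<circ> G' x0 = id"
    using linear_injective_left_inverse[OF lin[OF x0]] by blast
  have bg: "blinfun_apply (Blinfun g) = g"
    using g(1) by (intro bounded_linear_Blinfun_apply linear_conv_bounded_linear[THEN iffD1])
  have inv: "Blinfun g o\<^sub>L Blinfun (G' x0) = id_blinfun"
  proof (rule blinfun_eqI)
    fix i show "blinfun_apply (Blinfun g o\<^sub>L Blinfun (G' x0)) i = blinfun_apply id_blinfun i"
      using fun_cong[OF g(2), of i] by (simp add: bg b[OF x0])
  qed
  have der: "(G has_derivative blinfun_apply (Blinfun (G' x))) (at x)" if "x \<in> S" for x
    using G'[OF that] b[OF that] by simp
  obtain U V h h' where U: "open U" "U \<subseteq> S" "x0 \<in> U" "open V" "G x0 \<in> V" and hom: "homeomorphism U V G h"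
    and h: "\<And>y. y \<in> V \<Longrightarrow> (h has_derivative h' y) (at y)"
    "\<And>y. y \<in> V \<Longrightarrow> h' y = inv (blinfun_apply (Blinfun (G' (h y))))"
    "\<And>y. y \<in> V \<Longrightarrow> bij (blinfun_apply (Blinfun (G' (h y))))"
    using inverse_function_theorem[OF S der c x0 inv] by blast
  have hU: "h y \<in> U" if "y \<in> V" for y using hom that by (auto simp: homeomorphism_def)
  have hS: "h y \<in> S" if "y \<in> V" for y using hU[OF that] U(2) by blast
  show ?thesis
  proof (rule that[OF U hom])
    fix x v assume xv: "x \<in> U" "G' x v = 0"
    have y: "G x \<in> V" "h (G x) = x" using hom xv(1) by (auto simp: homeomorphism_def)
    have "bij (G' x)" using h(3)[OF y(1)] b[OF hS[OF y(1)]] y(2) by simp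
    then have "inj (G' x)" by (rule bij_is_inj)
    moreover have "G' x 0 = 0" using lin xv(1) U(2) by (intro linear_0) auto
    ultimately show "v = 0" using xv(2) by (metis injD)
  next
    fix y assume y: "y \<in> V"
    have "bij (G' (h y))" using h(3)[OF y] b[OF hS[OF y]] by simp
    then have "G' (h y) (inv (G' (h y)) w) = w" for w by (simp add: bij_is_surj surj_f_inv_f)
    then show "\<exists>h'. (h has_derivative h') (at y) \<and> (\<forall>w. G' (h y) (h' w) = w)"
      using h(1)[OF y] h(2)[OF y] b[OF hS[OF y]] by auto
  qed
qed

definition gradient_of :: "('e::euclidean_space \<Rightarrow> real) \<Rightarrow> 'e" where
  "gradient_of l = (\<Sum>b\<in>Basis. l b *\<^sub>R b)"

lemma gradient_of_inner:
  assumes "linear l" shows "v \<bullet> gradient_of l = l v"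
proof -
  have "v \<bullet> gradient_of l = (\<Sum>b\<in>Basis. (v \<bullet> b) * l b)"
    by (simp add: gradient_of_def inner_sum_right mult.commute)
  also have "\<dots> = l v" by (rule linear_real_euclidean_sum[OF assms, symmetric])
  finally show ?thesis .
qed

text \<open>
  Every vector tangent to a level set is the velocity of a curve in it. If \<open>f\<close> has a gradient at \<open>x\<close>,
  a local diffeomorphism \<open>G\<close> that replaces the component of \<open>y - x\<close> along the gradient by \<open>f y\<close> flattens the
  level set, and the curve is the preimage of the line along \<open>v\<close>; if \<open>f\<close> vanishes identically, the same
  line serves unflattened.
\<close>

lemma level_set_curve:
  fixes f :: "'e::euclidean_space \<Rightarrow> real"
  assumes S: "open S" and f: "smooth_on S f" and x: "x \<in> S" and fx: "f x = 0" and v: "dirder f x v = 0"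
    and regular: "(\<exists>w. dirder f x w \<noteq> 0) \<or> (\<forall>y\<in>S. f y = 0)"
  obtains c where "c 0 = x" "(c has_vector_derivative v) (at 0)"
    "\<forall>\<^sub>F s in nhds 0. c s \<in> S \<and> f (c s) = 0"
proof (cases "\<forall>y\<in>S. f y = 0")
  case True
  have c: "((\<lambda>s::real. x + s *\<^sub>R v) has_vector_derivative v) (at 0)"
    by (auto intro!: derivative_eq_intros)
  have "continuous (at 0) (\<lambda>s::real. x + s *\<^sub>R v)" by (intro continuous_intros)
  then have "\<forall>\<^sub>F s in nhds 0. x + s *\<^sub>R v \<in> S"
    using S x by (simp add: continuous_at_open eventually_nhds)
  then have "\<forall>\<^sub>F s in nhds 0. x + s *\<^sub>R v \<in> S \<and> f (x + s *\<^sub>R v) = 0"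
    by (rule eventually_mono) (use True in auto)
  with c show ?thesis by (intro that[of "\<lambda>s. x + s *\<^sub>R v"]) auto
next
  case False
  define n where "n = gradient_of (dirder f x)"
  have lin: "linear (dirder f y)" if "y \<in> S" for y by (rule smooth_on_dirder_linear[OF f S that])
  have n: "u \<bullet> n = dirder f x u" for u unfolding n_def by (rule gradient_of_inner[OF lin[OF x]])
  have nn: "n \<bullet> n \<noteq> 0"
    using regular False n by (metis inner_eq_zero_iff inner_zero_right)
  define G where "G = (\<lambda>y. (y - x) - (((y - x) \<bullet> n) / (n \<bullet> n)) *\<^sub>R n + f y *\<^sub>R n)"
  define G' where "G' = (\<lambda>y u. u - ((u \<bullet> n) / (n \<bullet> n)) *\<^sub>R n + dirder f y u *\<^sub>R n)"
  have der: "(G has_derivative G' y) (at y)" if y: "y \<in> S" for y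
  proof -
    note f' = smooth_on_has_derivative[OF f S y]
    show ?thesis unfolding G_def G'_def
      by (auto intro!: derivative_eq_intros f' simp: divide_inverse algebra_simps)
  qed
  have cont: "continuous_on S (\<lambda>y. G' y u)" for u
    unfolding G'_def by (intro continuous_intros smooth_on_continuous_on smooth_on_dirder f)
  have dot: "G' y u \<bullet> n = dirder f y u * (n \<bullet> n)" for y u
    using nn by (simp add: G'_def inner_diff_left inner_add_left)
  have inj: "u = 0" if "G' x u = 0" for u
  proof -
    have "dirder f x u = 0" using dot[of x u] that nn by simp
    then show ?thesis using that by (simp add: G'_def n)
  qed
  obtain U V h where U: "open U" "U \<subseteq> S" "x \<in> U" "open V" "G x \<in> V" and hom: "homeomorphism U V G h"
    and h': "\<And>y. y \<in> V \<Longrightarrow> \<exists>h'. (h has_derivative h') (at y) \<and> (\<forall>w. G' (h y) (h' w) = w)"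
    using local_inverse[OF S x der cont inj] by metis
  have Gx: "G x = 0" by (simp add: G_def fx)
  have h0: "h 0 = x" using hom U(3) Gx by (metis homeomorphism_def)
  obtain k where k: "(h has_derivative k) (at 0)" "\<And>w. G' (h 0) (k w) = w"
    using h'[of 0] U(5) Gx by auto
  have "G' x (k v - v) = 0"
  proof -
    have "G' x v = v" using v n by (simp add: G'_def)
    moreover have "linear (G' x)" by (rule has_derivative_linear[OF der[OF x]])
    ultimately show ?thesis using k(2)[of v] h0 by (simp add: linear_diff)
  qed
  then have kv: "k v = v" using inj by fastforce
  have s': "((\<lambda>s::real. s *\<^sub>R v) has_derivative (\<lambda>s. s *\<^sub>R v)) (at 0)"
    by (auto intro!: derivative_eq_intros)
  have k': "(h has_derivative k) (at (0 *\<^sub>R v))" using k(1) by simp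
  have "((\<lambda>s. h (s *\<^sub>R v)) has_derivative (\<lambda>s. k (s *\<^sub>R v))) (at 0)"
    by (rule has_derivative_compose[OF s' k'])
  then have c': "((\<lambda>s. h (s *\<^sub>R v)) has_vector_derivative v) (at 0)"
    using linear_scale[OF has_derivative_linear[OF k(1)]] kv by (simp add: has_vector_derivative_def)
  have "continuous (at 0) (\<lambda>s::real. s *\<^sub>R v)" by (intro continuous_intros)
  then have "\<forall>\<^sub>F s in nhds 0. s *\<^sub>R v \<in> V"
    using U(4,5) Gx by (simp add: continuous_at_open eventually_nhds)
  then have "\<forall>\<^sub>F s in nhds 0. h (s *\<^sub>R v) \<in> S \<and> f (h (s *\<^sub>R v)) = 0"
  proof (rule eventually_mono)
    fix s :: real assume s: "s *\<^sub>R v \<in> V"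
    have hU: "h (s *\<^sub>R v) \<in> U" "G (h (s *\<^sub>R v)) = s *\<^sub>R v"
      using hom s by (auto simp: homeomorphism_def)
    have "G y \<bullet> n = f y * (n \<bullet> n)" for y
      using nn by (simp add: G_def inner_diff_left inner_add_left)
    from this[of "h (s *\<^sub>R v)"] have "f (h (s *\<^sub>R v)) = 0"
      using hU(2) n[of v] v nn by simp
    then show "h (s *\<^sub>R v) \<in> S \<and> f (h (s *\<^sub>R v)) = 0" using hU(1) U(2) by blast
  qed
  with c' show ?thesis using h0 by (intro that[of "\<lambda>s. h (s *\<^sub>R v)"]) auto
qed

section \<open>Constructible functions on Euclidean spaces\<close>

text \<open>
  Constructibility is stated for functions of finite sequences. This is its reading for functions on a
  Euclidean space, in the coordinates of its enumerated basis.
\<close>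

definition constructible_on :: "local_fun set \<Rightarrow> 'e::euclidean_space set \<Rightarrow> ('e \<Rightarrow> real) \<Rightarrow> bool" where
  "constructible_on D S f \<longleftrightarrow> known D DIM('e) (to_coords ` S) (\<lambda>y. f (of_coords y))"

lemma basis_list_props:
  "distinct (basis_list :: 'e::euclidean_space list)" "set (basis_list :: 'e list) = Basis"
  "length (basis_list :: 'e list) = DIM('e)"
proof -
  have "\<exists>bs. distinct bs \<and> set bs = (Basis :: 'e set)"
    using finite_distinct_list[OF finite_Basis] by blast
  then have *: "distinct (basis_list :: 'e list) \<and> set (basis_list :: 'e list) = Basis"
    unfolding basis_list_def by (rule someI_ex)
  then show "distinct (basis_list :: 'e list)" "set (basis_list :: 'e list) = Basis" by blast+
  show "length (basis_list :: 'e list) = DIM('e)"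
    using distinct_card[of "basis_list :: 'e list"] * by simp
qed

lemma basis_list_in_Basis: "i < DIM('e) \<Longrightarrow> (basis_list ! i :: 'e::euclidean_space) \<in> Basis"
  using basis_list_props[where 'e = 'e] nth_mem by metis

lemma Basis_eq_basis_list:
  assumes "b \<in> (Basis :: 'e::euclidean_space set)" obtains i where "i < DIM('e)" "b = basis_list ! i"
  using assms basis_list_props[where 'e = 'e] by (metis in_set_conv_nth)

lemma inner_basis_list:
  "i < DIM('e) \<Longrightarrow> j < DIM('e) \<Longrightarrow>
    (basis_list ! i :: 'e::euclidean_space) \<bullet> basis_list ! j = (if i = j then 1 else 0)"
  using basis_list_props[where 'e = 'e]
  by (simp add: inner_Basis basis_list_in_Basis nth_eq_iff_index_eq)

lemma sum_basis_list: "(\<Sum>b\<in>(Basis :: 'e::euclidean_space set). f b) = (\<Sum>i<DIM('e). f (basis_list ! i))"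
proof -
  have "bij_betw ((!) (basis_list :: 'e list)) {..<DIM('e)} Basis"
    using bij_betw_nth[of "basis_list :: 'e list" "{..<DIM('e)}" Basis] basis_list_props[where 'e = 'e] by simp
  then show ?thesis by (rule sum.reindex_bij_betw[symmetric])
qed

lemma of_coords_to_coords [simp]: "of_coords (to_coords x) = (x :: 'e::euclidean_space)"
proof -
  have "of_coords (to_coords x) = (\<Sum>b\<in>Basis. (x \<bullet> b) *\<^sub>R b)"
    unfolding of_coords_def to_coords_def sum_basis_list by (rule sum.cong) auto
  then show ?thesis by (simp add: euclidean_representation)
qed

lemma inner_of_coords:
  "i < DIM('e) \<Longrightarrow> (of_coords y :: 'e::euclidean_space) \<bullet> basis_list ! i = y i"
  unfolding of_coords_def inner_sum_left by (simp add: inner_basis_list if_distrib cong: if_cong)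

lemma to_coords_of_coords:
  assumes "y \<in> topspace (Euclidean_space DIM('e))"
  shows "to_coords (of_coords y :: 'e::euclidean_space) = y"
  using assms by (auto simp: to_coords_def inner_of_coords topspace_Euclidean_space fun_eq_iff)

lemma to_coords_in_topspace: "to_coords (x :: 'e::euclidean_space) \<in> topspace (Euclidean_space DIM('e))"
  by (simp add: to_coords_def topspace_Euclidean_space)

lemma to_coords_image:
  "to_coords ` S = {y \<in> topspace (Euclidean_space DIM('e)). (of_coords y :: 'e::euclidean_space) \<in> S}"
proof (rule set_eqI, rule iffI)
  fix y assume "y \<in> {y \<in> topspace (Euclidean_space DIM('e)). (of_coords y :: 'e) \<in> S}"
  then have "y = to_coords (of_coords y :: 'e)" "(of_coords y :: 'e) \<in> S"
    using to_coords_of_coords[of y, where 'e = 'e] by auto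
  then show "y \<in> to_coords ` S" by (rule image_eqI)
qed (auto simp: to_coords_in_topspace)

lemma continuous_on_of_coords: "continuous_on A (of_coords :: _ \<Rightarrow> 'e::euclidean_space)"
proof -
  have c: "continuous_on A (\<lambda>y. y i)" for i :: nat
    by (rule continuous_on_subset[OF continuous_on_product_coordinates]) simp
  show ?thesis unfolding of_coords_def
    by (rule continuous_on_sum) (intro continuous_intros c)
qed

lemma Euclidean_space_eq_top_of_set: "Euclidean_space k = top_of_set {y. \<forall>i\<ge>k. y i = (0::real)}"
  unfolding Euclidean_space_def by (simp add: euclidean_product_topology)

lemma openin_to_coords:
  assumes "open (S :: 'e::euclidean_space set)"
  shows "openin (Euclidean_space DIM('e)) (to_coords ` S)"
proof -
  let ?T = "{y. \<forall>i\<ge>DIM('e). y i = (0::real)}"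
  have "openin (top_of_set ?T) (?T \<inter> of_coords -` S)"
    using continuous_on_of_coords assms by (rule continuous_openin_preimage_gen)
  moreover have "?T \<inter> of_coords -` S = to_coords ` S"
    by (auto simp: to_coords_image topspace_Euclidean_space)
  ultimately show ?thesis by (simp add: Euclidean_space_eq_top_of_set)
qed

lemma constructible_on_const: "open S \<Longrightarrow> constructible_on D S (\<lambda>x. c)"
  unfolding constructible_on_def by (intro known.const openin_to_coords)

lemma constructible_on_add:
  "constructible_on D S f \<Longrightarrow> constructible_on D S g \<Longrightarrow> constructible_on D S (\<lambda>x. f x + g x)"
  unfolding constructible_on_def by (rule known.add)

lemma constructible_on_mult:
  "constructible_on D S f \<Longrightarrow> constructible_on D S g \<Longrightarrow> constructible_on D S (\<lambda>x. f x * g x)"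
  unfolding constructible_on_def by (rule known.mult)

lemma constructible_on_divide:
  assumes "constructible_on D S f" "constructible_on D S g" "\<And>x. x \<in> S \<Longrightarrow> g x \<noteq> 0"
  shows "constructible_on D S (\<lambda>x. f x / g x)"
  using assms(1,2) unfolding constructible_on_def
  by (rule known.divide) (use assms(3) in auto)

lemma constructible_on_subset:
  assumes "constructible_on D S f" "open T" "T \<subseteq> S" "\<And>x. x \<in> T \<Longrightarrow> g x = f x"
  shows "constructible_on D T g"
  using assms(1) openin_to_coords[OF assms(2)] unfolding constructible_on_def
  by (rule known.restriction) (use assms(3,4) in auto)

lemma constructible_on_sum:
  assumes "open S" "\<And>i. i \<in> I \<Longrightarrow> constructible_on D S (f i)"
  shows "constructible_on D S (\<lambda>x. \<Sum>i\<in>I. f i x)"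
  using assms(2)
proof (induction I rule: infinite_finite_induct)
  case (insert i I)
  then show ?case using constructible_on_add[of D S "f i"] by simp
qed (simp_all add: constructible_on_const assms(1))

lemma constructible_on_diff:
  assumes "open S" "constructible_on D S f" "constructible_on D S g"
  shows "constructible_on D S (\<lambda>x. f x - g x)"
  using constructible_on_add[OF assms(2) constructible_on_mult[OF constructible_on_const[OF assms(1), of D "-1"] assms(3)]]
  by simp

lemma constructible_on_inner:
  assumes S: "open (S :: 'e::euclidean_space set)"
  shows "constructible_on D S (\<lambda>x. x \<bullet> v)"
proof -
  have b: "constructible_on D S (\<lambda>x. x \<bullet> b)" if b: "b \<in> Basis" for b :: 'e
  proof -
    obtain i where i: "i < DIM('e)" "b = basis_list ! i" using Basis_eq_basis_list[OF b] .
    show ?thesis unfolding constructible_on_def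
      by (rule known.restriction[OF known.coordinate[OF openin_to_coords[OF S] i(1)] openin_to_coords[OF S]])
         (auto simp: i inner_basis_list inner_of_coords to_coords_def)
  qed
  have "constructible_on D S (\<lambda>x. \<Sum>b\<in>Basis. (x \<bullet> b) * (v \<bullet> b))"
    by (intro constructible_on_sum[OF S] constructible_on_mult constructible_on_const[OF S] b)
  then show ?thesis by (simp add: euclidean_inner[of _ v])
qed

lemma tuple_to_coords:
  "tuple DIM('e) (\<lambda>j y. (g y :: 'e::euclidean_space) \<bullet> basis_list ! j) y = to_coords (g y)"
  by (simp add: tuple_def to_coords_def)

lemma constructible_on_compose:
  fixes g :: "'d::euclidean_space \<Rightarrow> 'e::euclidean_space"
  assumes S: "open S" and f: "constructible_on D T f" and "g ` S \<subseteq> T"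
    and g: "\<And>b. b \<in> Basis \<Longrightarrow> constructible_on D S (\<lambda>x. g x \<bullet> b)"
  shows "constructible_on D S (\<lambda>x. f (g x))"
proof -
  let ?g = "\<lambda>j y. g (of_coords y) \<bullet> basis_list ! j"
  have "known D DIM('d) (to_coords ` S) (\<lambda>y. (\<lambda>y. f (of_coords y)) (tuple DIM('e) ?g y))"
  proof (rule known.compose[OF f[unfolded constructible_on_def] openin_to_coords[OF S]])
    fix j assume "j < DIM('e)"
    from g[OF basis_list_in_Basis[OF this]]
    show "known D DIM('d) (to_coords ` S) (?g j)" by (simp add: constructible_on_def)
  next
    fix y assume "y \<in> to_coords ` S"
    then show "tuple DIM('e) ?g y \<in> to_coords ` T"
      using assms(3) by (auto simp: tuple_to_coords)
  qed
  then show ?thesis by (simp add: tuple_to_coords constructible_on_def)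
qed

lemma of_coords_fun_upd:
  assumes "i < DIM('e)"
  shows "(of_coords (y(i := t)) :: 'e::euclidean_space) = of_coords y + (t - y i) *\<^sub>R basis_list ! i"
proof -
  have "(of_coords (y(i := t)) :: 'e) = (\<Sum>j<DIM('e). y j *\<^sub>R basis_list ! j + (if j = i then (t - y i) *\<^sub>R basis_list ! i else 0))"
    unfolding of_coords_def by (rule sum.cong) (auto simp: algebra_simps)
  also have "\<dots> = of_coords y + (t - y i) *\<^sub>R basis_list ! i"
    using assms by (simp add: sum.distrib of_coords_def)
  finally show ?thesis .
qed

lemma has_real_derivative_coordinate:
  fixes f :: "'e::euclidean_space \<Rightarrow> real"
  assumes "i < DIM('e)" and f: "(f has_derivative f') (at (of_coords y))"
  shows "((\<lambda>t. f (of_coords (y(i := t)))) has_real_derivative f' (basis_list ! i)) (at (y i))"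
proof -
  have g: "((\<lambda>t. of_coords y + (t - y i) *\<^sub>R basis_list ! i :: 'e) has_derivative (\<lambda>t. t *\<^sub>R basis_list ! i)) (at (y i))"
    by (auto intro!: derivative_eq_intros)
  have f2: "(f has_derivative f') (at (of_coords y + (y i - y i) *\<^sub>R basis_list ! i))" using f by simp
  have "((\<lambda>t. f (of_coords y + (t - y i) *\<^sub>R basis_list ! i)) has_derivative (\<lambda>t. f' (t *\<^sub>R basis_list ! i))) (at (y i))"
    by (rule has_derivative_compose[OF g f2])
  then show ?thesis
    using linear_scale[OF has_derivative_linear[OF f]]
    by (simp add: of_coords_fun_upd[OF assms(1)] has_field_derivative_def mult.commute[of _ "f' _"])
qed

lemma partial_deriv_eq:
  fixes f :: "'e::euclidean_space \<Rightarrow> real"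
  assumes "i < DIM('e)" and "(f has_derivative f') (at (of_coords y))"
  shows "partial_deriv i (\<lambda>y. f (of_coords y)) y = f' (basis_list ! i)"
  unfolding partial_deriv_def by (rule DERIV_imp_deriv[OF has_real_derivative_coordinate[OF assms]])

text \<open>
  Partial derivatives are an admissible operation; a directional derivative is a combination of them
  with constant coefficients.
\<close>

lemma constructible_on_derivative:
  fixes f :: "'e::euclidean_space \<Rightarrow> real"
  assumes S: "open S" and f: "constructible_on D S f"
    and f': "\<And>x. x \<in> S \<Longrightarrow> (f has_derivative f' x) (at x)"
  shows "constructible_on D S (\<lambda>x. f' x v)"
proof -
  have b: "constructible_on D S (\<lambda>x. f' x b)" if b: "b \<in> Basis" for b :: 'e
  proof -
    obtain i where i: "i < DIM('e)" "b = basis_list ! i" using Basis_eq_basis_list[OF b] .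
    show ?thesis unfolding constructible_on_def
    proof (rule known.restriction[OF known.differentiation[OF f[unfolded constructible_on_def] i(1)] openin_to_coords[OF S]])
      fix y assume "y \<in> to_coords ` S"
      then show "f' (of_coords y) b = partial_deriv i (\<lambda>y. f (of_coords y)) y"
        using partial_deriv_eq[OF i(1) f', of y] i(2) by auto
    qed simp
  qed
  have c: "constructible_on D S (\<lambda>x. \<Sum>b\<in>Basis. (v \<bullet> b) * f' x b)"
    by (intro constructible_on_sum[OF S] constructible_on_mult constructible_on_const[OF S] b)
  show ?thesis
  proof (rule constructible_on_subset[OF c S subset_refl])
    fix x assume "x \<in> S"
    then show "f' x v = (\<Sum>b\<in>Basis. (v \<bullet> b) * f' x b)"
      by (intro linear_real_euclidean_sum has_derivative_linear[OF f'])
  qed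
qed

text \<open>
  The inversion rule for an injective \<open>G\<close> between spaces of the same dimension: being immersive means
  here that the kernel of \<open>G'\<close> is trivial.
\<close>

lemma constructible_on_inversion:
  fixes G :: "'e::euclidean_space \<Rightarrow> 'e" and h y :: "'d::euclidean_space \<Rightarrow> 'e"
  assumes V: "open V" and W: "open W"
    and G: "\<And>b. b \<in> Basis \<Longrightarrow> constructible_on D V (\<lambda>x. G x \<bullet> b)" and inj: "inj_on G V"
    and G': "\<And>x. x \<in> V \<Longrightarrow> (G has_derivative G' x) (at x)"
    and reg: "\<And>x v. x \<in> V \<Longrightarrow> G' x v = 0 \<Longrightarrow> v = 0"
    and y: "\<And>b. b \<in> Basis \<Longrightarrow> constructible_on D W (\<lambda>w. y w \<bullet> b)"
    and h: "continuous_on W h" "\<And>w. w \<in> W \<Longrightarrow> h w \<in> V \<and> G (h w) = y w" and b: "b \<in> Basis"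
  shows "constructible_on D W (\<lambda>w. h w \<bullet> b)"
proof -
  let ?k = "DIM('e)"
  let ?c = "\<lambda>(f::_ \<Rightarrow> 'e) j y. f y \<bullet> basis_list ! j"
  obtain i where i: "i < ?k" "b = basis_list ! i" using Basis_eq_basis_list[OF b] .
  have "known D DIM('d) (to_coords ` W) (?c (\<lambda>w. h (of_coords w)) i)"
  proof (rule known.inversion[where m = ?k and k = ?k and V = "to_coords ` V"
        and g = "?c (\<lambda>x. G (of_coords x))" and y = "?c (\<lambda>w. y (of_coords w))"])
    show "known D ?k (to_coords ` V) (?c (\<lambda>x. G (of_coords x)) j)" if "j < ?k" for j
      using G[OF basis_list_in_Basis[OF that]] by (simp add: constructible_on_def)
    show "known D DIM('d) (to_coords ` W) (?c (\<lambda>w. y (of_coords w)) j)" if "j < ?k" for j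
      using y[OF basis_list_in_Basis[OF that]] by (simp add: constructible_on_def)
    show "openin (Euclidean_space ?k) (to_coords ` V)" "openin (Euclidean_space DIM('d)) (to_coords ` W)"
      by (rule openin_to_coords[OF V], rule openin_to_coords[OF W])
    have injc: "inj (to_coords :: 'e \<Rightarrow> _)" by (rule inj_on_inverseI[of _ of_coords]) simp
    show "inj_on (tuple ?k (?c (\<lambda>x. G (of_coords x)))) (to_coords ` V)"
    proof (rule inj_onI)
      fix p q assume "p \<in> to_coords ` V" "q \<in> to_coords ` V"
      then obtain x z where xz: "p = to_coords x" "q = to_coords z" "x \<in> V" "z \<in> V" by blast
      assume "tuple ?k (?c (\<lambda>x. G (of_coords x))) p = tuple ?k (?c (\<lambda>x. G (of_coords x))) q"
      then have "to_coords (G x) = to_coords (G z)" by (simp add: tuple_to_coords xz)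
      then have "G x = G z" using injc by (simp add: inj_eq)
      then show "p = q" using inj xz by (simp add: inj_on_eq_iff)
    qed
    show "immersive ?k ?k (?c (\<lambda>x. G (of_coords x))) p" if "p \<in> to_coords ` V" for p
      unfolding immersive_def
    proof (intro allI impI)
      fix c j assume c: "\<forall>j<?k. (\<Sum>i<?k. c i * partial_deriv i (?c (\<lambda>x. G (of_coords x)) j) p) = 0"
        and j: "j < ?k"
      obtain x where x: "p = to_coords x" "x \<in> V" using \<open>p \<in> to_coords ` V\<close> by blast
      let ?v = "\<Sum>i<?k. c i *\<^sub>R (basis_list ! i :: 'e)"
      have lin: "linear (G' x)" by (rule has_derivative_linear[OF G'[OF x(2)]])
      have "G' x ?v \<bullet> basis_list ! j = 0" if "j < ?k" for j
      proof -
        have "partial_deriv i (?c (\<lambda>x. G (of_coords x)) j) p = G' x (basis_list ! i) \<bullet> basis_list ! j" if "i < ?k" for i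
        proof (rule partial_deriv_eq[OF that, of "\<lambda>x. G x \<bullet> basis_list ! j" "\<lambda>v. G' x v \<bullet> basis_list ! j"])
          have "((\<lambda>x. G x \<bullet> basis_list ! j) has_derivative (\<lambda>v. G' x v \<bullet> basis_list ! j)) (at x)"
            by (rule bounded_linear.has_derivative[OF bounded_linear_inner_left G'[OF x(2)]])
          then show "((\<lambda>x. G x \<bullet> basis_list ! j) has_derivative (\<lambda>v. G' x v \<bullet> basis_list ! j)) (at (of_coords p))"
            by (simp add: x(1))
        qed
        then have "(\<Sum>i<?k. c i * (G' x (basis_list ! i) \<bullet> basis_list ! j))
            = (\<Sum>i<?k. c i * partial_deriv i (?c (\<lambda>x. G (of_coords x)) j) p)"
          by (intro sum.cong refl) simp
        also have "\<dots> = 0" using c that by blast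
        finally have "(\<Sum>i<?k. c i * (G' x (basis_list ! i) \<bullet> basis_list ! j)) = 0" .
        then show ?thesis by (simp add: linear_sum[OF lin] linear_scale[OF lin] inner_sum_left)
      qed
      note orth = this
      have "G' x ?v = 0"
      proof (rule euclidean_eqI)
        fix b :: 'e assume "b \<in> Basis"
        then obtain j where "j < ?k" "b = basis_list ! j" by (rule Basis_eq_basis_list)
        then show "G' x ?v \<bullet> b = 0 \<bullet> b" using orth[of j] by simp
      qed
      then have "?v = 0" by (rule reg[OF x(2)])
      moreover have "?v \<bullet> basis_list ! j = c j"
        using inner_of_coords[OF j, of c] by (simp add: of_coords_def)
      ultimately show "c j = 0" by simp
    qed
    show "continuous_map (subtopology (Euclidean_space DIM('d)) (to_coords ` W)) euclideanreal
        (?c (\<lambda>w. h (of_coords w)) j)" if "j < ?k" for j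
    proof -
      have "continuous_on (to_coords ` W) (\<lambda>w. h (of_coords w))"
        by (rule continuous_on_compose2[OF h(1) continuous_on_of_coords]) auto
      then have "continuous_on (to_coords ` W) (?c (\<lambda>w. h (of_coords w)) j)"
        by (intro continuous_intros)
      moreover have "subtopology (Euclidean_space DIM('d)) (to_coords ` W) = top_of_set (to_coords ` W)"
      proof -
        have "to_coords ` W \<subseteq> {y. \<forall>i\<ge>DIM('d). y i = (0::real)}"
          by (auto simp: to_coords_def)
        then show ?thesis
          by (simp add: Euclidean_space_eq_top_of_set subtopology_subtopology Int_absorb1)
      qed
      ultimately show ?thesis by simp
    qed
    show "tuple ?k (?c (\<lambda>w. h (of_coords w))) w \<in> to_coords ` V \<and>
        tuple ?k (?c (\<lambda>x. G (of_coords x))) (tuple ?k (?c (\<lambda>w. h (of_coords w))) w) = tuple ?k (?c (\<lambda>w. y (of_coords w))) w"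
      if "w \<in> to_coords ` W" for w
      using that h(2) by (auto simp: tuple_to_coords)
    show "i < ?k" by (rule i(1))
  qed
  then show ?thesis by (simp add: i constructible_on_def)
qed

text \<open>
  The quadrature rule when all variables are integrated, so that there are no parameters.
\<close>

lemma constructible_on_primitive:
  fixes F :: "'e::euclidean_space \<Rightarrow> real"
  assumes S: "open S" and A: "\<And>b. b \<in> Basis \<Longrightarrow> constructible_on D S (A b)"
    and star: "\<And>x s. x \<in> S \<Longrightarrow> s \<in> {0..1} \<Longrightarrow> a + s *\<^sub>R (x - a) \<in> S"
    and F': "\<And>x. x \<in> S \<Longrightarrow> (F has_derivative (\<lambda>v. \<Sum>b\<in>Basis. (v \<bullet> b) * A b x)) (at x)"
    and Fa: "F a = 0"
  shows "constructible_on D S F"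
  unfolding constructible_on_def
proof (rule known.quadrature[where I = "{..<DIM('e)}" and a = "to_coords a" and f = "\<lambda>i y. A (basis_list ! i) (of_coords y)"])
  show "known D DIM('e) (to_coords ` S) (\<lambda>y. A (basis_list ! i) (of_coords y))" if "i \<in> {..<DIM('e)}" for i
    using A[of "basis_list ! i"] that by (simp add: constructible_on_def basis_list_in_Basis)
  show "openin (Euclidean_space DIM('e)) (to_coords ` S)" by (rule openin_to_coords[OF S])
next
  fix p and s :: real assume p: "p \<in> to_coords ` S" and s: "s \<in> {0..1}"
  then obtain x where x: "p = to_coords x" "x \<in> S" by blast
  have "(\<lambda>i. if i \<in> {..<DIM('e)} then to_coords a i + s * (p i - to_coords a i) else p i) = to_coords (a + s *\<^sub>R (x - a))"
    by (auto simp: x(1) to_coords_def fun_eq_iff inner_add_left inner_diff_left)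
  then show "(\<lambda>i. if i \<in> {..<DIM('e)} then to_coords a i + s * (p i - to_coords a i) else p i) \<in> to_coords ` S"
    using star[OF x(2) s] by simp
next
  fix p i assume p: "p \<in> to_coords ` S" and i: "i \<in> {..<DIM('e)}"
  then obtain x where x: "p = to_coords x" "x \<in> S" by blast
  have "(\<Sum>b\<in>Basis. ((basis_list ! i :: 'e) \<bullet> b) * A b x) = A (basis_list ! i) x"
    using i by (simp add: inner_Basis basis_list_in_Basis if_distrib[of "\<lambda>t. t * _"] cong: if_cong)
  then show "((\<lambda>t. F (of_coords (p(i := t)))) has_real_derivative A (basis_list ! i) (of_coords p)) (at (p i))"
    using has_real_derivative_coordinate[of i F _ p, OF _ F'[of "of_coords p"]] i x by simp
next
  fix p assume p: "p \<in> to_coords ` S" and eq: "\<And>i. i \<in> {..<DIM('e)} \<Longrightarrow> p i = to_coords a i"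
  have "p = to_coords a"
  proof
    fix i show "p i = to_coords a i"
      using eq[of i] p by (cases "i < DIM('e)") (auto simp: to_coords_def)
  qed
  then show "F (of_coords p) = 0" using Fa by simp
qed simp

lemma constructible_on_real_imp_known:
  assumes "constructible_on D S (f :: real \<Rightarrow> real)"
  shows "known D 1 {y \<in> topspace (Euclidean_space 1). y 0 \<in> S} (\<lambda>y. f (y 0))"
proof -
  have "set (basis_list :: real list) = {1}" "length (basis_list :: real list) = 1"
    using basis_list_props[where 'e = real] by auto
  moreover have "xs = [1]" if "set xs = {1}" "length xs = 1" for xs :: "real list"
    using that by (cases xs) auto
  ultimately have l: "(basis_list :: real list) = [1]" by blast
  have o: "of_coords = (\<lambda>y. y 0 :: real)"
    unfolding of_coords_def l by (rule ext) simp
  show ?thesis using assms unfolding constructible_on_def to_coords_image o DIM_real .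
qed

lemma constructible_on_component_funs:
  fixes f :: "'e::euclidean_space \<Rightarrow> 'f::euclidean_space"
  assumes "component_funs S f \<subseteq> D" "b \<in> Basis"
  shows "constructible_on D S (\<lambda>x. f x \<bullet> b)"
  unfolding constructible_on_def
  by (rule known.data) (use assms in \<open>auto simp: component_funs_def\<close>)

section \<open>Forms and fields in product coordinates\<close>

text \<open>
  The exterior derivative of a form on an open set of a vector space, evaluated on constant vectors.
\<close>

definition ext_d :: "('z::real_normed_vector \<Rightarrow> 'z \<Rightarrow> real) \<Rightarrow> 'z \<Rightarrow> 'z \<Rightarrow> 'z \<Rightarrow> real" where
  "ext_d E z a b = dirder (\<lambda>z. E z b) z a - dirder (\<lambda>z. E z a) z b"

lemma dirder_cong:
  assumes S: "open S" and x: "x \<in> S" and f: "smooth_on S f" and eq: "\<And>y. y \<in> S \<Longrightarrow> f y = g y"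
  shows "dirder f x v = dirder g x v"
proof -
  have "(g has_derivative dirder f x) (at x)"
    using has_derivative_transform_within_open[where f = f and g = g and s = S,
        OF smooth_on_has_derivative[OF f S x] S x eq] .
  then show ?thesis by (rule dirder_eq[symmetric])
qed

text \<open>
  Differentiating a family of linear forms with respect to its parameter gives linear forms.
\<close>

lemma linear_dirder_family:
  fixes E :: "'z::real_normed_vector \<Rightarrow> 'w::real_vector \<Rightarrow> real"
  assumes S: "open S" and x: "x \<in> S" and lin: "\<And>y. y \<in> S \<Longrightarrow> linear (E y)"
    and sm: "\<And>w. smooth_on S (\<lambda>y. E y w)"
  shows "linear (\<lambda>w. dirder (\<lambda>y. E y w) x a)"
proof (rule linearI)
  note d = smooth_on_has_derivative[OF sm S x]
  show "dirder (\<lambda>y. E y (v + w)) x a = dirder (\<lambda>y. E y v) x a + dirder (\<lambda>y. E y w) x a" for v w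
  proof -
    have "dirder (\<lambda>y. E y (v + w)) x a = dirder (\<lambda>y. E y v + E y w) x a"
      by (rule dirder_cong[OF S x sm]) (rule linear_add[OF lin])
    also have "\<dots> = dirder (\<lambda>y. E y v) x a + dirder (\<lambda>y. E y w) x a"
      by (rule dirder_eq[OF has_derivative_add[OF d d]])
    finally show ?thesis .
  qed
  show "dirder (\<lambda>y. E y (r *\<^sub>R w)) x a = r *\<^sub>R dirder (\<lambda>y. E y w) x a" for r w
  proof -
    have "dirder (\<lambda>y. E y (r *\<^sub>R w)) x a = dirder (\<lambda>y. r *\<^sub>R E y w) x a"
      by (rule dirder_cong[OF S x sm]) (rule linear_scale[OF lin])
    also have "\<dots> = r *\<^sub>R dirder (\<lambda>y. E y w) x a"
      by (rule dirder_eq[OF has_derivative_scaleR_right[OF d]])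
    finally show ?thesis .
  qed
qed

lemma linear_partial1:
  assumes "linear (g :: 'n::real_vector \<times> 'l::real_vector \<Rightarrow> real)" shows "linear (\<lambda>v. g (v, 0))"
proof -
  have "linear (\<lambda>v :: 'n. (v, 0 :: 'l))" by (simp add: linear_iff)
  from linear_compose[OF this assms] show ?thesis by (simp add: o_def)
qed

lemma linear_partial2:
  assumes "linear (g :: 'n::real_vector \<times> 'l::real_vector \<Rightarrow> real)" shows "linear (\<lambda>w. g (0, w))"
proof -
  have "linear (\<lambda>w :: 'l. (0 :: 'n, w))" by (simp add: linear_iff)
  from linear_compose[OF this assms] show ?thesis by (simp add: o_def)
qed

lemma slice_has_derivative:
  fixes h :: "'n::euclidean_space \<times> 'l::euclidean_space \<Rightarrow> real"
  assumes "open Z" "smooth_on Z h" "(x, y) \<in> Z"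
  shows "((\<lambda>x. h (x, y)) has_derivative (\<lambda>v. dirder h (x, y) (v, 0))) (at x)"
    "((\<lambda>y. h (x, y)) has_derivative (\<lambda>w. dirder h (x, y) (0, w))) (at y)"
proof -
  note h = smooth_on_has_derivative[OF assms(2,1,3)]
  have "((\<lambda>x. (x, y)) has_derivative (\<lambda>v. (v, 0))) (at x)"
    by (auto intro!: derivative_eq_intros)
  from has_derivative_compose[OF this h]
  show "((\<lambda>x. h (x, y)) has_derivative (\<lambda>v. dirder h (x, y) (v, 0))) (at x)" .
  have "((\<lambda>y. (x, y)) has_derivative (\<lambda>v. (0, v))) (at y)"
    by (auto intro!: derivative_eq_intros)
  from has_derivative_compose[OF this h]
  show "((\<lambda>y. h (x, y)) has_derivative (\<lambda>w. dirder h (x, y) (0, w))) (at y)" .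
qed

lemma slice_dirder:
  fixes h :: "'n::euclidean_space \<times> 'l::euclidean_space \<Rightarrow> real"
  assumes "open Z" "smooth_on Z h" "(x, y) \<in> Z"
  shows "dirder (\<lambda>x. h (x, y)) x v = dirder h (x, y) (v, 0)"
  by (rule dirder_eq[OF slice_has_derivative(1)[OF assms]])

lemma slice_smooth:
  fixes h :: "'n::euclidean_space \<times> 'l::euclidean_space \<Rightarrow> real"
  assumes "open Z" "smooth_on Z h" "open X" "\<And>x. x \<in> X \<Longrightarrow> (x, y) \<in> Z"
  shows "smooth_on X (\<lambda>x. h (x, y))"
proof (rule smooth_on_compose[OF assms(3,1) _ _ assms(2)])
  show "(\<lambda>x. (x, y)) ` X \<subseteq> Z" using assms(4) by blast
  show "smooth_on X (\<lambda>x. (x, y))"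
    by (intro smooth_on_Pair[OF assms(3)] smooth_on_bounded_linear[OF bounded_linear_ident] smooth_on_const)
qed

lemma slice_smooth2:
  fixes h :: "'n::euclidean_space \<times> 'l::euclidean_space \<Rightarrow> real"
  assumes "open Z" "smooth_on Z h" "open Y" "\<And>y. y \<in> Y \<Longrightarrow> (x, y) \<in> Z"
  shows "smooth_on Y (\<lambda>y. h (x, y))"
proof (rule smooth_on_compose[OF assms(3,1) _ _ assms(2)])
  show "(\<lambda>y. (x, y)) ` Y \<subseteq> Z" using assms(4) by blast
  show "smooth_on Y (\<lambda>y. (x, y))"
    by (intro smooth_on_Pair[OF assms(3)] smooth_on_bounded_linear[OF bounded_linear_ident] smooth_on_const)
qed

lemma constructible_on_curve_in_slice:
  fixes h :: "'n::euclidean_space \<times> 'l::euclidean_space \<Rightarrow> real" and g :: "'d::euclidean_space \<Rightarrow> 'n"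
  assumes "constructible_on D Z h" "open X" "\<And>x. x \<in> X \<Longrightarrow> (g x, y) \<in> Z"
    "\<And>b. b \<in> Basis \<Longrightarrow> constructible_on D X (\<lambda>x. g x \<bullet> b)"
  shows "constructible_on D X (\<lambda>x. h (g x, y))"
proof (rule constructible_on_compose[OF assms(2,1), where g = "\<lambda>x. (g x, y)"])
  show "(\<lambda>x. (g x, y)) ` X \<subseteq> Z" using assms(3) by blast
  have "constructible_on D X (\<lambda>x. g x \<bullet> v)" for v
    by (rule constructible_on_compose[OF assms(2) constructible_on_inner[OF open_UNIV] _ assms(4)]) auto
  then show "constructible_on D X (\<lambda>x. (g x, y) \<bullet> b)" for b
    using constructible_on_add[OF _ constructible_on_const[OF assms(2)]] by (simp add: inner_prod_def)
qed

lemma constructible_on_slice: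
  fixes h :: "'n::euclidean_space \<times> 'l::euclidean_space \<Rightarrow> real"
  assumes "constructible_on D Z h" "open X" "\<And>x. x \<in> X \<Longrightarrow> (x, y) \<in> Z"
  shows "constructible_on D X (\<lambda>x. h (x, y))"
  by (rule constructible_on_curve_in_slice[OF assms constructible_on_inner[OF assms(2)]])

text \<open>
  For differentials \<open>l\<^sub>i\<close> the map \<open>v \<mapsto> \<Sum>\<^sub>i l\<^sub>i(v) l\<^sub>i\<close> is positive semidefinite with kernel the joint kernel of
  the \<open>l\<^sub>i\<close>. Hence, if the \<open>l\<^sub>i\<close> have no common zero, the functions that they are differentials of can be
  combined, with constant coefficients, to a local diffeomorphism.
\<close>

lemma normal_map_kernel:
  fixes l :: "'i \<Rightarrow> 'e::euclidean_space \<Rightarrow> real"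
  assumes I: "finite I" and lin: "\<And>i. i \<in> I \<Longrightarrow> linear (l i)"
  shows "(\<Sum>b\<in>Basis. (\<Sum>i\<in>I. l i b * l i v) *\<^sub>R b) \<bullet> v = (\<Sum>i\<in>I. (l i v)\<^sup>2)"
proof -
  have "(\<Sum>b\<in>Basis. (\<Sum>i\<in>I. l i b * l i v) *\<^sub>R b) \<bullet> v = (\<Sum>b\<in>Basis. \<Sum>i\<in>I. ((v \<bullet> b) * l i b) * l i v)"
    unfolding inner_sum_left inner_scaleR_left sum_distrib_right
    by (intro sum.cong refl) (simp add: inner_commute mult_ac)
  also have "\<dots> = (\<Sum>i\<in>I. (\<Sum>b\<in>Basis. (v \<bullet> b) * l i b) * l i v)"
    by (subst sum.swap) (simp add: sum_distrib_right)
  also have "\<dots> = (\<Sum>i\<in>I. (l i v)\<^sup>2)"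
    by (rule sum.cong[OF refl]) (simp add: linear_real_euclidean_sum[OF lin, symmetric] power2_eq_square)
  finally show ?thesis .
qed

text \<open>
  The preimage of a line under a constructible local diffeomorphism is a constructible curve. Its
  velocity is pinned down by \<open>G'\<close>, so a curve is recognized as a solution of a differential equation by
  comparing images under \<open>G'\<close>.
\<close>

lemma line_preimage:
  fixes G :: "'e::euclidean_space \<Rightarrow> 'e"
  assumes S: "open S" and x0: "x0 \<in> S"
    and G': "\<And>x. x \<in> S \<Longrightarrow> (G has_derivative G' x) (at x)"
    and cont: "\<And>v. continuous_on S (\<lambda>x. G' x v)"
    and inj: "\<And>v. G' x0 v = 0 \<Longrightarrow> v = 0"
    and con: "\<And>b. b \<in> Basis \<Longrightarrow> constructible_on D S (\<lambda>x. G x \<bullet> b)"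
  shows "\<exists>\<epsilon> x. \<epsilon> > 0 \<and> x 0 = x0 \<and>
    (\<forall>t\<in>{-\<epsilon><..<\<epsilon>}. x t \<in> S \<and> G (x t) = G x0 + t *\<^sub>R c \<and> (\<forall>v. G' (x t) v = 0 \<longrightarrow> v = 0) \<and>
       (\<exists>d. (x has_vector_derivative d) (at t) \<and> G' (x t) d = c)) \<and>
    (\<forall>b\<in>Basis. constructible_on D {-\<epsilon><..<\<epsilon>} (\<lambda>t. x t \<bullet> b))"
proof -
  obtain U V h where U: "open U" "U \<subseteq> S" "x0 \<in> U" and V: "open V" "G x0 \<in> V" and hom: "homeomorphism U V G h"
    and reg: "\<And>x v. x \<in> U \<Longrightarrow> G' x v = 0 \<Longrightarrow> v = 0"
    and h': "\<And>y. y \<in> V \<Longrightarrow> \<exists>h'. (h has_derivative h') (at y) \<and> (\<forall>w. G' (h y) (h' w) = w)"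
    using local_inverse[OF S x0 G' cont inj] by metis
  let ?l = "\<lambda>t::real. G x0 + t *\<^sub>R c"
  have cl: "continuous_on UNIV ?l" by (intro continuous_intros)
  have "open (?l -` V)" by (rule open_vimage[OF V(1) cl])
  moreover have "0 \<in> ?l -` V" using V(2) by simp
  ultimately obtain \<epsilon> where e: "\<epsilon> > 0" "ball 0 \<epsilon> \<subseteq> ?l -` V" using open_contains_ball by blast
  have lV: "?l t \<in> V" if "t \<in> {-\<epsilon><..<\<epsilon>}" for t
    using that e(2) by (auto simp: subset_iff dist_real_def)
  have hU: "h y \<in> U" "G (h y) = y" if "y \<in> V" for y using hom that by (auto simp: homeomorphism_def)
  have hom': "continuous_on V h" "h (G x0) = x0" using hom U(3) by (auto simp: homeomorphism_def)
  show ?thesis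
  proof (intro exI[of _ \<epsilon>] exI[of _ "\<lambda>t. h (?l t)"] conjI[OF e(1)] conjI ballI)
    show "h (?l 0) = x0" using hom'(2) by simp
    fix t assume t: "t \<in> {-\<epsilon><..<\<epsilon>}"
    obtain k where k: "(h has_derivative k) (at (?l t))" "\<And>w. G' (h (?l t)) (k w) = w"
      using h'[OF lV[OF t]] by blast
    have "(?l has_derivative (\<lambda>t. t *\<^sub>R c)) (at t)" by (auto intro!: derivative_eq_intros)
    from has_derivative_compose[OF this k(1)]
    have "((\<lambda>t. h (?l t)) has_vector_derivative k c) (at t)"
      using linear_scale[OF has_derivative_linear[OF k(1)]] by (simp add: has_vector_derivative_def)
    then show "\<exists>d. ((\<lambda>t. h (?l t)) has_vector_derivative d) (at t) \<and> G' (h (?l t)) d = c"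
      using k(2) by blast
    show "h (?l t) \<in> S" "G (h (?l t)) = ?l t" using hU[OF lV[OF t]] U(2) by blast+
    show "\<forall>v. G' (h (?l t)) v = 0 \<longrightarrow> v = 0" using hU[OF lV[OF t]] reg by blast
  next
    fix b :: 'e assume b: "b \<in> Basis"
    show "constructible_on D {-\<epsilon><..<\<epsilon>} (\<lambda>t. h (?l t) \<bullet> b)"
    proof (rule constructible_on_inversion[OF U(1) _ _ _ G' reg, where y = ?l])
      show "constructible_on D U (\<lambda>x. G x \<bullet> b)" if "b \<in> Basis" for b
        by (rule constructible_on_subset[OF con[OF that] U(1,2)]) simp
      show "inj_on G U" using hom by (metis homeomorphism_def inj_on_inverseI)
      show "constructible_on D {-\<epsilon><..<\<epsilon>} (\<lambda>t. ?l t \<bullet> b)" for b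
      proof -
        have "constructible_on D {-\<epsilon><..<\<epsilon>} (\<lambda>t::real. G x0 \<bullet> b + t \<bullet> (c \<bullet> b))"
          by (intro constructible_on_add constructible_on_const constructible_on_inner open_greaterThanLessThan)
        then show ?thesis by (simp add: inner_add_left)
      qed
      show "continuous_on {-\<epsilon><..<\<epsilon>} (\<lambda>t. h (?l t))"
        by (rule continuous_on_compose2[OF hom'(1), where f = ?l]) (use lV in \<open>auto intro!: continuous_intros\<close>)
      show "h (?l t) \<in> U \<and> G (h (?l t)) = ?l t" if "t \<in> {-\<epsilon><..<\<epsilon>}" for t
        using hU[OF lV[OF that]] by simp
    qed (use U(2) b in auto)
  qed
qed

text \<open>
  The equation \<open>x' = u (x, y0)\<close> has a constructible local solution through \<open>x0\<close> that stays in \<open>Z\<close>.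
\<close>

definition solved_by_quadratures ::
    "local_fun set \<Rightarrow> ('n::euclidean_space \<times> 'l::euclidean_space) set \<Rightarrow> ('n \<times> 'l \<Rightarrow> 'n) \<Rightarrow> 'n \<Rightarrow> 'l \<Rightarrow> bool" where
  "solved_by_quadratures D Z u x0 y0 \<longleftrightarrow> (\<exists>\<epsilon>>0. \<exists>x. x 0 = x0 \<and>
     (\<forall>t\<in>{-\<epsilon><..<\<epsilon>}. (x t, y0) \<in> Z \<and> (x has_vector_derivative u (x t, y0)) (at t)) \<and>
     (\<forall>b\<in>Basis. constructible_on D {-\<epsilon><..<\<epsilon>} (\<lambda>t. x t \<bullet> b)))"

text \<open>
  A contact form \<open>E\<close> and a Hamiltonian \<open>K\<close> on an open set \<open>Z\<close> of a product, such that the contact field of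
  \<open>K\<close> is \<open>(u, 0)\<close>, that is, tangent to the leaves on which the second coordinate is constant; \<open>f\<close> stands for
  the derivative of \<open>K\<close> along the Reeb field, whose value at \<open>z\<close> is the vector in \<open>reeb\<close>.
\<close>

locale contact_coords =
  fixes D :: "local_fun set" and Z :: "('n::euclidean_space \<times> 'l::euclidean_space) set"
    and E :: "'n \<times> 'l \<Rightarrow> 'n \<times> 'l \<Rightarrow> real" and K f :: "'n \<times> 'l \<Rightarrow> real" and u :: "'n \<times> 'l \<Rightarrow> 'n"
    and x0 :: 'n and y0 :: 'l
  assumes Z: "open Z" and z0: "(x0, y0) \<in> Z"
    and E_linear: "\<And>z. z \<in> Z \<Longrightarrow> linear (E z)"
    and E_smooth: "\<And>w. smooth_on Z (\<lambda>z. E z w)" and K_smooth: "smooth_on Z K"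
    and E_constructible: "\<And>w. constructible_on D Z (\<lambda>z. E z w)" and K_constructible: "constructible_on D Z K"
    and contact: "\<And>z a. z \<in> Z \<Longrightarrow> E z a = 0 \<Longrightarrow> (\<And>b. ext_d E z a b = 0) \<Longrightarrow> a = 0"
    and reeb: "\<And>z. z \<in> Z \<Longrightarrow> \<exists>r. E z r = 1 \<and> (\<forall>b. ext_d E z r b = 0) \<and> dirder K z r = f z"
    and f_nonzero: "\<And>z. z \<in> Z \<Longrightarrow> f z \<noteq> 0" and f_continuous: "continuous_on Z f"
    and field: "\<And>z b. z \<in> Z \<Longrightarrow> ext_d E z (u z, 0) b = - dirder K z b + f z * E z b"
    and field_K: "\<And>z. z \<in> Z \<Longrightarrow> E z (u z, 0) = K z"

lemma ext_d_self [simp]: "ext_d E z a a = 0"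
  by (simp add: ext_d_def)

lemma ext_d_swap: "ext_d E z a b = - ext_d E z b a"
  by (simp add: ext_d_def)

lemma linear_ext_d:
  assumes S: "open S" and x: "x \<in> S" and lin: "\<And>y. y \<in> S \<Longrightarrow> linear (E y)"
    and sm: "\<And>w. smooth_on S (\<lambda>y. E y w)"
  shows "linear (ext_d E x a)"
  unfolding ext_d_def
  by (rule linear_compose_sub[OF linear_dirder_family[OF S x lin sm] smooth_on_dirder_linear[OF sm S x]])

lemma ext_d_quotient:
  assumes S: "open S" and x: "x \<in> S" and E: "\<And>w. smooth_on S (\<lambda>y. E y w)" and K: "smooth_on S K"
    and Kx: "K x \<noteq> 0"
  shows "ext_d (\<lambda>y w. E y w / K y) x a b =
    ext_d E x a b / K x - (dirder K x a * E x b - dirder K x b * E x a) / (K x)\<^sup>2"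
proof -
  have "dirder (\<lambda>y. E y w / K y) x v = (dirder (\<lambda>y. E y w) x v * K x - E x w * dirder K x v) / (K x * K x)" for v w
    by (rule dirder_eq[OF has_derivative_divide'[OF smooth_on_has_derivative[OF E S x]
          smooth_on_has_derivative[OF K S x] Kx]])
  then show ?thesis using Kx unfolding ext_d_def by (simp only:) (simp add: power2_eq_square field_simps)
qed

lemma (in contact_coords) field_of_K: "z \<in> Z \<Longrightarrow> dirder K z (u z, 0) = f z * K z"
  using field[of z "(u z, 0)"] field_K[of z] by simp

text \<open>
  With \<open>\<theta> = E/K\<close>, the primitive \<open>W\<close> of \<open>\<theta>\<close> on the leaf grows at unit speed and the functions
  \<open>p w = \<theta>(0, w) - P w\<close> are constant along the field, where \<open>P w\<close> is the primitive on the leaf of the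
  derivative of \<open>\<theta>\<close> in the direction \<open>w\<close>. They form an immersion because \<open>\<theta>\<close> is again a contact form.
\<close>

lemma (in contact_coords) solved_where_K_nonzero:
  assumes K0: "\<And>z. z \<in> Z \<Longrightarrow> K z \<noteq> 0"
    and isotropic: "\<And>z a b. z \<in> Z \<Longrightarrow> ext_d (\<lambda>z w. E z w / K z) z (a, 0) (b, 0) = 0"
  shows "solved_by_quadratures D Z u x0 y0"
proof -
  define T where "T = (\<lambda>z w. E z w / K z)"
  have T_smooth: "smooth_on Z (\<lambda>z. T z w)" for w
    unfolding T_def by (rule smooth_on_divide[OF Z E_smooth K_smooth K0])
  have T_con: "constructible_on D Z (\<lambda>z. T z w)" for w
    unfolding T_def by (rule constructible_on_divide[OF E_constructible K_constructible K0])
  have T_linear: "linear (T z)" if "z \<in> Z" for z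
    unfolding T_def divide_inverse mult.commute[of _ "inverse _"]
    using linear_compose_scale_right[OF E_linear[OF that], of "inverse (K z)"] by simp
  have dT: "ext_d T z a b = ext_d E z a b / K z - (dirder K z a * E z b - dirder K z b * E z a) / (K z)\<^sup>2"
    if "z \<in> Z" for z a b
    unfolding T_def by (rule ext_d_quotient[OF Z that E_smooth K_smooth K0[OF that]])
  have T_u: "T z (u z, 0) = 1" if "z \<in> Z" for z
    using K0[OF that] field_K[OF that] by (simp add: T_def)
  have dT_u: "ext_d T z (u z, 0) b = 0" if "z \<in> Z" for z b
    using K0[OF that] unfolding dT[OF that] field[OF that] field_of_K[OF that] field_K[OF that]
    by (simp add: power2_eq_square field_simps)
  have T_contact: "a = 0" if z: "z \<in> Z" and "T z a = 0" and b: "\<And>b. ext_d T z a b = 0" for z a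
  proof -
    have Ea: "E z a = 0" using that(2) K0[OF z] by (simp add: T_def)
    have e: "ext_d E z a b = dirder K z a * E z b / K z" for b
      using b[of b] K0[OF z] unfolding dT[OF z] Ea by (simp add: power2_eq_square field_simps)
    obtain r where r: "E z r = 1" "\<And>b. ext_d E z r b = 0" using reeb[OF z] by blast
    have "dirder K z a = 0" using e[of r] r(1) ext_d_swap[of E z a r] r(2) K0[OF z] by simp
    then show "a = 0" using contact[OF z Ea] e by simp
  qed
  obtain X Y where XY: "open X" "open Y" "x0 \<in> X" "y0 \<in> Y" "X \<times> Y \<subseteq> Z"
    using open_prod_elim[OF Z z0] by (metis mem_Sigma_iff)
  then obtain r where r: "r > 0" "ball x0 r \<subseteq> X" using open_contains_ball by blast
  define B where "B = ball x0 r"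
  have B: "open B" "convex B" "x0 \<in> B" using r(1) by (auto simp: B_def)
  have BZ: "(x, y0) \<in> Z" if "x \<in> B" for x using that r XY unfolding B_def by blast
  have star: "x0 + s *\<^sub>R (x - x0) \<in> B" if "x \<in> B" "s \<in> {0..1}" for x s
  proof -
    have "(1 - s) *\<^sub>R x0 + s *\<^sub>R x \<in> B" using that by (intro convexD[OF B(2,3)]) auto
    then show ?thesis by (simp add: algebra_simps)
  qed
  have swap: "dirder (\<lambda>z. T z (b, 0)) z (c, 0) = dirder (\<lambda>z. T z (c, 0)) z (b, 0)" if "z \<in> Z" for z b c
    using isotropic[OF that, of b c] unfolding T_def ext_d_def by simp
  obtain W where W: "W x0 = 0"
    "\<And>x. x \<in> B \<Longrightarrow> (W has_derivative (\<lambda>v. \<Sum>b\<in>Basis. (v \<bullet> b) * T (x, y0) (b, 0))) (at x)"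
  proof (rule Poincare_lemma[OF B, where A = "\<lambda>b x. T (x, y0) (b, 0)"])
    show "smooth_on B (\<lambda>x. T (x, y0) (b, 0))" for b
      by (rule slice_smooth[OF Z T_smooth B(1) BZ])
    show "dirder (\<lambda>x. T (x, y0) (b, 0)) x c = dirder (\<lambda>x. T (x, y0) (c, 0)) x b" if "x \<in> B" for b c x
      unfolding slice_dirder[OF Z T_smooth BZ[OF that]] by (rule swap[OF BZ[OF that]])
  qed blast
  have W': "(W has_derivative (\<lambda>v. T (x, y0) (v, 0))) (at x)" if "x \<in> B" for x
    using W(2)[OF that] unfolding linear_real_euclidean_sum[OF linear_partial1[OF T_linear[OF BZ[OF that]]], symmetric] .
  have W_con: "constructible_on D B W"
    by (rule constructible_on_primitive[OF B(1) _ star W(2,1)])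
       (rule constructible_on_slice[OF T_con B(1) BZ])
  define C where "C = (\<lambda>w b x. dirder (\<lambda>z. T z (b, 0)) (x, y0) (0, w))"
  have C_smooth: "smooth_on B (C w b)" for w b
    unfolding C_def by (rule slice_smooth[OF Z smooth_on_dirder[OF T_smooth] B(1) BZ])
  have "\<exists>P. P x0 = 0 \<and> (\<forall>x\<in>B. (P has_derivative (\<lambda>v. \<Sum>b\<in>Basis. (v \<bullet> b) * C w b x)) (at x))" for w
  proof (rule Poincare_lemma[OF B C_smooth])
    fix b c :: 'n and x assume x: "x \<in> B"
    note z = BZ[OF x]
    \<comment> \<open>closedness on the neighbouring leaves, differentiated across them\<close>
    have "dirder (C w b) x c = dirder (\<lambda>z. dirder (\<lambda>z. T z (b, 0)) z (0, w)) (x, y0) (c, 0)"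
      unfolding C_def by (rule slice_dirder[OF Z smooth_on_dirder[OF T_smooth] z])
    also have "\<dots> = dirder (\<lambda>z. dirder (\<lambda>z. T z (b, 0)) z (c, 0)) (x, y0) (0, w)"
      by (rule dirder_symmetric_real[OF Z T_smooth z])
    also have "\<dots> = dirder (\<lambda>z. dirder (\<lambda>z. T z (c, 0)) z (b, 0)) (x, y0) (0, w)"
      by (rule dirder_cong[OF Z z smooth_on_dirder[OF T_smooth] swap])
    also have "\<dots> = dirder (\<lambda>z. dirder (\<lambda>z. T z (c, 0)) z (0, w)) (x, y0) (b, 0)"
      by (rule dirder_symmetric_real[OF Z T_smooth z])
    also have "\<dots> = dirder (C w c) x b"
      unfolding C_def by (rule slice_dirder[OF Z smooth_on_dirder[OF T_smooth] z, symmetric])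
    finally show "dirder (C w b) x c = dirder (C w c) x b" .
  qed blast
  then have "\<forall>w. \<exists>P. P x0 = 0 \<and> (\<forall>x\<in>B. (P has_derivative (\<lambda>v. \<Sum>b\<in>Basis. (v \<bullet> b) * C w b x)) (at x))"
    by (rule allI)
  from choice[OF this] obtain P where P: "\<And>w. P w x0 = 0"
    "\<And>w x. x \<in> B \<Longrightarrow> (P w has_derivative (\<lambda>v. \<Sum>b\<in>Basis. (v \<bullet> b) * C w b x)) (at x)"
    by blast
  have P_con: "constructible_on D B (P w)" for w
    by (rule constructible_on_primitive[OF B(1) _ star P(2,1)])
       (use constructible_on_slice[OF constructible_on_derivative[OF Z T_con smooth_on_has_derivative[OF T_smooth Z]] B(1) BZ]
         in \<open>auto simp: C_def\<close>)
  define p where "p = (\<lambda>w x. T (x, y0) (0, w) - P w x)"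
  have p': "(p w has_derivative (\<lambda>v. ext_d T (x, y0) (v, 0) (0, w))) (at x)" if x: "x \<in> B" for w x
  proof -
    note z = BZ[OF x]
    have "(\<Sum>b\<in>Basis. (v \<bullet> b) * C w b x) = dirder (\<lambda>z. T z (v, 0)) (x, y0) (0, w)" for v
      unfolding C_def
      by (rule linear_real_euclidean_sum[OF linear_partial1[OF linear_dirder_family[OF Z z T_linear T_smooth]], symmetric])
    then have P': "(P w has_derivative (\<lambda>v. dirder (\<lambda>z. T z (v, 0)) (x, y0) (0, w))) (at x)"
      using P(2)[OF x, of w] by (simp only: )
    show ?thesis unfolding p_def ext_d_def
      by (rule has_derivative_diff[OF slice_has_derivative(1)[OF Z T_smooth z] P'])
  qed
  have p_con: "constructible_on D B (p w)" for w
    unfolding p_def by (intro constructible_on_diff[OF B(1)] constructible_on_slice[OF T_con B(1) BZ] P_con)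
  define I where "I = insert None (Some ` (Basis :: 'l set))"
  define g where "g = (\<lambda>i. case i of None \<Rightarrow> W | Some w \<Rightarrow> p w)"
  define g' where "g' = (\<lambda>i x v. case i of None \<Rightarrow> T (x, y0) (v, 0) | Some w \<Rightarrow> ext_d T (x, y0) (v, 0) (0, w))"
  have I: "finite I" by (simp add: I_def)
  have g_der: "(g i has_derivative g' i x) (at x)" if "x \<in> B" for i x
    using W'[OF that] p'[OF that] by (simp add: g_def g'_def split: option.split)
  have g_con: "constructible_on D B (g i)" for i
    using W_con p_con by (simp add: g_def split: option.split)
  have g_cont: "continuous_on B (\<lambda>x. g' i x v)" for i v
  proof -
    have s: "continuous_on B (\<lambda>x. h (x, y0))" if "smooth_on Z h" for h :: "'n \<times> 'l \<Rightarrow> real"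
      by (rule smooth_on_continuous_on[OF slice_smooth[OF Z that B(1) BZ]])
    show ?thesis
      by (cases i) (auto simp: g'_def ext_d_def intro!: s T_smooth smooth_on_diff[OF Z] smooth_on_dirder)
  qed
  define G where "G = (\<lambda>x. \<Sum>b\<in>Basis. (\<Sum>i\<in>I. g' i x0 b * g i x) *\<^sub>R b)"
  define G' where "G' = (\<lambda>x v. \<Sum>b\<in>Basis. (\<Sum>i\<in>I. g' i x0 b * g' i x v) *\<^sub>R b)"
  have G_der: "(G has_derivative G' x) (at x)" if "x \<in> B" for x
    unfolding G_def G'_def
    by (intro has_derivative_sum has_derivative_scaleR_left has_derivative_mult_right g_der[OF that])
  have G_cont: "continuous_on B (\<lambda>x. G' x v)" for v
    unfolding G'_def by (intro continuous_intros g_cont)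
  have G_inj: "v = 0" if "G' x0 v = 0" for v
  proof -
    have "(\<Sum>i\<in>I. (g' i x0 v)\<^sup>2) = 0"
      using normal_map_kernel[OF I, of "\<lambda>i. g' i x0" v] has_derivative_linear[OF g_der[OF B(3)]] that by (simp add: G'_def)
    then have g0: "g' i x0 v = 0" if "i \<in> I" for i
      using that I by (simp add: sum_nonneg_eq_0_iff)
    have "ext_d T (x0, y0) (v, 0) (a, w) = 0" for a w
    proof -
      note l = linear_ext_d[OF Z z0 T_linear T_smooth, of "(v, 0)"]
      have w: "ext_d T (x0, y0) (v, 0) (0, w) = 0"
      proof -
        from linear_real_euclidean_sum[OF linear_partial2[OF l], of w] show ?thesis
          using g0[of "Some _"] by (simp add: I_def g'_def)
      qed
      have a: "ext_d T (x0, y0) (v, 0) (a, 0) = 0"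
        using isotropic[OF z0] by (simp add: T_def)
      show ?thesis using linear_add[OF l, of "(a, 0)" "(0, w)"] w a by simp
    qed
    then have "(v, 0 :: 'l) = 0"
      using g0[of None] by (intro T_contact[OF z0]) (auto simp: I_def g'_def)
    then show "v = 0" by (simp add: zero_prod_def)
  qed
  have G_con: "constructible_on D B (\<lambda>x. G x \<bullet> b)" if "b \<in> Basis" for b
  proof -
    have "constructible_on D B (\<lambda>x. \<Sum>i\<in>I. g' i x0 b * g i x)"
      by (intro constructible_on_sum[OF B(1)] constructible_on_mult constructible_on_const[OF B(1)] g_con)
    moreover have "G x \<bullet> b = (\<Sum>i\<in>I. g' i x0 b * g i x)" for x
      unfolding G_def using that by simp
    ultimately show ?thesis by (simp only: )
  qed
  define c where "c = (\<Sum>b\<in>Basis. g' None x0 b *\<^sub>R b)"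
  \<comment> \<open>the speed of the image under \<open>G\<close> is the same at all points\<close>
  have G_u: "G' x (u (x, y0)) = c" if "x \<in> B" for x
    unfolding G'_def c_def I_def g'_def using T_u[OF BZ[OF that]] dT_u[OF BZ[OF that]]
    by (simp add: sum.reindex)
  obtain \<epsilon> x where x: "\<epsilon> > 0" "x 0 = x0"
    and xt0: "\<forall>t\<in>{-\<epsilon><..<\<epsilon>}. x t \<in> B \<and> G (x t) = G x0 + t *\<^sub>R c \<and> (\<forall>v. G' (x t) v = 0 \<longrightarrow> v = 0) \<and>
       (\<exists>d. (x has_vector_derivative d) (at t) \<and> G' (x t) d = c)"
    and xc0: "\<forall>b\<in>Basis. constructible_on D {-\<epsilon><..<\<epsilon>} (\<lambda>t. x t \<bullet> b)"
    using line_preimage[OF B(1,3) G_der G_cont G_inj G_con, of c] by blast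
  note xt = bspec[OF xt0] and xc = bspec[OF xc0]
  have "(x has_vector_derivative u (x t, y0)) (at t)" if t: "t \<in> {-\<epsilon><..<\<epsilon>}" for t
  proof -
    obtain d where d: "(x has_vector_derivative d) (at t)" "G' (x t) d = c" using xt[OF t] by blast
    have xB: "x t \<in> B" using xt[OF t] by blast
    have "G' (x t) (d - u (x t, y0)) = 0"
      using d(2) G_u[OF xB] linear_diff[OF has_derivative_linear[OF G_der[OF xB]]] by simp
    then have "d - u (x t, y0) = 0" using xt[OF t] by blast
    then show ?thesis using d(1) by simp
  qed
  then show ?thesis
    unfolding solved_by_quadratures_def using x xc
    by (intro exI[of _ \<epsilon>] exI[of _ x] conjI ballI) (auto simp: BZ xt)
qed

section \<open>Curves along which first integrals scale\<close>

text \<open>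
  If \<open>K(\<cdot>, y0)\<close> crosses zero at \<open>x0\<close> with nonzero derivative, then \<open>K(\<cdot>, y)\<close> still takes both signs near \<open>x0\<close>
  for \<open>y\<close> close to \<open>y0\<close>, so it has a zero there.
\<close>

lemma transversal_zero_set:
  fixes K :: "'n::euclidean_space \<Rightarrow> 'l::euclidean_space \<Rightarrow> real"
  assumes X: "open X" "convex X" "x0 \<in> X" and Y: "open Y" "y0 \<in> Y"
    and cx: "\<And>y. y \<in> Y \<Longrightarrow> continuous_on X (\<lambda>x. K x y)"
    and cy: "\<And>x. x \<in> X \<Longrightarrow> continuous_on Y (K x)"
    and K0: "K x0 y0 = 0" and der: "((\<lambda>x. K x y0) has_derivative l) (at x0)" and l: "l v \<noteq> 0"
  obtains Y' where "open Y'" "y0 \<in> Y'" "Y' \<subseteq> Y" "\<And>y. y \<in> Y' \<Longrightarrow> \<exists>x\<in>X. K x y = 0"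
proof -
  have lin: "linear l" by (rule has_derivative_linear[OF der])
  define w where "w = (1 / l v) *\<^sub>R v"
  have lw: "l w = 1" using l linear_scale[OF lin] by (simp add: w_def)
  let ?g = "\<lambda>s::real. x0 + s *\<^sub>R w"
  have g': "(?g has_derivative (\<lambda>s. s *\<^sub>R w)) (at 0)" by (auto intro!: derivative_eq_intros)
  have der0: "((\<lambda>x. K x y0) has_derivative l) (at (x0 + 0 *\<^sub>R w))" using der by simp
  have "((\<lambda>s. K (?g s) y0) has_derivative (\<lambda>s. l (s *\<^sub>R w))) (at 0)"
    by (rule has_derivative_compose[OF g' der0])
  have D: "((\<lambda>s. K (?g s) y0) has_real_derivative 1) (at 0)"
  proof -
    have "(\<lambda>s. l (s *\<^sub>R w)) = (*) 1" by (simp add: linear_scale[OF lin] lw fun_eq_iff)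
    then show ?thesis
      using \<open>((\<lambda>s. K (?g s) y0) has_derivative (\<lambda>s. l (s *\<^sub>R w))) (at 0)\<close>
      unfolding has_field_derivative_def by (simp only:)
  qed
  obtain d1 where d1: "d1 > 0" "\<And>h. h > 0 \<Longrightarrow> h < d1 \<Longrightarrow> K (?g 0) y0 < K (?g (0 + h)) y0"
    using DERIV_pos_inc_right[OF D] by auto
  obtain d2 where d2: "d2 > 0" "\<And>h. h > 0 \<Longrightarrow> h < d2 \<Longrightarrow> K (?g (0 - h)) y0 < K (?g 0) y0"
    using DERIV_pos_inc_left[OF D] by auto
  have "continuous_on UNIV ?g" by (intro continuous_intros)
  then have "open (?g -` X)" by (rule open_vimage[OF X(1)])
  moreover have "0 \<in> ?g -` X" using X(3) by simp
  ultimately obtain d3 where d3: "d3 > 0" "ball 0 d3 \<subseteq> ?g -` X" using open_contains_ball by blast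
  define h where "h = min d1 (min d2 d3) / 2"
  have h: "h > 0" "h < d1" "h < d2" "h < d3" using d1(1) d2(1) d3(1) by (auto simp: h_def)
  have "h \<in> ball 0 d3" "- h \<in> ball 0 d3" using h by auto
  then have gX: "?g h \<in> X" "?g (- h) \<in> X" using d3(2) by blast+
  have sgn: "K (?g (- h)) y0 < 0" "0 < K (?g h) y0" using d1(2)[of h] d2(2)[of h] h K0 by auto
  obtain Y1 where Y1: "open Y1" "Y1 \<inter> Y = K (?g (- h)) -` {..<0} \<inter> Y"
    using cy[OF gX(2), unfolded continuous_on_open_invariant, rule_format, OF open_lessThan[of 0]] by blast
  obtain Y2 where Y2: "open Y2" "Y2 \<inter> Y = K (?g h) -` {0<..} \<inter> Y"
    using cy[OF gX(1), unfolded continuous_on_open_invariant, rule_format, OF open_greaterThan[of 0]] by blast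
  show ?thesis
  proof (rule that[of "Y1 \<inter> Y2 \<inter> Y"])
    show "open (Y1 \<inter> Y2 \<inter> Y)" using Y1(1) Y2(1) Y(1) by blast
    show "y0 \<in> Y1 \<inter> Y2 \<inter> Y" using sgn Y(2) Y1(2) Y2(2) by blast
    show "Y1 \<inter> Y2 \<inter> Y \<subseteq> Y" by blast
    fix y assume y: "y \<in> Y1 \<inter> Y2 \<inter> Y"
    then have k: "K (?g (- h)) y < 0" "0 < K (?g h) y" "y \<in> Y" using Y1(2) Y2(2) by blast+
    have "connected ((\<lambda>x. K x y) ` X)"
      by (rule connected_continuous_image[OF cx[OF k(3)] convex_connected[OF X(2)]])
    then have "0 \<in> (\<lambda>x. K x y) ` X"
      using connectedD_interval[of "(\<lambda>x. K x y) ` X" "K (?g (- h)) y" "K (?g h) y" 0] k gX by auto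
    then show "\<exists>x\<in>X. K x y = 0" by force
  qed
qed

text \<open>
  The field is \<open>(1 + s) f\<close> times the velocity of a constructible curve \<open>h\<close>, so the time elapsed along \<open>h\<close> has
  the derivative \<open>1/((1 + s) f)\<close> in \<open>s\<close>. The function \<open>f\<close> is not among the known ones, but inserting
  \<open>u = (1 + s) f h'\<close> into the defining equation of the field, evaluated on a vector \<open>r\<close> transverse to the
  levels of \<open>K\<close>, is a linear equation for \<open>1/f\<close> with known coefficients. A quadrature then gives time as a
  function of \<open>s\<close>, and an inversion gives \<open>s\<close> as a function of time.
\<close>

lemma (in contact_coords) solved_by_time_change:
  assumes e: "\<epsilon> > 0" "\<epsilon> \<le> 1" and h0: "h 0 = x0"
    and hZ: "\<And>s. s \<in> {-\<epsilon><..<\<epsilon>} \<Longrightarrow> (h s, y0) \<in> Z"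
    and h': "\<And>s. s \<in> {-\<epsilon><..<\<epsilon>} \<Longrightarrow> (h has_vector_derivative d s) (at s)"
    and hu: "\<And>s. s \<in> {-\<epsilon><..<\<epsilon>} \<Longrightarrow> u (h s, y0) = ((1 + s) * f (h s, y0)) *\<^sub>R d s"
    and hcon: "\<And>b. b \<in> Basis \<Longrightarrow> constructible_on D {-\<epsilon><..<\<epsilon>} (\<lambda>s. h s \<bullet> b)"
  shows "solved_by_quadratures D Z u x0 y0"
proof -
  let ?J = "{-\<epsilon><..<\<epsilon>}"
  obtain r where r: "dirder K (x0, y0) r = f (x0, y0)" using reeb[OF z0] by blast
  have h_cont: "continuous_on ?J h"
    using h' by (intro continuous_at_imp_continuous_on ballI has_vector_derivative_continuous) auto
  have hy_cont: "continuous_on ?J (\<lambda>s. g (h s, y0))" if "continuous_on Z g" for g :: "'n \<times> 'l \<Rightarrow> real"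
    by (rule continuous_on_compose2[OF that, where f = "\<lambda>s. (h s, y0)"])
       (use hZ in \<open>auto intro!: continuous_intros h_cont\<close>)
  have dK_cont: "continuous_on ?J (\<lambda>s. dirder K (h s, y0) r)"
    by (rule hy_cont[OF smooth_on_continuous_on[OF smooth_on_dirder[OF K_smooth]]])
  have o0: "open (- {0 :: real})" by (rule open_Compl, rule closed_singleton)
  obtain J' where J': "open J'" "J' \<inter> ?J = (\<lambda>s. dirder K (h s, y0) r) -` (- {0}) \<inter> ?J"
    using dK_cont[unfolded continuous_on_open_invariant, rule_format, OF o0] by blast
  have "0 \<in> (\<lambda>s. dirder K (h s, y0) r) -` (- {0}) \<inter> ?J"
    using e(1) f_nonzero[OF z0] by (simp add: h0 r)
  then have "0 \<in> J' \<inter> ?J" using J'(2) by simp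
  then obtain e1 where e1: "e1 > 0" "ball 0 e1 \<subseteq> J' \<inter> ?J"
    using openE[OF open_Int[OF J'(1) open_greaterThanLessThan]] by blast
  define a where "a = e1 / 2"
  have a: "a > 0" using e1(1) by (simp add: a_def)
  have aJ: "{-a..a} \<subseteq> J' \<inter> ?J"
  proof -
    have "{-a..a} \<subseteq> ball 0 e1" using e1(1) by (auto simp: a_def dist_real_def)
    then show ?thesis using e1(2) by blast
  qed
  then have aJ1: "s \<in> ?J" "dirder K (h s, y0) r \<noteq> 0" if "s \<in> {-a..a}" for s
    using that J'(2) by blast+
  have pos: "1 + s > 0" if "s \<in> ?J" for s using that e(2) by auto
  let ?I = "{-a<..<a}"
  have I: "open ?I" "0 \<in> ?I" using a by auto
  have IJ: "?I \<subseteq> {-a..a}" "?I \<subseteq> ?J" using aJ by auto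
  define F where "F = (\<lambda>s. 1 / ((1 + s) * f (h s, y0)))"
  have F_cont: "continuous_on {-a..a} F"
  proof -
    have "continuous_on ?J F" unfolding F_def
      using pos f_nonzero[OF hZ] by (intro continuous_intros hy_cont f_continuous) (auto simp: less_imp_neq[THEN not_sym])
    then show ?thesis by (rule continuous_on_subset) (use aJ in blast)
  qed
  \<comment> \<open>the linear equation for \<open>1/f\<close> solved; its right-hand side is known\<close>
  have F_eq: "F s = (E (h s, y0) r - (1 + s) * (\<Sum>b\<in>Basis. (d s \<bullet> b) * ext_d E (h s, y0) (b, 0) r)) / ((1 + s) * dirder K (h s, y0) r)"
    if s: "s \<in> ?I" for s
  proof -
    have sJ: "s \<in> ?J" and nz: "dirder K (h s, y0) r \<noteq> 0" using s IJ aJ1 by blast+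
    note z = hZ[OF sJ]
    have "(\<lambda>a. ext_d E (h s, y0) a r) = (\<lambda>a. - ext_d E (h s, y0) r a)"
      by (rule ext) (rule ext_d_swap)
    then have "linear (\<lambda>a. ext_d E (h s, y0) a r)"
      using linear_compose_neg[OF linear_ext_d[OF Z z E_linear E_smooth, of r]] by (simp only:)
    then have lin: "linear (\<lambda>v. ext_d E (h s, y0) (v, 0) r)" by (rule linear_partial1)
    let ?w = "ext_d E (h s, y0) (d s, 0) r"
    have w: "?w = (\<Sum>b\<in>Basis. (d s \<bullet> b) * ext_d E (h s, y0) (b, 0) r)"
      by (rule linear_real_euclidean_sum[OF lin])
    have "((1 + s) * f (h s, y0)) * ?w = - dirder K (h s, y0) r + f (h s, y0) * E (h s, y0) r"
      using field[OF z, of r] linear_scale[OF lin, of "(1 + s) * f (h s, y0)" "d s"] by (simp add: hu[OF sJ])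
    moreover have "c * (e - a * w) = k" if "(a * c) * w = - k + c * e" for a c e k w :: real
      using that by (simp add: algebra_simps)
    ultimately have "f (h s, y0) * (E (h s, y0) r - (1 + s) * ?w) = dirder K (h s, y0) r" by blast
    have "F s = (E (h s, y0) r - (1 + s) * ?w) / ((1 + s) * dirder K (h s, y0) r)"
    proof -
      have "1 / (a * b) = X / (a * c)" if "b * X = c" "b \<noteq> 0" "c \<noteq> 0" "a \<noteq> 0" for a b c X :: real
        using that by (auto simp: field_simps)
      moreover have "1 + s \<noteq> 0" using pos[OF sJ] by simp
      ultimately show ?thesis
        using nz f_nonzero[OF z] \<open>f (h s, y0) * (E (h s, y0) r - (1 + s) * ?w) = dirder K (h s, y0) r\<close>
        unfolding F_def by blast
    qed
    then show ?thesis unfolding w .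
  qed
  have hconI: "constructible_on D ?I (\<lambda>s. h s \<bullet> b)" if "b \<in> Basis" for b
    by (rule constructible_on_subset[OF hcon[OF that] I(1) IJ(2)]) simp
  have zcon: "constructible_on D ?I (\<lambda>s. g (h s, y0))" if "constructible_on D Z g" for g
    using constructible_on_curve_in_slice[where g = h and X = ?I and y = y0, OF that I(1) _ hconI]
      hZ[OF subsetD[OF IJ(2)]] by blast
  have dcon: "constructible_on D ?I (\<lambda>s. d s \<bullet> b)" if "b \<in> Basis" for b
  proof -
    have "((\<lambda>s. h s \<bullet> b) has_derivative (\<lambda>v. v * (d s \<bullet> b))) (at s)" if "s \<in> ?I" for s
      using bounded_linear.has_derivative[OF bounded_linear_inner_left h'[of s, unfolded has_vector_derivative_def]] that IJ(2)
      by auto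
    from constructible_on_derivative[OF I(1) hconI[OF that] this, of 1] show ?thesis by simp
  qed
  have E'con: "constructible_on D Z (\<lambda>z. ext_d E z v w)" for v w
    unfolding ext_d_def
    by (intro constructible_on_diff[OF Z]
        constructible_on_derivative[OF Z E_constructible smooth_on_has_derivative[OF E_smooth Z]])
  have K'con: "constructible_on D Z (\<lambda>z. dirder K z r)"
    by (rule constructible_on_derivative[OF Z K_constructible smooth_on_has_derivative[OF K_smooth Z]])
  have scon: "constructible_on D ?I (\<lambda>s. 1 + s)"
    using constructible_on_add[OF constructible_on_const[OF I(1), of D 1] constructible_on_inner[OF I(1), of D 1]] by simp
  have F_con: "constructible_on D ?I F"
  proof -
    have "constructible_on D ?I (\<lambda>s. (E (h s, y0) r - (1 + s) * (\<Sum>b\<in>Basis. (d s \<bullet> b) * ext_d E (h s, y0) (b, 0) r))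
        / ((1 + s) * dirder K (h s, y0) r))"
    proof (rule constructible_on_divide)
      show "constructible_on D ?I (\<lambda>s. E (h s, y0) r - (1 + s) * (\<Sum>b\<in>Basis. (d s \<bullet> b) * ext_d E (h s, y0) (b, 0) r))"
        by (intro constructible_on_diff[OF I(1)] constructible_on_mult constructible_on_sum[OF I(1)] scon dcon
            zcon[OF E_constructible] zcon[OF E'con])
      show "constructible_on D ?I (\<lambda>s. (1 + s) * dirder K (h s, y0) r)"
        by (intro constructible_on_mult scon zcon[OF K'con])
      show "(1 + s) * dirder K (h s, y0) r \<noteq> 0" if "s \<in> ?I" for s
        using aJ1(2)[OF subsetD[OF IJ(1) that]] pos[OF subsetD[OF IJ(2) that]] by auto
    qed
    then show ?thesis by (rule constructible_on_subset[OF _ I(1) subset_refl F_eq])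
  qed
  obtain g where g: "\<And>s. s \<in> {-a..a} \<Longrightarrow> (g has_vector_derivative F s) (at s within {-a..a})"
    using antiderivative_continuous[OF F_cont] by metis
  define \<tau> where "\<tau> = (\<lambda>s. g s - g 0)"
  have \<tau>': "(\<tau> has_derivative (\<lambda>v. v * F s)) (at s)" if s: "s \<in> ?I" for s
  proof -
    have "(g has_vector_derivative F s) (at s within ?I)"
      using has_vector_derivative_within_subset[OF g IJ(1)] s IJ(1) by blast
    then have "(g has_vector_derivative F s) (at s)"
      using at_within_open[OF s I(1)] by simp
    then show ?thesis unfolding \<tau>_def has_vector_derivative_def
      by (auto intro!: derivative_eq_intros)
  qed
  have \<tau>_con: "constructible_on D ?I (\<lambda>s. \<tau> s \<bullet> b)" if "b \<in> Basis" for b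
  proof -
    have "constructible_on D ?I \<tau>"
    proof (rule constructible_on_primitive[OF I(1), where A = "\<lambda>b. F" and a = 0])
      show "0 + s *\<^sub>R (x - 0) \<in> ?I" if "x \<in> ?I" "s \<in> {0..1}" for x s
      proof -
        have "(1 - s) *\<^sub>R 0 + s *\<^sub>R x \<in> ?I"
          using that I(2) by (intro convexD[OF convex_real_interval(8)]) auto
        then show ?thesis by simp
      qed
      show "(\<tau> has_derivative (\<lambda>v. \<Sum>b\<in>Basis. (v \<bullet> b) * F x)) (at x)" if "x \<in> ?I" for x
        using \<tau>'[OF that] by simp
      show "constructible_on D ?I F" by (rule F_con)
      show "\<tau> 0 = 0" by (simp add: \<tau>_def)
    qed
    then show ?thesis using that by simp
  qed
  have F_contI: "continuous_on ?I (\<lambda>s. v * F s)" for v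
    by (intro continuous_on_mult continuous_on_const continuous_on_subset[OF F_cont IJ(1)])
  have F_inj: "v = 0" if "v * F 0 = 0" for v
    using that f_nonzero[OF z0] by (simp add: F_def h0)
  obtain \<delta> \<sigma> where \<delta>: "\<delta> > 0" "\<sigma> 0 = 0"
    and \<sigma>0: "\<forall>t\<in>{-\<delta><..<\<delta>}. \<sigma> t \<in> ?I \<and> \<tau> (\<sigma> t) = \<tau> 0 + t *\<^sub>R 1 \<and> (\<forall>v. v * F (\<sigma> t) = 0 \<longrightarrow> v = 0) \<and>
       (\<exists>d. (\<sigma> has_vector_derivative d) (at t) \<and> d * F (\<sigma> t) = 1)"
    and \<sigma>_con0: "\<forall>b\<in>Basis. constructible_on D {-\<delta><..<\<delta>} (\<lambda>t. \<sigma> t \<bullet> b)"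
    using line_preimage[OF I \<tau>' F_contI F_inj \<tau>_con, of 1] by blast
  note \<sigma> = bspec[OF \<sigma>0] and \<sigma>_con = bspec[OF \<sigma>_con0]
  have \<sigma>I: "\<sigma> t \<in> ?I" if "t \<in> {-\<delta><..<\<delta>}" for t using \<sigma>[OF that] by blast
  have x': "((\<lambda>t. h (\<sigma> t)) has_vector_derivative u (h (\<sigma> t), y0)) (at t)" if t: "t \<in> {-\<delta><..<\<delta>}" for t
  proof -
    obtain d' where d': "(\<sigma> has_vector_derivative d') (at t)" "d' * F (\<sigma> t) = 1"
      using \<sigma>[OF t] by blast
    have sJ: "\<sigma> t \<in> ?J" by (rule subsetD[OF IJ(2) \<sigma>I[OF t]])
    have "((\<lambda>t. h (\<sigma> t)) has_vector_derivative d' *\<^sub>R d (\<sigma> t)) (at t)"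
      using vector_diff_chain_at[OF d'(1) h'[OF sJ]] by (simp add: o_def)
    moreover have "d' = (1 + \<sigma> t) * f (h (\<sigma> t), y0)"
      using d'(2) pos[OF sJ] f_nonzero[OF hZ[OF sJ]] unfolding F_def by (simp add: field_simps)
    ultimately show ?thesis by (simp add: hu[OF sJ])
  qed
  show ?thesis unfolding solved_by_quadratures_def
  proof (intro exI[of _ \<delta>] exI[of _ "\<lambda>t. h (\<sigma> t)"] conjI ballI)
    show "\<delta> > 0" "h (\<sigma> 0) = x0" using \<delta> h0 by simp_all
    show "(h (\<sigma> t), y0) \<in> Z" if "t \<in> {-\<delta><..<\<delta>}" for t
      by (rule hZ[OF subsetD[OF IJ(2) \<sigma>I[OF that]]])
    show "((\<lambda>t. h (\<sigma> t)) has_vector_derivative u (h (\<sigma> t), y0)) (at t)" if "t \<in> {-\<delta><..<\<delta>}" for t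
      by (rule x'[OF that])
    show "constructible_on D {-\<delta><..<\<delta>} (\<lambda>t. h (\<sigma> t) \<bullet> b)" if "b \<in> Basis" for b
      by (rule constructible_on_compose[where f = "\<lambda>s. h s \<bullet> b" and g = \<sigma> and T = ?I, OF _ hconI[OF that] _ \<sigma>_con])
         (use \<sigma>I in auto)
  qed
qed

text \<open>
  Suppose that on \<open>k = 0\<close> the derivative along the field multiplies every \<open>p i\<close> by \<open>f\<close>, and that the \<open>p i\<close>
  together with \<open>k\<close> form an immersion. Then a trajectory moves the vector of the \<open>p i\<close> along a ray and keeps
  \<open>k = 0\<close>. For the inversion the normal map of the \<open>p i\<close> is projected along the gradient \<open>n\<close> of \<open>k\<close> and its
  component along \<open>n\<close> is replaced by \<open>k\<close>, so that the preimage of the ray lies in \<open>k = 0\<close>.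
\<close>

lemma (in contact_coords) solved_by_scaling_integrals:
  fixes p :: "'i \<Rightarrow> 'n \<Rightarrow> real"
  defines "k \<equiv> \<lambda>x. K (x, y0)"
  assumes X: "open X" "x0 \<in> X" and XZ: "\<And>x. x \<in> X \<Longrightarrow> (x, y0) \<in> Z" and K0: "k x0 = 0"
    and regular: "(\<exists>w. dirder k x0 w \<noteq> 0) \<or> (\<forall>x\<in>X. k x = 0)"
    and I: "finite I" and p_smooth: "\<And>i. i \<in> I \<Longrightarrow> smooth_on X (p i)"
    and p_con: "\<And>i. i \<in> I \<Longrightarrow> constructible_on D X (p i)"
    and p_u: "\<And>i x. i \<in> I \<Longrightarrow> x \<in> X \<Longrightarrow> k x = 0 \<Longrightarrow> dirder (p i) x (u (x, y0)) = f (x, y0) * p i x"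
    and immersion: "\<And>v. dirder k x0 v = 0 \<Longrightarrow> (\<And>i. i \<in> I \<Longrightarrow> dirder (p i) x0 v = 0) \<Longrightarrow> v = 0"
  shows "solved_by_quadratures D Z u x0 y0"
proof -
  have k_smooth: "smooth_on X k" unfolding k_def by (rule slice_smooth[OF Z K_smooth X(1) XZ])
  have k_con: "constructible_on D X k" unfolding k_def by (rule constructible_on_slice[OF K_constructible X(1) XZ])
  define n where "n = gradient_of (dirder k x0)"
  have n: "v \<bullet> n = dirder k x0 v" for v
    unfolding n_def by (rule gradient_of_inner[OF smooth_on_dirder_linear[OF k_smooth X]])
  define Q where "Q = (\<lambda>y. y - ((y \<bullet> n) / (n \<bullet> n)) *\<^sub>R n)"
  have Q_bl: "bounded_linear Q" unfolding Q_def divide_inverse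
    by (intro bounded_linear_sub bounded_linear_ident bounded_linear_scaleR_const bounded_linear_mult_const bounded_linear_inner_left)
  have Q_lin: "linear Q" using Q_bl by (rule bounded_linear.linear)
  have Qn: "Q y \<bullet> n = 0" for y by (cases "n = 0") (simp_all add: Q_def inner_diff_left)
  define P where "P = (\<lambda>x. \<Sum>b\<in>Basis. (\<Sum>i\<in>I. dirder (p i) x0 b * p i x) *\<^sub>R b)"
  define P' where "P' = (\<lambda>x v. \<Sum>b\<in>Basis. (\<Sum>i\<in>I. dirder (p i) x0 b * dirder (p i) x v) *\<^sub>R b)"
  define G where "G = (\<lambda>x. Q (P x) + k x *\<^sub>R n)"
  define G' where "G' = (\<lambda>x v. Q (P' x v) + dirder k x v *\<^sub>R n)"
  have P_der: "(P has_derivative P' x) (at x)" if "x \<in> X" for x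
    unfolding P_def P'_def
    by (intro has_derivative_sum has_derivative_scaleR_left has_derivative_mult_right
        smooth_on_has_derivative[OF p_smooth X(1) that])
  have G_der: "(G has_derivative G' x) (at x)" if "x \<in> X" for x
    unfolding G_def G'_def
    by (intro has_derivative_add bounded_linear.has_derivative[OF Q_bl] has_derivative_scaleR_left P_der[OF that]
        smooth_on_has_derivative[OF k_smooth X(1) that])
  have G_cont: "continuous_on X (\<lambda>x. G' x v)" for v
    unfolding G'_def P'_def
    by (intro continuous_on_add bounded_linear.continuous_on[OF Q_bl] continuous_on_sum continuous_on_scaleR continuous_on_mult
        continuous_on_const smooth_on_continuous_on smooth_on_dirder k_smooth p_smooth)
  have G_inj: "v = 0" if v: "G' x0 v = 0" for v
  proof -
    have "dirder k x0 v * (n \<bullet> n) = G' x0 v \<bullet> n" by (simp add: G'_def inner_add_left Qn)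
    then have nn: "(v \<bullet> n) * (n \<bullet> n) = 0" using v n[of v] by simp
    then have kv: "dirder k x0 v = 0" using n[of v] by (cases "n = 0") auto
    have "0 = Q (P' x0 v) \<bullet> v" using v kv by (simp add: G'_def)
    also have "\<dots> = P' x0 v \<bullet> v"
    proof -
      have "n \<bullet> v = 0" using kv n[of v] by (simp add: inner_commute)
      then show ?thesis by (simp add: Q_def inner_diff_left)
    qed
    also have "\<dots> = (\<Sum>i\<in>I. (dirder (p i) x0 v)\<^sup>2)"
      unfolding P'_def by (rule normal_map_kernel[OF I smooth_on_dirder_linear[OF p_smooth X]])
    finally have "dirder (p i) x0 v = 0" if "i \<in> I" for i
      using I that by (simp add: sum_nonneg_eq_0_iff)
    with kv show "v = 0" by (rule immersion)
  qed
  have P_con: "constructible_on D X (\<lambda>x. P x \<bullet> w)" for w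
  proof -
    have "constructible_on D X (\<lambda>x. \<Sum>b\<in>Basis. (\<Sum>i\<in>I. dirder (p i) x0 b * p i x) * (b \<bullet> w))"
      by (intro constructible_on_sum[OF X(1)] constructible_on_mult constructible_on_const[OF X(1)] p_con)
    then show ?thesis by (simp add: P_def inner_sum_left)
  qed
  have G_con: "constructible_on D X (\<lambda>x. G x \<bullet> b)" for b
  proof -
    have "constructible_on D X (\<lambda>x. P x \<bullet> b - (1 / (n \<bullet> n) * (n \<bullet> b)) * (P x \<bullet> n) + k x * (n \<bullet> b))"
      by (intro constructible_on_add constructible_on_diff[OF X(1)] constructible_on_mult constructible_on_const[OF X(1)] P_con k_con)
    then show ?thesis by (simp add: G_def Q_def inner_add_left inner_diff_left mult_ac)
  qed
  define g where "g = Q (P x0)"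
  have Gx0: "G x0 = g" using K0 by (simp add: G_def g_def)
  have gn: "g \<bullet> n = 0" by (simp add: g_def Qn)
  obtain \<epsilon> h where e: "\<epsilon> > 0" "h 0 = x0"
    and hs0: "\<forall>t\<in>{-\<epsilon><..<\<epsilon>}. h t \<in> X \<and> G (h t) = G x0 + t *\<^sub>R g \<and> (\<forall>v. G' (h t) v = 0 \<longrightarrow> v = 0) \<and>
       (\<exists>d. (h has_vector_derivative d) (at t) \<and> G' (h t) d = g)"
    and h_con0: "\<forall>b\<in>Basis. constructible_on D {-\<epsilon><..<\<epsilon>} (\<lambda>t. h t \<bullet> b)"
    using line_preimage[OF X G_der G_cont G_inj G_con, of g] by blast
  note hs = bspec[OF hs0] and h_con = bspec[OF h_con0]
  define \<delta> where "\<delta> = min \<epsilon> 1"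
  have d: "\<delta> > 0" "\<delta> \<le> 1" "{-\<delta><..<\<delta>} \<subseteq> {-\<epsilon><..<\<epsilon>}" using e(1) by (auto simp: \<delta>_def)
  have "\<exists>d. (h has_vector_derivative d) (at s) \<and> u (h s, y0) = ((1 + s) * f (h s, y0)) *\<^sub>R d" if s: "s \<in> {-\<delta><..<\<delta>}" for s
  proof -
    note s' = hs[OF subsetD[OF d(3) s]]
    have hX: "h s \<in> X" and Gh: "G (h s) = (1 + s) *\<^sub>R g" using s' Gx0 by (auto simp: algebra_simps)
    obtain d where d: "(h has_vector_derivative d) (at s)" "G' (h s) d = g" using s' by blast
    have "k (h s) * (n \<bullet> n) = G (h s) \<bullet> n" by (simp add: G_def inner_add_left Qn)
    then have "k (h s) * (n \<bullet> n) = 0" using gn by (simp add: Gh)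
    \<comment> \<open>the component of \<open>G\<close> along \<open>n\<close> is \<open>k\<close>; without a gradient, \<open>k\<close> vanishes identically\<close>
    have kh: "k (h s) = 0"
    proof (cases "n = 0")
      case True
      then have "dirder k x0 w = 0" for w using n[of w] by simp
      then show ?thesis using regular hX by blast
    next
      case False
      then show ?thesis using \<open>k (h s) * (n \<bullet> n) = 0\<close> by simp
    qed
    let ?U = "u (h s, y0)" and ?f = "f (h s, y0)"
    have "P' (h s) ?U = ?f *\<^sub>R P (h s)"
    proof -
      have "P' (h s) ?U = (\<Sum>b\<in>Basis. (?f * (\<Sum>i\<in>I. dirder (p i) x0 b * p i (h s))) *\<^sub>R b)"
        unfolding P'_def sum_distrib_left
        by (intro sum.cong refl arg_cong2[where f = scaleR]) (simp add: p_u[OF _ hX kh])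
      then show ?thesis by (simp add: P_def scaleR_sum_right)
    qed
    moreover have "dirder k (h s) ?U = 0"
      using field_of_K[OF XZ[OF hX]] kh unfolding k_def slice_dirder[OF Z K_smooth XZ[OF hX]] by simp
    ultimately have "G' (h s) ?U = ?f *\<^sub>R Q (P (h s))" by (simp add: G'_def linear_scale[OF Q_lin])
    also have "\<dots> = ((1 + s) * ?f) *\<^sub>R g" using Gh kh by (simp add: G_def mult.commute)
    also have "\<dots> = G' (h s) (((1 + s) * ?f) *\<^sub>R d)"
      using d(2) linear_scale[OF has_derivative_linear[OF G_der[OF hX]]] by simp
    finally have "G' (h s) (?U - ((1 + s) * ?f) *\<^sub>R d) = 0"
      using linear_diff[OF has_derivative_linear[OF G_der[OF hX]]] by simp
    then have "?U - ((1 + s) * ?f) *\<^sub>R d = 0" using s' by blast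
    then show ?thesis using d(1) by auto
  qed
  then have "\<forall>s. \<exists>d. s \<in> {-\<delta><..<\<delta>} \<longrightarrow> (h has_vector_derivative d) (at s) \<and> u (h s, y0) = ((1 + s) * f (h s, y0)) *\<^sub>R d"
    by blast
  from choice[OF this] obtain d' where d': "\<And>s. s \<in> {-\<delta><..<\<delta>} \<Longrightarrow> (h has_vector_derivative d' s) (at s)"
      "\<And>s. s \<in> {-\<delta><..<\<delta>} \<Longrightarrow> u (h s, y0) = ((1 + s) * f (h s, y0)) *\<^sub>R d' s"
    by blast
  show ?thesis
  proof (rule solved_by_time_change[OF d(1,2) e(2) _ d'])
    show "(h s, y0) \<in> Z" if "s \<in> {-\<delta><..<\<delta>}" for s using hs[OF subsetD[OF d(3) that]] XZ by blast
    show "constructible_on D {-\<delta><..<\<delta>} (\<lambda>s. h s \<bullet> b)" if "b \<in> Basis" for b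
      by (rule constructible_on_subset[OF h_con[OF that] _ d(3)]) auto
  qed
qed

section \<open>The zero level of the Hamiltonian\<close>

lemma derivative_along_zero_curve:
  fixes h :: "'e::real_normed_vector \<Rightarrow> real"
  assumes h: "(h has_derivative h') (at x)" and c: "c 0 = x" "(c has_vector_derivative v) (at 0)"
    and ev: "\<forall>\<^sub>F s in nhds 0. h (c s) = 0"
  shows "h' v = 0"
proof -
  have h0: "(h has_derivative h') (at (c 0))" using h c(1) by simp
  have d: "((\<lambda>s. h (c s)) has_derivative (\<lambda>s. h' (s *\<^sub>R v))) (at 0)"
    by (rule has_derivative_compose[OF c(2)[unfolded has_vector_derivative_def] h0])
  obtain T where T: "open T" "0 \<in> T" "\<And>s. s \<in> T \<Longrightarrow> h (c s) = 0"
    using ev by (auto simp: eventually_nhds)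
  have "((\<lambda>s. 0) has_derivative (\<lambda>s. h' (s *\<^sub>R v))) (at 0)"
    by (rule has_derivative_transform_within_open[where f = "\<lambda>s. h (c s)" and s = T, OF d T])
  then have "(\<lambda>s. h' (s *\<^sub>R v)) = (\<lambda>s. 0)"
    by (rule has_derivative_unique) (rule has_derivative_const)
  from fun_cong[OF this, of 1] show ?thesis by simp
qed

text \<open>
  \<open>K\<close> is regular, so its partial derivative in one of the two factors is nonzero at the base point. Then
  the equation \<open>K = 0\<close> can be solved in that factor for every nearby point of the other one, and all these
  points belong to the zero set's projection to the other factor.
\<close>

lemma (in contact_coords) zero_set_splits:
  fixes A :: "'n set" and B :: "'l set"
  assumes K0: "K (x0, y0) = 0"
    and zero_set: "\<And>x y. (x, y) \<in> Z \<Longrightarrow> K (x, y) = 0 \<longleftrightarrow> x \<in> A \<and> y \<in> B"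
  shows "\<exists>X Y. open X \<and> x0 \<in> X \<and> open Y \<and> y0 \<in> Y \<and> X \<times> Y \<subseteq> Z \<and>
    ((Y \<subseteq> B \<and> (\<exists>\<rho>. \<forall>x\<in>X. dirder K (x, y0) (\<rho>, 0) \<noteq> 0)) \<or>
     (X \<subseteq> A \<and> (\<exists>w. dirder K (x0, y0) (0, w) \<noteq> 0)))"
proof -
  obtain X1 Y1 where XY: "open X1" "open Y1" "x0 \<in> X1" "y0 \<in> Y1" "X1 \<times> Y1 \<subseteq> Z"
    using open_prod_elim[OF Z z0] by (metis mem_Sigma_iff)
  obtain r1 where r1: "r1 > 0" "ball x0 r1 \<subseteq> X1" using XY(1,3) open_contains_ball by blast
  obtain r2 where r2: "r2 > 0" "ball y0 r2 \<subseteq> Y1" using XY(2,4) open_contains_ball by blast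
  define X where "X = ball x0 r1"
  define Y where "Y = ball y0 r2"
  have X: "open X" "convex X" "x0 \<in> X" using r1(1) by (auto simp: X_def)
  have Y: "open Y" "convex Y" "y0 \<in> Y" using r2(1) by (auto simp: Y_def)
  have XYZ: "(x, y) \<in> Z" if "x \<in> X" "y \<in> Y" for x y
    using that r1(2) r2(2) XY(5) unfolding X_def Y_def by blast
  have cx: "continuous_on X (\<lambda>x. K (x, y))" if "y \<in> Y" for y
    by (rule smooth_on_continuous_on[OF slice_smooth[OF Z K_smooth X(1) XYZ[OF _ that]]])
  have cy: "continuous_on Y (\<lambda>y. K (x, y))" if "x \<in> X" for x
    by (rule smooth_on_continuous_on[OF slice_smooth2[OF Z K_smooth Y(1) XYZ[OF that]]])
  note d1 = slice_has_derivative(1)[OF Z K_smooth z0] and d2 = slice_has_derivative(2)[OF Z K_smooth z0]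
  show ?thesis
  proof (cases "\<exists>\<rho>. dirder K (x0, y0) (\<rho>, 0) \<noteq> 0")
    case True
    then obtain \<rho> where \<rho>: "dirder K (x0, y0) (\<rho>, 0) \<noteq> 0" by blast
    obtain Y' where Y': "open Y'" "y0 \<in> Y'" "Y' \<subseteq> Y" "\<And>y. y \<in> Y' \<Longrightarrow> \<exists>x\<in>X. K (x, y) = 0"
      using transversal_zero_set[where K = "\<lambda>x y. K (x, y)", OF X Y(1,3) cx cy K0 d1 \<rho>] by blast
    have YB: "Y' \<subseteq> B"
    proof
      fix y assume y: "y \<in> Y'"
      then obtain x where x: "x \<in> X" "K (x, y) = 0" using Y'(4) by blast
      have "(x, y) \<in> Z" using XYZ[OF x(1)] y Y'(3) by blast
      from zero_set[OF this] x(2) show "y \<in> B" by blast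
    qed
    let ?X = "X \<inter> (\<lambda>x. dirder K (x, y0) (\<rho>, 0)) -` (- {0})"
    have "open ?X"
    proof (rule continuous_open_preimage[OF _ X(1)])
      show "continuous_on X (\<lambda>x. dirder K (x, y0) (\<rho>, 0))"
        by (rule smooth_on_continuous_on[OF slice_smooth[OF Z smooth_on_dirder[OF K_smooth] X(1) XYZ[OF _ Y(3)]]])
      show "open (- {0 :: real})" by (rule open_Compl, rule closed_singleton)
    qed
    moreover have "?X \<times> Y' \<subseteq> Z" using XYZ Y'(3) by blast
    ultimately show ?thesis using YB \<rho> X(3) Y'(1,2)
      by (intro exI[of _ ?X] exI[of _ Y'] conjI disjI1 exI[of _ \<rho>]) simp_all
  next
    case False
    obtain a where a: "dirder K (x0, y0) a \<noteq> 0" using reeb[OF z0] f_nonzero[OF z0] by metis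
    have "dirder K (x0, y0) a = dirder K (x0, y0) ((fst a, 0) + (0, snd a))" by simp
    also have "\<dots> = dirder K (x0, y0) (fst a, 0) + dirder K (x0, y0) (0, snd a)"
      by (rule linear_add[OF smooth_on_dirder_linear[OF K_smooth Z z0]])
    finally have w: "dirder K (x0, y0) (0, snd a) \<noteq> 0" using a False by simp
    obtain X' where X': "open X'" "x0 \<in> X'" "X' \<subseteq> X" "\<And>x. x \<in> X' \<Longrightarrow> \<exists>y\<in>Y. K (x, y) = 0"
      using transversal_zero_set[where K = "\<lambda>y x. K (x, y)", OF Y X(1,3) cy cx K0 d2 w] by blast
    have "X' \<subseteq> A"
    proof
      fix x assume x: "x \<in> X'"
      then obtain y where y: "y \<in> Y" "K (x, y) = 0" using X'(4) by blast
      have "(x, y) \<in> Z" using XYZ[OF _ y(1)] x X'(3) by blast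
      from zero_set[OF this] y(2) show "x \<in> A" by blast
    qed
    moreover have "X' \<times> Y \<subseteq> Z" using XYZ X'(3) by blast
    ultimately show ?thesis using w X'(1,2) Y(1,3)
      by (intro exI[of _ X'] exI[of _ Y] conjI disjI2 exI[of _ "snd a"]) simp_all
  qed
qed

text \<open>
  On the zero level \<open>A \<times> B\<close> the leaf directions tangent to \<open>A\<close> are annihilated by \<open>E\<close>. The functions
  \<open>p b\<close> are the values of \<open>E\<close> on a spanning family of the directions tangent to \<open>B\<close>, obtained by projecting
  the basis to the kernel of \<open>dK(0, \<cdot>)\<close>. A vector annihilated by the differentials of \<open>K\<close> and of the \<open>p b\<close> is
  tangent to \<open>A\<close>, hence annihilated by \<open>E\<close>, and is orthogonal for \<open>dE\<close> to the kernel of \<open>dK\<close> and to the Reeb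
  vector, which together span everything.
\<close>

lemma (in contact_coords) solved_where_K_zero:
  fixes A :: "'n set" and B :: "'l set"
  assumes K0: "K (x0, y0) = 0"
    and zero_set: "\<And>x y. (x, y) \<in> Z \<Longrightarrow> K (x, y) = 0 \<longleftrightarrow> x \<in> A \<and> y \<in> B"
    and isotropic: "\<And>x y c v. (x, y) \<in> Z \<Longrightarrow> x \<in> A \<Longrightarrow> y \<in> B \<Longrightarrow> c 0 = x \<Longrightarrow>
      (c has_vector_derivative v) (at 0) \<Longrightarrow> \<forall>\<^sub>F s in nhds 0. c s \<in> A \<Longrightarrow> E (x, y) (v, 0) = 0"
  shows "solved_by_quadratures D Z u x0 y0"
proof -
  obtain X Y where X: "open X" "x0 \<in> X" and Y: "open Y" "y0 \<in> Y" and XY: "X \<times> Y \<subseteq> Z"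
    and split: "(Y \<subseteq> B \<and> (\<exists>\<rho>. \<forall>x\<in>X. dirder K (x, y0) (\<rho>, 0) \<noteq> 0)) \<or>
     (X \<subseteq> A \<and> (\<exists>w. dirder K (x0, y0) (0, w) \<noteq> 0))"
    using zero_set_splits[OF K0 zero_set] by blast
  have A0: "x0 \<in> A" and B0: "y0 \<in> B" using zero_set[OF z0] K0 by blast+
  have XYZ: "(x, y) \<in> Z" if "x \<in> X" "y \<in> Y" for x y using that XY by blast
  note XZ = XYZ[OF _ Y(2)] and YZ = XYZ[OF X(2)]
  define k where "k = (\<lambda>x. K (x, y0))"
  define l where "l = (\<lambda>y. K (x0, y))"
  have k_smooth: "smooth_on X k" unfolding k_def by (rule slice_smooth[OF Z K_smooth X(1) XZ])
  have l_smooth: "smooth_on Y l" unfolding l_def by (rule slice_smooth2[OF Z K_smooth Y(1) YZ])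
  have k': "dirder k x v = dirder K (x, y0) (v, 0)" if "x \<in> X" for x v
    unfolding k_def by (rule slice_dirder[OF Z K_smooth XZ[OF that]])
  have l': "dirder l y0 w = dirder K (x0, y0) (0, w)" for w
    unfolding l_def by (rule dirder_eq[OF slice_has_derivative(2)[OF Z K_smooth z0]])
  have kA: "k x = 0 \<longleftrightarrow> x \<in> A" if "x \<in> X" for x using zero_set[OF XZ[OF that]] B0 by (simp add: k_def)
  have lB: "l y = 0 \<longleftrightarrow> y \<in> B" if "y \<in> Y" for y using zero_set[OF YZ[OF that]] A0 by (simp add: l_def)
  have k_regular: "(\<exists>w. dirder k x w \<noteq> 0) \<or> (\<forall>y\<in>X. k y = 0)" if "x \<in> X" for x
    using split kA k' that by (metis subsetD)
  have l_regular: "(\<exists>w. dirder l y0 w \<noteq> 0) \<or> (\<forall>y\<in>Y. l y = 0)"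
    using split lB l' by (metis subsetD)
  have curveA: "\<exists>c. c 0 = x \<and> (c has_vector_derivative v) (at 0) \<and> (\<forall>\<^sub>F s in nhds 0. c s \<in> X \<and> c s \<in> A)"
    if x: "x \<in> X" "x \<in> A" and v: "dirder k x v = 0" for x v
  proof -
    have kx: "k x = 0" using kA x by simp
    obtain c where c: "c 0 = x" "(c has_vector_derivative v) (at 0)" "\<forall>\<^sub>F s in nhds 0. c s \<in> X \<and> k (c s) = 0"
      using level_set_curve[OF X(1) k_smooth x(1) kx v k_regular[OF x(1)]] by blast
    have "\<forall>\<^sub>F s in nhds 0. c s \<in> X \<and> c s \<in> A"
      using c(3) by (rule eventually_mono) (use kA in blast)
    with c(1,2) show ?thesis by blast
  qed
  have isoA: "E (x, y) (v, 0) = 0" if x: "x \<in> X" "x \<in> A" and v: "dirder k x v = 0" and y: "y \<in> Y" "y \<in> B" for x y v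
  proof -
    obtain c where c: "c 0 = x" "(c has_vector_derivative v) (at 0)" "\<forall>\<^sub>F s in nhds 0. c s \<in> X \<and> c s \<in> A"
      using curveA[OF x v] by blast
    have "\<forall>\<^sub>F s in nhds 0. c s \<in> A" using c(3) by (rule eventually_mono) blast
    from isotropic[OF XYZ[OF x(1) y(1)] x(2) y(2) c(1,2) this] show ?thesis .
  qed
  \<comment> \<open>functions that vanish on a factor have no derivative along it\<close>
  have alongA: "dirder h x v = 0" if h: "smooth_on X h" "\<And>y. y \<in> X \<Longrightarrow> y \<in> A \<Longrightarrow> h y = 0"
    and x: "x \<in> X" "x \<in> A" and v: "dirder k x v = 0" for h :: "'n \<Rightarrow> real" and x v
  proof -
    obtain c where c: "c 0 = x" "(c has_vector_derivative v) (at 0)" "\<forall>\<^sub>F s in nhds 0. c s \<in> X \<and> c s \<in> A"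
      using curveA[OF x v] by blast
    have "\<forall>\<^sub>F s in nhds 0. h (c s) = 0" using c(3) by (rule eventually_mono) (use h(2) in blast)
    from derivative_along_zero_curve[OF smooth_on_has_derivative[OF h(1) X(1) x(1)] c(1,2) this]
    show ?thesis .
  qed
  have alongB: "dirder h (x, y0) (0, w) = 0" if h: "smooth_on Z h" "\<And>y. y \<in> Y \<Longrightarrow> y \<in> B \<Longrightarrow> h (x, y) = 0"
    and x: "x \<in> X" and w: "dirder l y0 w = 0" for h :: "'n \<times> 'l \<Rightarrow> real" and x w
  proof -
    have ly: "l y0 = 0" using lB[OF Y(2)] B0 by simp
    obtain c where c: "c 0 = y0" "(c has_vector_derivative w) (at 0)" "\<forall>\<^sub>F s in nhds 0. c s \<in> Y \<and> l (c s) = 0"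
      using level_set_curve[OF Y(1) l_smooth Y(2) ly w l_regular] by blast
    have "\<forall>\<^sub>F s in nhds 0. h (x, c s) = 0" using c(3) by (rule eventually_mono) (use h(2) lB in blast)
    from derivative_along_zero_curve[OF slice_has_derivative(2)[OF Z h(1) XZ[OF x]] c(1,2) this]
    show ?thesis .
  qed
  define q where "q = gradient_of (dirder l y0)"
  have q: "w \<bullet> q = dirder l y0 w" for w
    unfolding q_def by (rule gradient_of_inner[OF smooth_on_dirder_linear[OF l_smooth Y]])
  define wb where "wb = (\<lambda>b. b - ((b \<bullet> q) / (q \<bullet> q)) *\<^sub>R q)"
  have wb0: "dirder l y0 (wb b) = 0" for b
    unfolding q[symmetric] wb_def by (cases "q = 0") (simp_all add: inner_diff_left)
  have wb_span: "w = (\<Sum>b\<in>Basis. (w \<bullet> b) *\<^sub>R wb b)" if "dirder l y0 w = 0" for w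
  proof -
    have "(\<Sum>b\<in>Basis. (w \<bullet> b) *\<^sub>R wb b)
        = (\<Sum>b\<in>Basis. (w \<bullet> b) *\<^sub>R b) - ((\<Sum>b\<in>Basis. (w \<bullet> b) * (b \<bullet> q)) / (q \<bullet> q)) *\<^sub>R q"
      by (simp add: wb_def scaleR_diff_right sum_subtractf scaleR_sum_left sum_divide_distrib)
    also have "(\<Sum>b\<in>Basis. (w \<bullet> b) * (b \<bullet> q)) = (\<Sum>b\<in>Basis. (w \<bullet> b) * (q \<bullet> b))"
      by (intro sum.cong refl) (simp add: inner_commute)
    also have "\<dots> = w \<bullet> q"
      by (rule euclidean_inner[symmetric])
    finally show ?thesis using q[of w] that by (simp add: euclidean_representation)
  qed
  define p where "p = (\<lambda>b x. E (x, y0) (0, wb b))"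
  have p_smooth: "smooth_on X (p b)" for b
    unfolding p_def by (rule slice_smooth[OF Z E_smooth X(1) XZ])
  have p': "dirder (p b) x v = dirder (\<lambda>z. E z (0, wb b)) (x, y0) (v, 0)" if "x \<in> X" for b x v
    unfolding p_def by (rule slice_dirder[OF Z E_smooth XZ[OF that]])
  \<comment> \<open>\<open>E\<close> annihilates \<open>(v, 0)\<close> at all points \<open>(x, y)\<close> with \<open>y\<close> in \<open>B\<close>\<close>
  have EB: "dirder (\<lambda>z. E z (v, 0)) (x, y0) (0, w) = 0"
    if "x \<in> X" "x \<in> A" "dirder k x v = 0" "dirder l y0 w = 0" for x v w
    using that isoA by (intro alongB[OF E_smooth]) auto
  show ?thesis
  proof (rule solved_by_scaling_integrals[OF X XZ _ _ finite_Basis p_smooth])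
    show "K (x0, y0) = 0" by (rule K0)
    show "(\<exists>w. dirder (\<lambda>x. K (x, y0)) x0 w \<noteq> 0) \<or> (\<forall>x\<in>X. K (x, y0) = 0)"
      using k_regular[OF X(2)] by (simp add: k_def)
    show "constructible_on D X (p b)" for b
      unfolding p_def by (rule constructible_on_slice[OF E_constructible X(1) XZ])
  next
    fix b x assume x: "x \<in> X" and kx: "K (x, y0) = 0"
    have xA: "x \<in> A" using kA[OF x] kx by (simp add: k_def)
    let ?u = "u (x, y0)"
    have ku: "dirder k x ?u = 0" using field_of_K[OF XZ[OF x]] kx by (simp add: k'[OF x])
    have Kw: "dirder K (x, y0) (0, wb b) = 0"
      using zero_set[OF XYZ[OF x]] xA by (intro alongB[OF K_smooth _ x wb0]) auto
    have "dirder (p b) x ?u = ext_d E (x, y0) (?u, 0) (0, wb b) + dirder (\<lambda>z. E z (?u, 0)) (x, y0) (0, wb b)"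
      by (simp add: p'[OF x] ext_d_def)
    also have "\<dots> = f (x, y0) * E (x, y0) (0, wb b)"
      unfolding field[OF XZ[OF x]] Kw EB[OF x xA ku wb0] by simp
    finally show "dirder (p b) x ?u = f (x, y0) * p b x" by (simp add: p_def)
  next
    fix v assume "dirder (\<lambda>x. K (x, y0)) x0 v = 0" and pv: "\<And>b. b \<in> Basis \<Longrightarrow> dirder (p b) x0 v = 0"
    then have kv: "dirder k x0 v = 0" by (simp add: k_def)
    note lin = linear_ext_d[OF Z z0 E_linear E_smooth, of "(v, 0)"]
    have Ev: "E (x0, y0) (v, 0) = 0" by (rule isoA[OF X(2) A0 kv Y(2) B0])
    have dw: "ext_d E (x0, y0) (v, 0) (0, w) = 0" if w: "dirder l y0 w = 0" for w
    proof -
      have b: "ext_d E (x0, y0) (v, 0) (0, wb b) = 0" if "b \<in> Basis" for b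
        using pv[OF that] EB[OF X(2) A0 kv wb0, of b] by (simp add: p'[OF X(2)] ext_d_def)
      have l2: "linear (\<lambda>w. ext_d E (x0, y0) (v, 0) (0, w))" by (rule linear_partial2[OF lin])
      have "ext_d E (x0, y0) (v, 0) (0, \<Sum>b\<in>Basis. (w \<bullet> b) *\<^sub>R wb b) = 0"
        using linear_sum[OF l2, of "\<lambda>b. (w \<bullet> b) *\<^sub>R wb b" Basis] linear_scale[OF l2] b by simp
      then show ?thesis using wb_span[OF w] by simp
    qed
    have dt: "ext_d E (x0, y0) (v, 0) (t, 0) = 0" if t: "dirder k x0 t = 0" for t
    proof -
      have s: "smooth_on X (\<lambda>x. E (x, y0) (a, 0))" for a by (rule slice_smooth[OF Z E_smooth X(1) XZ])
      have d: "dirder (\<lambda>x. E (x, y0) (a, 0)) x0 b = dirder (\<lambda>z. E z (a, 0)) (x0, y0) (b, 0)" for a b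
        by (rule slice_dirder[OF Z E_smooth z0])
      \<comment> \<open>on \<open>A\<close> the form \<open>E(\<cdot>, 0)\<close> vanishes on the kernel of \<open>dk\<close>, so it is a multiple \<open>m dk\<close> of it, and its
        derivatives along \<open>A\<close> are symmetric up to terms that vanish on that kernel\<close>
      have "\<exists>m. \<forall>a b. dirder k x0 a = 0 \<longrightarrow> dirder k x0 b = 0 \<longrightarrow>
          dirder (\<lambda>x. E (x, y0) (a, 0)) x0 b = m * dirder (\<lambda>x. dirder k x a) x0 b"
      proof (cases "\<exists>\<rho>. \<forall>x\<in>X. dirder K (x, y0) (\<rho>, 0) \<noteq> 0")
        case True
        then obtain \<rho> where \<rho>: "\<And>x. x \<in> X \<Longrightarrow> dirder k x \<rho> \<noteq> 0" using k' by auto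
        define m where "m = (\<lambda>x. E (x, y0) (\<rho>, 0) / dirder k x \<rho>)"
        have m: "smooth_on X m" unfolding m_def
          by (rule smooth_on_divide[OF X(1) s smooth_on_dirder[OF k_smooth] \<rho>])
        show ?thesis
        proof (intro exI[of _ "m x0"] allI impI)
          fix a b assume a: "dirder k x0 a = 0" and b: "dirder k x0 b = 0"
          let ?h = "\<lambda>x. E (x, y0) (a, 0) - m x * dirder k x a"
          note k2 = smooth_on_dirder[OF k_smooth, of a]
          have "dirder ?h x0 b = 0"
          proof (rule alongA[OF _ _ X(2) A0 b])
            show "smooth_on X ?h"
              by (rule smooth_on_diff[OF X(1) s smooth_on_mult[OF X(1) m k2]])
            fix x assume x: "x \<in> X" "x \<in> A"
            let ?c = "dirder k x a / dirder k x \<rho>"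
            have "linear (dirder k x)" by (rule smooth_on_dirder_linear[OF k_smooth X(1) x(1)])
            then have "dirder k x (a - ?c *\<^sub>R \<rho>) = 0" using \<rho>[OF x(1)] by (simp add: linear_diff linear_scale)
            then have "E (x, y0) (a - ?c *\<^sub>R \<rho>, 0) = 0" by (intro isoA[OF x _ Y(2) B0])
            moreover have l1: "linear (\<lambda>a. E (x, y0) (a, 0))" by (rule linear_partial1[OF E_linear[OF XZ[OF x(1)]]])
            ultimately show "?h x = 0" using linear_diff[OF l1, of a "?c *\<^sub>R \<rho>"] linear_scale[OF l1, of ?c \<rho>]
              by (simp add: m_def)
          qed
          moreover have "dirder ?h x0 b = dirder (\<lambda>x. E (x, y0) (a, 0)) x0 b
              - (m x0 * dirder (\<lambda>x. dirder k x a) x0 b + dirder m x0 b * dirder k x0 a)"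
            by (rule dirder_eq[OF has_derivative_diff[OF smooth_on_has_derivative[OF s X]
                has_derivative_mult[OF smooth_on_has_derivative[OF m X] smooth_on_has_derivative[OF k2 X]]]])
          ultimately show "dirder (\<lambda>x. E (x, y0) (a, 0)) x0 b = m x0 * dirder (\<lambda>x. dirder k x a) x0 b"
            using a by simp
        qed
      next
        case False
        then have XA: "X \<subseteq> A" using split by blast
        have k0: "dirder k x a = 0" if x: "x \<in> X" for x a
        proof -
          have "dirder k x a = dirder (\<lambda>x. 0 :: real) x a"
            by (rule dirder_cong[OF X(1) x k_smooth]) (use kA XA in blast)
          then show ?thesis by (simp add: dirder_eq[OF has_derivative_const])
        qed
        have "dirder (\<lambda>x. E (x, y0) (a, 0)) x0 b = 0" for a b
        proof (rule alongA[OF s _ X(2) A0 k0[OF X(2)]])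
          show "E (x, y0) (a, 0) = 0" if "x \<in> X" "x \<in> A" for x
            by (rule isoA[OF that k0[OF that(1)] Y(2) B0])
        qed
        then show ?thesis by (intro exI[of _ 0]) simp
      qed
      then obtain m where m: "\<And>a b. dirder k x0 a = 0 \<Longrightarrow> dirder k x0 b = 0 \<Longrightarrow>
          dirder (\<lambda>x. E (x, y0) (a, 0)) x0 b = m * dirder (\<lambda>x. dirder k x a) x0 b" by blast
      have "dirder (\<lambda>x. dirder k x t) x0 v = dirder (\<lambda>x. dirder k x v) x0 t"
        by (rule dirder_symmetric_real[OF X(1) k_smooth X(2)])
      then show ?thesis using m[OF t kv] m[OF kv t] by (simp add: ext_d_def d)
    qed
    have dtw: "ext_d E (x0, y0) (v, 0) a = 0" if a: "dirder K (x0, y0) a = 0" for a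
    proof -
      obtain t w where tw: "a = (t, w)" by (cases a)
      have "dirder K (x0, y0) ((t, 0) + (0, w)) = dirder K (x0, y0) (t, 0) + dirder K (x0, y0) (0, w)"
        by (rule linear_add[OF smooth_on_dirder_linear[OF K_smooth Z z0]])
      then have sum0: "dirder k x0 t + dirder l y0 w = 0" using a by (simp add: tw k'[OF X(2)] l')
      \<comment> \<open>one factor of the zero set is open, so the differential of \<open>K\<close> in it vanishes\<close>
      have "dirder k x0 t = 0 \<or> dirder l y0 w = 0"
        using split
      proof
        assume "Y \<subseteq> B \<and> (\<exists>\<rho>. \<forall>x\<in>X. dirder K (x, y0) (\<rho>, 0) \<noteq> 0)"
        then have YB: "Y \<subseteq> B" by blast
        have "dirder l y0 w = dirder (\<lambda>y. 0 :: real) y0 w"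
          by (rule dirder_cong[OF Y l_smooth]) (use lB YB in blast)
        then show ?thesis by (simp add: dirder_eq[OF has_derivative_const])
      next
        assume "X \<subseteq> A \<and> (\<exists>w. dirder K (x0, y0) (0, w) \<noteq> 0)"
        then have XA: "X \<subseteq> A" by blast
        have "dirder k x0 t = dirder (\<lambda>x. 0 :: real) x0 t"
          by (rule dirder_cong[OF X k_smooth]) (use kA XA in blast)
        then show ?thesis by (simp add: dirder_eq[OF has_derivative_const])
      qed
      then have "dirder k x0 t = 0" "dirder l y0 w = 0" using sum0 by auto
      then have "ext_d E (x0, y0) (v, 0) (t, 0) + ext_d E (x0, y0) (v, 0) (0, w) = 0" using dt dw by simp
      then show ?thesis using linear_add[OF lin, of "(t, 0)" "(0, w)"] by (simp add: tw)
    qed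
    obtain r where r: "\<And>b. ext_d E (x0, y0) r b = 0" "dirder K (x0, y0) r = f (x0, y0)"
      using reeb[OF z0] by blast
    have "ext_d E (x0, y0) (v, 0) a = 0" for a
    proof -
      let ?c = "dirder K (x0, y0) a / f (x0, y0)"
      note Kl = smooth_on_dirder_linear[OF K_smooth Z z0]
      have "dirder K (x0, y0) (a - ?c *\<^sub>R r) = 0"
        using f_nonzero[OF z0] by (simp add: linear_diff[OF Kl] linear_scale[OF Kl] r(2))
      then have "ext_d E (x0, y0) (v, 0) (a - ?c *\<^sub>R r) = 0" by (rule dtw)
      moreover have "ext_d E (x0, y0) (v, 0) r = 0" using r(1)[of "(v, 0)"] ext_d_swap[of E "(x0, y0)" "(v, 0)" r] by simp
      ultimately show ?thesis by (simp add: linear_diff[OF lin] linear_scale[OF lin])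
    qed
    then have "(v, 0 :: 'l) = 0" by (rule contact[OF z0 Ev])
    then show "v = 0" by (simp add: zero_prod_def)
  qed
qed

section \<open>Parametrizations of manifolds and pushed-forward vectors\<close>

lemma is_chartD:
  assumes "is_chart (U, \<phi>)"
  shows "open U" "open (\<phi> ` U)" "continuous_on U \<phi>" "continuous_on (\<phi> ` U) (inv_into U \<phi>)" "inj_on \<phi> U"
    "\<And>p. p \<in> U \<Longrightarrow> inv_into U \<phi> (\<phi> p) = p"
  using assms by (auto simp: is_chart_def homeomorphism_def intro: inj_on_inverseI)

lemma chart_open_image:
  assumes c: "is_chart (U, \<phi>)" and T: "open T"
  shows "open (\<phi> ` (U \<inter> T))"
proof -
  have "\<phi> ` (U \<inter> T) = \<phi> ` U \<inter> inv_into U \<phi> -` T"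
    using is_chartD(6)[OF c] by auto
  then show ?thesis
    using continuous_open_preimage[OF is_chartD(4)[OF c] is_chartD(2)[OF c] T] by simp
qed

lemma smooth_fun_on_iff:
  "smooth_fun_on M W f \<longleftrightarrow> open W \<and> continuous_on W f \<and>
    (\<forall>(U, \<phi>)\<in>M. smooth_on (\<phi> ` (U \<inter> W)) (\<lambda>x. f (inv_into U \<phi> x)))"
  unfolding smooth_map_on_def euclidean_atlas_def by (simp add: o_def)

lemma manifoldD:
  assumes "manifold M"
  shows "c \<in> M \<Longrightarrow> is_chart c" "\<exists>c\<in>M. p \<in> fst c" "c \<in> M \<Longrightarrow> c \<in> maximal_atlas M"
  using assms unfolding manifold_def maximal_atlas_def by auto

lemma manifold_chart:
  assumes "manifold M" obtains U \<phi> where "(U, \<phi>) \<in> M" "p \<in> U"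
  using manifoldD(2)[OF assms, of p] by auto

lemma maximal_atlasD:
  assumes "(U, \<phi>) \<in> maximal_atlas M"
  shows "is_chart (U, \<phi>)"
    "(V, \<psi>) \<in> M \<Longrightarrow> smooth_on (\<phi> ` (U \<inter> V)) (\<lambda>x. \<psi> (inv_into U \<phi> x))"
    "(V, \<psi>) \<in> M \<Longrightarrow> smooth_on (\<psi> ` (U \<inter> V)) (\<lambda>x. \<phi> (inv_into V \<psi> x))"
  using assms unfolding maximal_atlas_def compatible_def by (auto simp: o_def)

lemma chart_coordinate_smooth:
  assumes M: "manifold M" and c: "(U, \<phi>) \<in> maximal_atlas M"
  shows "smooth_fun_on M U (\<lambda>p. \<phi> p \<bullet> b)"
  unfolding smooth_fun_on_iff
proof (intro conjI ballI, safe)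
  note ch = maximal_atlasD(1)[OF c]
  show "open U" by (rule is_chartD(1)[OF ch])
  show "continuous_on U (\<lambda>p. \<phi> p \<bullet> b)" by (intro continuous_intros is_chartD(3)[OF ch])
  fix V \<psi> assume d: "(V, \<psi>) \<in> M"
  have "open (\<psi> ` (V \<inter> U))"
    by (rule chart_open_image[OF manifoldD(1)[OF M d] is_chartD(1)[OF ch]])
  then show "smooth_on (\<psi> ` (V \<inter> U)) (\<lambda>x. \<phi> (inv_into V \<psi> x) \<bullet> b)"
    using maximal_atlasD(3)[OF c d] by (intro smooth_on_linear_compose[OF bounded_linear_inner_left]) (simp_all add: Int_commute)
qed

text \<open>
  A map from an open set of a Euclidean space to a manifold is smooth if it pulls smooth functions back
  to smooth functions. In this form compositions need no charts.
\<close>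

definition smooth_param ::
    "('a::topological_space, 'e::euclidean_space) atlas \<Rightarrow> 'z::euclidean_space set \<Rightarrow> ('z \<Rightarrow> 'a) \<Rightarrow> bool" where
  "smooth_param M Z s \<longleftrightarrow> open Z \<and> continuous_on Z s \<and>
     (\<forall>W f. smooth_fun_on M W f \<longrightarrow> smooth_on (Z \<inter> s -` W) (\<lambda>z. f (s z)))"

text \<open>
  The image of \<open>w\<close> under the differential of \<open>s\<close> at \<open>z\<close>, as a derivation. Coordinate vectors are the case
  where \<open>s\<close> is the inverse of a chart.
\<close>

definition push_vec ::
    "('a::topological_space, 'e::euclidean_space) atlas \<Rightarrow> ('z::euclidean_space \<Rightarrow> 'a) \<Rightarrow> 'z \<Rightarrow> 'z \<Rightarrow> 'a tvec" where
  "push_vec M s z w f = (if smooth_near M (s z) f then dirder (\<lambda>z. f (s z)) z w else 0)"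

lemma smooth_paramD:
  assumes "smooth_param M Z s"
  shows "open Z" "continuous_on Z s" "smooth_fun_on M W f \<Longrightarrow> smooth_on (Z \<inter> s -` W) (\<lambda>z. f (s z))"
    "open W \<Longrightarrow> open (Z \<inter> s -` W)"
  using assms unfolding smooth_param_def by (auto intro: continuous_open_preimage)

lemma smooth_param_subset:
  assumes "smooth_param M Z s" "open Y" "Y \<subseteq> Z"
  shows "smooth_param M Y s"
  unfolding smooth_param_def
proof (intro conjI allI impI)
  show "continuous_on Y s" by (rule continuous_on_subset[OF smooth_paramD(2)[OF assms(1)] assms(3)])
  fix W f assume "smooth_fun_on M W f"
  from smooth_paramD(3)[OF assms(1) this] show "smooth_on (Y \<inter> s -` W) (\<lambda>z. f (s z))"
    by (rule smooth_on_subset) (use assms(3) in blast)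
qed (rule assms(2))

lemma smooth_param_has_derivative:
  assumes s: "smooth_param M Z s" and z: "z \<in> Z" and f: "smooth_near M (s z) f"
  shows "((\<lambda>z. f (s z)) has_derivative dirder (\<lambda>z. f (s z)) z) (at z)"
proof -
  obtain W where W: "s z \<in> W" "smooth_fun_on M W f" using f by (auto simp: smooth_near_def)
  have "open W" using W(2) by (simp add: smooth_fun_on_iff)
  show ?thesis
    by (rule smooth_on_has_derivative[OF smooth_paramD(3)[OF s W(2)] smooth_paramD(4)[OF s \<open>open W\<close>]])
       (use z W(1) in blast)
qed

lemma smooth_param_chart_smooth:
  assumes M: "manifold M" and c: "(U, \<phi>) \<in> maximal_atlas M" and s: "smooth_param M Z s"
  shows "smooth_on (Z \<inter> s -` U) (\<lambda>z. \<phi> (s z))"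
  by (rule smooth_on_componentwise[OF smooth_paramD(4)[OF s is_chartD(1)[OF maximal_atlasD(1)[OF c]]]])
     (rule smooth_paramD(3)[OF s chart_coordinate_smooth[OF M c]])

text \<open>
  A chart of the maximal atlas need not belong to the atlas, so smoothness is checked through the charts
  of the atlas around each point.
\<close>

lemma smooth_param_inv_chart:
  assumes M: "manifold M" and c: "(U, \<phi>) \<in> maximal_atlas M"
  shows "smooth_param M (\<phi> ` U) (inv_into U \<phi>)"
  unfolding smooth_param_def
proof (intro conjI allI impI)
  note ch = maximal_atlasD(1)[OF c]
  show "open (\<phi> ` U)" "continuous_on (\<phi> ` U) (inv_into U \<phi>)" using is_chartD[OF ch] by blast+
  fix W f assume f: "smooth_fun_on M W f"
  have W: "open W" using f by (simp add: smooth_fun_on_iff)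
  show "smooth_on (\<phi> ` U \<inter> inv_into U \<phi> -` W) (\<lambda>x. f (inv_into U \<phi> x))"
  proof (rule smooth_on_local)
    fix x assume x: "x \<in> \<phi> ` U \<inter> inv_into U \<phi> -` W"
    then obtain p where p: "p \<in> U" "x = \<phi> p" "p \<in> W" using is_chartD(6)[OF ch] by auto
    obtain V \<psi> where d: "(V, \<psi>) \<in> M" "p \<in> V" using manifold_chart[OF M] .
    note dch = manifoldD(1)[OF M d(1)]
    have V: "open V" by (rule is_chartD(1)[OF dch])
    let ?T = "\<phi> ` (U \<inter> (V \<inter> W))"
    have T: "open ?T" by (rule chart_open_image[OF ch open_Int[OF V W]])
    have "smooth_on ?T (\<lambda>x. (\<lambda>y. f (inv_into V \<psi> y)) (\<psi> (inv_into U \<phi> x)))"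
    proof (rule smooth_on_compose[OF T, where T = "\<psi> ` (V \<inter> W)"])
      show "open (\<psi> ` (V \<inter> W))" by (rule chart_open_image[OF dch W])
      show "(\<lambda>x. \<psi> (inv_into U \<phi> x)) ` ?T \<subseteq> \<psi> ` (V \<inter> W)" using is_chartD(6)[OF ch] by auto
      show "smooth_on ?T (\<lambda>x. \<psi> (inv_into U \<phi> x))"
        by (rule smooth_on_subset[OF maximal_atlasD(2)[OF c d(1)]]) auto
      show "smooth_on (\<psi> ` (V \<inter> W)) (\<lambda>y. f (inv_into V \<psi> y))" using f d(1) by (auto simp: smooth_fun_on_iff)
    qed
    then have "smooth_on ?T (\<lambda>x. f (inv_into U \<phi> x))"
      by (rule smooth_on_cong[OF T, rotated]) (use is_chartD(6)[OF ch] is_chartD(6)[OF dch] in auto)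
    then show "\<exists>T. open T \<and> x \<in> T \<and> smooth_on T (\<lambda>x. f (inv_into U \<phi> x))"
      using T p d(2) by (intro exI[of _ ?T]) blast
  qed
qed

lemma smooth_fun_on_compose:
  assumes M: "\<And>c. c \<in> M \<Longrightarrow> is_chart c" and N: "manifold N"
    and F: "smooth_map_on M N W F" and g: "smooth_fun_on N V g"
  shows "smooth_fun_on M (W \<inter> F -` V) (\<lambda>p. g (F p))"
  unfolding smooth_fun_on_iff
proof (intro conjI ballI, safe)
  have W: "open W" and cF: "continuous_on W F" using F by (auto simp: smooth_map_on_def)
  have V: "open V" and cg: "continuous_on V g" using g by (auto simp: smooth_fun_on_iff)
  show WV: "open (W \<inter> F -` V)" by (rule continuous_open_preimage[OF cF W V])
  show "continuous_on (W \<inter> F -` V) (\<lambda>p. g (F p))"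
    by (rule continuous_on_compose2[OF cg continuous_on_subset[OF cF]]) auto
  fix U \<phi> assume c: "(U, \<phi>) \<in> M"
  note ch = M[OF c]
  show "smooth_on (\<phi> ` (U \<inter> (W \<inter> F -` V))) (\<lambda>x. g (F (inv_into U \<phi> x)))"
  proof (rule smooth_on_local)
    fix x assume "x \<in> \<phi> ` (U \<inter> (W \<inter> F -` V))"
    then obtain p where p: "p \<in> U" "x = \<phi> p" "p \<in> W" "F p \<in> V" by auto
    obtain V' \<psi> where d: "(V', \<psi>) \<in> N" "F p \<in> V'" using manifold_chart[OF N] .
    note dch = manifoldD(1)[OF N d(1)]
    let ?T = "\<phi> ` (U \<inter> (W \<inter> F -` (V \<inter> V')))"
    have T: "open ?T"
      by (rule chart_open_image[OF ch continuous_open_preimage[OF cF W open_Int[OF V is_chartD(1)[OF dch]]]])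
    have "smooth_on ?T (\<lambda>x. (\<lambda>y. g (inv_into V' \<psi> y)) (\<psi> (F (inv_into U \<phi> x))))"
    proof (rule smooth_on_compose[OF T, where T = "\<psi> ` (V' \<inter> V)"])
      show "open (\<psi> ` (V' \<inter> V))" by (rule chart_open_image[OF dch V])
      show "(\<lambda>x. \<psi> (F (inv_into U \<phi> x))) ` ?T \<subseteq> \<psi> ` (V' \<inter> V)" using is_chartD(6)[OF ch] by auto
      have "smooth_on (\<phi> ` (U \<inter> W \<inter> F -` V')) (\<psi> \<circ> F \<circ> inv_into U \<phi>)"
        using F c d(1) by (auto simp: smooth_map_on_def)
      then show "smooth_on ?T (\<lambda>x. \<psi> (F (inv_into U \<phi> x)))"
        unfolding o_def by (rule smooth_on_subset) auto
      show "smooth_on (\<psi> ` (V' \<inter> V)) (\<lambda>y. g (inv_into V' \<psi> y))" using g d(1) by (auto simp: smooth_fun_on_iff)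
    qed
    then have "smooth_on ?T (\<lambda>x. g (F (inv_into U \<phi> x)))"
      by (rule smooth_on_cong[OF T, rotated]) (use is_chartD(6)[OF ch] is_chartD(6)[OF dch] in auto)
    then show "\<exists>T. open T \<and> x \<in> T \<and> smooth_on T (\<lambda>x. g (F (inv_into U \<phi> x)))"
      using T p d(2) by (intro exI[of _ ?T]) blast
  qed
qed

lemma smooth_near_compose:
  assumes M: "\<And>c. c \<in> M \<Longrightarrow> is_chart c" and N: "manifold N"
    and F: "smooth_map_on M N W F" and p: "p \<in> W" and g: "smooth_near N (F p) g"
  shows "smooth_near M p (\<lambda>p. g (F p))"
proof -
  obtain V where V: "F p \<in> V" "smooth_fun_on N V g" using g by (auto simp: smooth_near_def)
  have "smooth_fun_on M (W \<inter> F -` V) (\<lambda>p. g (F p))" by (rule smooth_fun_on_compose[OF M N F V(2)])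
  moreover have "p \<in> W \<inter> F -` V" using p V(1) by blast
  ultimately show ?thesis unfolding smooth_near_def by (intro exI[of _ "W \<inter> F -` V"] conjI)
qed

lemma smooth_param_compose:
  assumes M: "\<And>c. c \<in> M \<Longrightarrow> is_chart c" and N: "manifold N"
    and F: "smooth_map_on M N W F" and s: "smooth_param M Z s"
  shows "smooth_param N (Z \<inter> s -` W) (\<lambda>z. F (s z))"
  unfolding smooth_param_def
proof (intro conjI allI impI)
  have W: "open W" and cF: "continuous_on W F" using F by (auto simp: smooth_map_on_def)
  show "open (Z \<inter> s -` W)" by (rule smooth_paramD(4)[OF s W])
  show "continuous_on (Z \<inter> s -` W) (\<lambda>z. F (s z))"
    by (rule continuous_on_compose2[OF cF continuous_on_subset[OF smooth_paramD(2)[OF s]]]) auto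
  fix V g assume "smooth_fun_on N V g"
  from smooth_paramD(3)[OF s smooth_fun_on_compose[OF M N F this]]
  show "smooth_on (Z \<inter> s -` W \<inter> (\<lambda>z. F (s z)) -` V) (\<lambda>z. g (F (s z)))"
    by (rule smooth_on_subset) auto
qed

lemma coord_vec_eq_push_vec:
  assumes "is_chart (U, \<phi>)" "p \<in> U"
  shows "coord_vec M (U, \<phi>) p w = push_vec M (inv_into U \<phi>) (\<phi> p) w"
  unfolding coord_vec_def push_vec_def using is_chartD(6)[OF assms] by (auto simp: fun_eq_iff o_def)

text \<open>
  The chain rule. With \<open>s\<close> the inverse of another chart it is the transformation law of components.
\<close>

lemma push_vec_eq_coord_vec:
  assumes M: "manifold M" and c: "(U, \<phi>) \<in> maximal_atlas M" and s: "smooth_param M Z s"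
    and z: "z \<in> Z" "s z \<in> U"
  shows "push_vec M s z w = coord_vec M (U, \<phi>) (s z) (dirder (\<lambda>z. \<phi> (s z)) z w)"
proof
  fix f
  note ch = maximal_atlasD(1)[OF c]
  note inv = is_chartD(6)[OF ch]
  show "push_vec M s z w f = coord_vec M (U, \<phi>) (s z) (dirder (\<lambda>z. \<phi> (s z)) z w) f"
  proof (cases "smooth_near M (s z) f")
    case True
    have U: "open (Z \<inter> s -` U)" by (rule smooth_paramD(4)[OF s is_chartD(1)[OF ch]])
    have zU: "z \<in> Z \<inter> s -` U" using z by blast
    have x: "\<phi> (s z) \<in> \<phi> ` U" using z(2) by blast
    have f': "((\<lambda>x. f (inv_into U \<phi> x)) has_derivative dirder (\<lambda>x. f (inv_into U \<phi> x)) (\<phi> (s z))) (at (\<phi> (s z)))"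
      by (rule smooth_param_has_derivative[OF smooth_param_inv_chart[OF M c] x]) (simp add: inv z(2) True)
    have s': "((\<lambda>z. \<phi> (s z)) has_derivative dirder (\<lambda>z. \<phi> (s z)) z) (at z)"
      by (rule smooth_on_has_derivative[OF smooth_param_chart_smooth[OF M c s] U zU])
    have "((\<lambda>z. f (inv_into U \<phi> (\<phi> (s z)))) has_derivative
        (\<lambda>w. dirder (\<lambda>x. f (inv_into U \<phi> x)) (\<phi> (s z)) (dirder (\<lambda>z. \<phi> (s z)) z w))) (at z)"
      by (rule has_derivative_compose[OF s' f'])
    then have "((\<lambda>z. f (s z)) has_derivative
        (\<lambda>w. dirder (\<lambda>x. f (inv_into U \<phi> x)) (\<phi> (s z)) (dirder (\<lambda>z. \<phi> (s z)) z w))) (at z)"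
      by (rule has_derivative_transform_within_open[where s = "Z \<inter> s -` U", OF _ U zU]) (simp add: inv)
    from dirder_eq[OF this, of w] show ?thesis
      by (simp add: push_vec_def coord_vec_def True o_def)
  qed (simp add: push_vec_def coord_vec_def)
qed

lemma push_vec_linear:
  assumes s: "smooth_param M Z s" and z: "z \<in> Z"
  shows "push_vec M s z (a *\<^sub>R v + b *\<^sub>R w) = (\<lambda>f. a * push_vec M s z v f + b * push_vec M s z w f)"
proof
  fix f
  show "push_vec M s z (a *\<^sub>R v + b *\<^sub>R w) f = a * push_vec M s z v f + b * push_vec M s z w f"
    using has_derivative_linear[OF smooth_param_has_derivative[OF s z, of f]]
    by (simp add: push_vec_def linear_add linear_scale)
qed

lemma push_vec_in_tangent_space:
  assumes M: "manifold M" and s: "smooth_param M Z s" and z: "z \<in> Z"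
  shows "push_vec M s z w \<in> tangent_space M (s z)"
proof -
  obtain U \<phi> where c: "(U, \<phi>) \<in> M" "s z \<in> U" using manifold_chart[OF M] .
  have "push_vec M s z w = coord_vec M (U, \<phi>) (s z) (dirder (\<lambda>z. \<phi> (s z)) z w)"
    by (rule push_vec_eq_coord_vec[OF M manifoldD(3)[OF M c(1)] s z c(2)])
  then show ?thesis using c unfolding tangent_space_def by force
qed

lemma pushforward_push_vec:
  assumes M: "\<And>c. c \<in> M \<Longrightarrow> is_chart c" and N: "manifold N"
    and F: "smooth_map_on M N W F" and sW: "s z \<in> W"
  shows "pushforward N F (s z) (push_vec M s z w) = push_vec N (\<lambda>z. F (s z)) z w"
proof
  fix g
  show "pushforward N F (s z) (push_vec M s z w) g = push_vec N (\<lambda>z. F (s z)) z w g"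
    using smooth_near_compose[OF M N F sW, of g] by (simp add: pushforward_def push_vec_def o_def)
qed

lemma push_vec_slice:
  fixes s :: "'n::euclidean_space \<times> 'l::euclidean_space \<Rightarrow> 'a::topological_space"
  assumes s: "smooth_param M Z s" and z: "(x, y) \<in> Z"
  shows "push_vec M (\<lambda>x. s (x, y)) x v = push_vec M s (x, y) (v, 0)"
proof
  fix f
  have "dirder (\<lambda>x. f (s (x, y))) x v = dirder (\<lambda>z. f (s z)) (x, y) (v, 0)" if f: "smooth_near M (s (x, y)) f"
  proof -
    have "((\<lambda>x. (x, y)) has_derivative (\<lambda>v. (v, 0))) (at x)" by (auto intro!: derivative_eq_intros)
    from has_derivative_compose[OF this smooth_param_has_derivative[OF s z f]]
    show ?thesis by (rule dirder_eq)
  qed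
  then show "push_vec M (\<lambda>x. s (x, y)) x v f = push_vec M s (x, y) (v, 0) f" by (simp add: push_vec_def)
qed

lemma prod_atlasE:
  assumes "c \<in> prod_atlas N L"
  obtains U \<phi> V \<psi> where "c = (U \<times> V, map_prod \<phi> \<psi>)" "(U, \<phi>) \<in> N" "(V, \<psi>) \<in> L"
  using assms unfolding prod_atlas_def by blast

lemma inv_into_map_prod:
  assumes "is_chart (U, \<phi>)" "is_chart (V, \<psi>)" "z \<in> \<phi> ` U \<times> \<psi> ` V"
  shows "inv_into (U \<times> V) (map_prod \<phi> \<psi>) z = (inv_into U \<phi> (fst z), inv_into V \<psi> (snd z))"
proof -
  obtain p q where pq: "p \<in> U" "q \<in> V" "z = (\<phi> p, \<psi> q)" using assms(3) by (cases z) auto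
  have "inj_on (map_prod \<phi> \<psi>) (U \<times> V)"
    by (rule map_prod_inj_on[OF is_chartD(5)[OF assms(1)] is_chartD(5)[OF assms(2)]])
  from inv_into_f_f[OF this, of "(p, q)"] show ?thesis
    using pq is_chartD(6)[OF assms(1)] is_chartD(6)[OF assms(2)] by simp
qed

lemma is_chart_prod:
  assumes c: "is_chart (U, \<phi>)" and d: "is_chart (V, \<psi>)"
  shows "is_chart (U \<times> V, map_prod \<phi> \<psi>)"
proof -
  have im: "map_prod \<phi> \<psi> ` (U \<times> V) = \<phi> ` U \<times> \<psi> ` V" by (rule map_prod_surj_on) auto
  have "continuous_on (U \<times> V) (\<lambda>z. (\<phi> (fst z), \<psi> (snd z)))"
    by (intro continuous_on_Pair continuous_on_compose2[OF is_chartD(3)[OF c]] continuous_on_compose2[OF is_chartD(3)[OF d]]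
        continuous_on_fst continuous_on_snd continuous_on_id) auto
  then have 1: "continuous_on (U \<times> V) (map_prod \<phi> \<psi>)" by (simp add: map_prod_def case_prod_unfold)
  have 2: "continuous_on (\<phi> ` U \<times> \<psi> ` V) (\<lambda>z. (inv_into U \<phi> (fst z), inv_into V \<psi> (snd z)))"
    by (intro continuous_on_Pair continuous_on_compose2[OF is_chartD(4)[OF c]] continuous_on_compose2[OF is_chartD(4)[OF d]]
        continuous_on_fst continuous_on_snd continuous_on_id) auto
  have 3: "continuous_on (\<phi> ` U \<times> \<psi> ` V) (inv_into (U \<times> V) (map_prod \<phi> \<psi>))"
    by (rule continuous_on_eq[OF 2]) (simp add: inv_into_map_prod[OF c d])
  have 4: "inv_into (U \<times> V) (map_prod \<phi> \<psi>) ` (\<phi> ` U \<times> \<psi> ` V) = U \<times> V"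
  proof -
    have "inv_into (U \<times> V) (map_prod \<phi> \<psi>) ` (\<phi> ` U \<times> \<psi> ` V) = (\<lambda>z. (inv_into U \<phi> (fst z), inv_into V \<psi> (snd z))) ` (\<phi> ` U \<times> \<psi> ` V)"
      by (rule image_cong[OF refl inv_into_map_prod[OF c d]])
    also have "\<dots> = U \<times> V"
    proof
      show "U \<times> V \<subseteq> (\<lambda>z. (inv_into U \<phi> (fst z), inv_into V \<psi> (snd z))) ` (\<phi> ` U \<times> \<psi> ` V)"
      proof
        fix z assume "z \<in> U \<times> V"
        then show "z \<in> (\<lambda>z. (inv_into U \<phi> (fst z), inv_into V \<psi> (snd z))) ` (\<phi> ` U \<times> \<psi> ` V)"
          using is_chartD(6)[OF c] is_chartD(6)[OF d] by (intro image_eqI[of _ _ "map_prod \<phi> \<psi> z"]) auto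
      qed
    qed (use is_chartD(6)[OF c] is_chartD(6)[OF d] in auto)
    finally show ?thesis .
  qed
  have 5: "inv_into (U \<times> V) (map_prod \<phi> \<psi>) (map_prod \<phi> \<psi> z) = z" if "z \<in> U \<times> V" for z
    by (rule inv_into_f_f[OF map_prod_inj_on[OF is_chartD(5)[OF c] is_chartD(5)[OF d]] that])
  have 6: "map_prod \<phi> \<psi> (inv_into (U \<times> V) (map_prod \<phi> \<psi>) z) = z" if "z \<in> \<phi> ` U \<times> \<psi> ` V" for z
    using f_inv_into_f[of z "map_prod \<phi> \<psi>" "U \<times> V"] that im by simp
  show ?thesis
    unfolding is_chart_def homeomorphism_def case_prod_conv im
    using 1 3 4 5 6 im is_chartD(1,2)[OF c] is_chartD(1,2)[OF d] by (simp add: open_Times)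
qed

lemma compatible_prod:
  assumes c: "is_chart (U, \<phi>)" "is_chart (U', \<phi>')" and d: "is_chart (V, \<psi>)" "is_chart (V', \<psi>')"
    and 1: "compatible (U, \<phi>) (U', \<phi>')" and 2: "compatible (V, \<psi>) (V', \<psi>')"
  shows "smooth_on (map_prod \<phi> \<psi> ` ((U \<times> V) \<inter> (U' \<times> V'))) (map_prod \<phi>' \<psi>' \<circ> inv_into (U \<times> V) (map_prod \<phi> \<psi>))"
proof -
  have im: "map_prod \<phi> \<psi> ` ((U \<times> V) \<inter> (U' \<times> V')) = \<phi> ` (U \<inter> U') \<times> \<psi> ` (V \<inter> V')" by auto
  have O1: "open (\<phi> ` (U \<inter> U'))" by (rule chart_open_image[OF c(1) is_chartD(1)[OF c(2)]])
  have O2: "open (\<psi> ` (V \<inter> V'))" by (rule chart_open_image[OF d(1) is_chartD(1)[OF d(2)]])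
  let ?T = "\<phi> ` (U \<inter> U') \<times> \<psi> ` (V \<inter> V')"
  have T: "open ?T" by (rule open_Times[OF O1 O2])
  have s1: "smooth_on (\<phi> ` (U \<inter> U')) (\<lambda>x. \<phi>' (inv_into U \<phi> x))" and s2: "smooth_on (\<psi> ` (V \<inter> V')) (\<lambda>x. \<psi>' (inv_into V \<psi> x))"
    using 1 2 by (auto simp: compatible_def o_def)
  have "smooth_on ?T (\<lambda>z. (\<phi>' (inv_into U \<phi> (fst z)), \<psi>' (inv_into V \<psi> (snd z))))"
  proof (rule smooth_on_Pair[OF T])
    show "smooth_on ?T (\<lambda>z. \<phi>' (inv_into U \<phi> (fst z)))"
      by (rule smooth_on_compose[OF T O1 _ smooth_on_bounded_linear[OF bounded_linear_fst] s1]) auto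
    show "smooth_on ?T (\<lambda>z. \<psi>' (inv_into V \<psi> (snd z)))"
      by (rule smooth_on_compose[OF T O2 _ smooth_on_bounded_linear[OF bounded_linear_snd] s2]) auto
  qed
  then have "smooth_on ?T (map_prod \<phi>' \<psi>' \<circ> inv_into (U \<times> V) (map_prod \<phi> \<psi>))"
    by (rule smooth_on_cong[OF T, rotated]) (auto simp: inv_into_map_prod[OF c(1) d(1)])
  then show ?thesis by (simp only: im)
qed

lemma manifold_prod:
  assumes N: "manifold N" and L: "manifold L"
  shows "manifold (prod_atlas N L)"
  unfolding manifold_def
proof (intro conjI ballI)
  show "is_chart c" if "c \<in> prod_atlas N L" for c
    using that by (rule prod_atlasE) (simp add: is_chart_prod manifoldD(1)[OF N] manifoldD(1)[OF L])
  show "(\<Union>c\<in>prod_atlas N L. fst c) = UNIV"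
  proof (rule UNIV_eq_I[symmetric])
    fix p :: "'a \<times> 'c"
    obtain U \<phi> where c: "(U, \<phi>) \<in> N" "fst p \<in> U" using manifold_chart[OF N] .
    obtain V \<psi> where d: "(V, \<psi>) \<in> L" "snd p \<in> V" using manifold_chart[OF L] .
    have "(U \<times> V, map_prod \<phi> \<psi>) \<in> prod_atlas N L" using c d unfolding prod_atlas_def by blast
    moreover have "p \<in> U \<times> V" using c d by (cases p) auto
    ultimately show "p \<in> (\<Union>c\<in>prod_atlas N L. fst c)" by force
  qed
  fix c d assume "c \<in> prod_atlas N L" "d \<in> prod_atlas N L"
  then obtain U \<phi> V \<psi> U' \<phi>' V' \<psi>' where c: "c = (U \<times> V, map_prod \<phi> \<psi>)" "(U, \<phi>) \<in> N" "(V, \<psi>) \<in> L"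
    and d: "d = (U' \<times> V', map_prod \<phi>' \<psi>')" "(U', \<phi>') \<in> N" "(V', \<psi>') \<in> L"
    by (elim prod_atlasE)
  have n: "compatible (U, \<phi>) (U', \<phi>')" "compatible (U', \<phi>') (U, \<phi>)" and l: "compatible (V, \<psi>) (V', \<psi>')" "compatible (V', \<psi>') (V, \<psi>)"
    using N L c d unfolding manifold_def by blast+
  note ch = manifoldD(1)[OF N c(2)] manifoldD(1)[OF N d(2)] manifoldD(1)[OF L c(3)] manifoldD(1)[OF L d(3)]
  show "compatible c d"
    unfolding c(1) d(1) compatible_def case_prod_conv
    using compatible_prod[OF ch n(1) l(1)] compatible_prod[OF ch(2,1,4,3) n(2) l(2)] by (simp add: Int_commute)
qed

section \<open>Submanifolds, local diffeomorphisms and pulled-back forms\<close>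

lemma subspace_memI_orthogonal:
  fixes S :: "'e::euclidean_space set"
  assumes S: "subspace S" and orth: "\<And>y. (\<And>v. v \<in> S \<Longrightarrow> v \<bullet> y = 0) \<Longrightarrow> w \<bullet> y = 0"
  shows "w \<in> S"
proof -
  obtain y z where yz: "y \<in> span S" "\<And>v. v \<in> span S \<Longrightarrow> orthogonal z v" "w = y + z"
    using orthogonal_subspace_decomp_exists[of S w] by blast
  have sp: "span S = S" using S by (simp add: span_eq_iff)
  have "w \<bullet> z = 0" using yz(2) by (intro orth) (simp add: sp orthogonal_def inner_commute)
  moreover have "y \<bullet> z = 0" using yz(1,2) by (simp add: orthogonal_def inner_commute)
  ultimately have "z = 0" by (simp add: yz(3) inner_add_left)
  then show ?thesis using yz(1,3) sp by simp
qed

text \<open>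
  In a slice chart the curve runs in a linear subspace, which therefore contains its velocity. This
  identifies tangent vectors of the submanifold without reference to dimensions.
\<close>

lemma tangent_to_of_curve:
  assumes N: "manifold N" and c: "(U, \<psi>) \<in> N" and sub: "submanifold N k N'" and x0: "x0 \<in> \<psi> ` U"
    and curve: "c 0 = x0" "(c has_vector_derivative v) (at 0)"
    and ev: "\<forall>\<^sub>F t in nhds 0. inv_into U \<psi> (c t) \<in> N'"
  shows "push_vec N (inv_into U \<psi>) x0 v \<in> tangent_to N N' (inv_into U \<psi> x0)"
proof -
  let ?i = "inv_into U \<psi>"
  have nN: "?i x0 \<in> N'" using eventually_nhds_x_imp_x[OF ev] curve(1) by simp
  obtain d S where d: "slice_chart N N' S d" "?i x0 \<in> fst d"
    using sub nN unfolding submanifold_def by blast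
  obtain V \<phi> where V: "d = (V, \<phi>)" by (cases d)
  have dm: "(V, \<phi>) \<in> maximal_atlas N" and S: "subspace S" and slice: "\<phi> ` (V \<inter> N') = \<phi> ` V \<inter> S"
    and nV: "?i x0 \<in> V"
    using d by (auto simp: slice_chart_def V)
  note ip = smooth_param_inv_chart[OF N manifoldD(3)[OF N c]]
  have oV: "open V" by (rule is_chartD(1)[OF maximal_atlasD(1)[OF dm]])
  let ?Y = "\<psi> ` U \<inter> ?i -` V"
  have Y: "open ?Y" "x0 \<in> ?Y" using smooth_paramD(4)[OF ip oV] x0 nV by auto
  have g: "smooth_on ?Y (\<lambda>x. \<phi> (?i x))" by (rule smooth_param_chart_smooth[OF N dm ip])
  note g' = smooth_on_has_derivative[OF g Y]
  have "(c \<longlongrightarrow> c 0) (at 0)"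
    using has_vector_derivative_continuous[OF curve(2)] by (simp only: isCont_def)
  then have "(c \<longlongrightarrow> c 0) (nhds 0)" by (rule tendsto_at_iff_tendsto_nhds[THEN iffD1])
  then have "(c \<longlongrightarrow> x0) (nhds 0)" by (simp only: curve(1))
  then have evY: "\<forall>\<^sub>F t in nhds 0. c t \<in> ?Y" using Y by (rule topological_tendstoD)
  have evS: "\<forall>\<^sub>F t in nhds 0. \<phi> (?i (c t)) \<in> S"
    using eventually_conj[OF evY ev] by (rule eventually_mono) (use slice in auto)
  have "dirder (\<lambda>x. \<phi> (?i x)) x0 v \<in> S"
  proof (rule subspace_memI_orthogonal[OF S])
    fix y assume y: "\<And>v. v \<in> S \<Longrightarrow> v \<bullet> y = 0"
    have "\<forall>\<^sub>F t in nhds 0. \<phi> (?i (c t)) \<bullet> y = 0"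
      using evS by (rule eventually_mono) (rule y)
    from derivative_along_zero_curve[OF bounded_linear.has_derivative[OF bounded_linear_inner_left g'] curve this]
    show "dirder (\<lambda>x. \<phi> (?i x)) x0 v \<bullet> y = 0" .
  qed
  moreover have "push_vec N ?i x0 v = coord_vec N (V, \<phi>) (?i x0) (dirder (\<lambda>x. \<phi> (?i x)) x0 v)"
    by (rule push_vec_eq_coord_vec[OF N dm ip x0 nV])
  ultimately show ?thesis
    unfolding tangent_to_def mem_Collect_eq using d(1) nV nN
    by (intro exI[of _ "(V, \<phi>)"] exI[of _ S] exI[of _ "dirder (\<lambda>x. \<phi> (?i x)) x0 v"] conjI) (simp_all add: V)
qed

text \<open>
  Near a point of \<open>S\<close> the only preimages of points of \<open>T\<close> lie in \<open>S\<close>: the local inverse of the restriction is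
  continuous, so it takes values in a neighbourhood on which \<open>F\<close> is injective.
\<close>

lemma local_restriction:
  assumes abs: "local_diffeo P M F UNIV UNIV" and rel: "local_diffeo P M F S T"
    and ST: "F ` S = T" and q0: "q0 \<in> S"
  obtains Q where "open Q" "q0 \<in> Q" "\<And>q. q \<in> Q \<Longrightarrow> F q \<in> T \<longleftrightarrow> q \<in> S"
proof -
  obtain Wa where Wa: "open Wa" "q0 \<in> Wa" "inj_on F Wa"
    using abs unfolding local_diffeo_def by auto
  obtain W W' where W: "open W" "q0 \<in> W" "open W'" "F ` (W \<inter> S) = W' \<inter> T" "inj_on F (W \<inter> S)"
    and sm: "smooth_map_on_subset M P (W' \<inter> T) (inv_into (W \<inter> S) F)"
    using rel q0 unfolding local_diffeo_def by blast
  have F0: "F q0 \<in> W' \<inter> T" using W(2,4) q0 by blast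
  obtain W1 G where G: "F q0 \<in> W1" "smooth_map_on M P W1 G" "\<And>p. p \<in> W1 \<inter> (W' \<inter> T) \<Longrightarrow> G p = inv_into (W \<inter> S) F p"
    using bspec[OF sm[unfolded smooth_map_on_subset_def] F0] by (elim exE conjE) (simp add: that)
  have W1: "open W1" "continuous_on W1 G" using G(2) by (auto simp: smooth_map_on_def)
  have cF: "continuous_on UNIV F" using abs by (auto simp: local_diffeo_def smooth_map_on_def)
  have Gq: "G (F q0) = q0" using G(3)[of "F q0"] G(1) F0 inv_into_f_f[OF W(5), of q0] W(2) q0 by simp
  define Q where "Q = Wa \<inter> F -` (W' \<inter> (W1 \<inter> G -` Wa))"
  have "open (W1 \<inter> G -` Wa)" by (rule continuous_open_preimage[OF W1(2,1) Wa(1)])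
  then have "open (F -` (W' \<inter> (W1 \<inter> G -` Wa)))" by (rule open_vimage[OF open_Int[OF W(3)] cF])
  then have "open Q" unfolding Q_def by (intro open_Int Wa(1))
  moreover have "q0 \<in> Q" unfolding Q_def using Wa(2) F0 G(1) Gq by simp
  moreover have "F q \<in> T \<longleftrightarrow> q \<in> S" if q: "q \<in> Q" for q
  proof
    assume FT: "F q \<in> T"
    have FW: "F q \<in> W' \<inter> T" "F q \<in> W1" "G (F q) \<in> Wa" "q \<in> Wa" using q FT by (auto simp: Q_def)
    have "F q \<in> F ` (W \<inter> S)" using FW(1) W(4) by simp
    then have "inv_into (W \<inter> S) F (F q) \<in> W \<inter> S" "F (inv_into (W \<inter> S) F (F q)) = F q"
      by (rule inv_into_into, rule f_inv_into_f)
    moreover have "G (F q) = inv_into (W \<inter> S) F (F q)" using G(3) FW(1,2) by blast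
    ultimately have "G (F q) \<in> S" "F (G (F q)) = F q" by auto
    then show "q \<in> S" using inj_onD[OF Wa(3) _ FW(3,4)] by simp
  next
    assume "q \<in> S" then show "F q \<in> T" using ST by blast
  qed
  ultimately show ?thesis by (rule that)
qed

lemma smooth_map_on_open_subset:
  assumes "smooth_map_on M N W F" "open V" "V \<subseteq> W"
  shows "smooth_map_on M N V F"
  unfolding smooth_map_on_def
proof (intro conjI ballI, safe)
  show "continuous_on V F" using assms by (auto simp: smooth_map_on_def intro: continuous_on_subset)
  fix U \<phi> U' \<psi> assume "(U, \<phi>) \<in> M" "(U', \<psi>) \<in> N"
  then have "smooth_on (\<phi> ` (U \<inter> W \<inter> F -` U')) (\<psi> \<circ> F \<circ> inv_into U \<phi>)"
    using assms(1) by (auto simp: smooth_map_on_def)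
  then show "smooth_on (\<phi> ` (U \<inter> V \<inter> F -` U')) (\<psi> \<circ> F \<circ> inv_into U \<phi>)"
    by (rule smooth_on_subset) (use assms(3) in blast)
qed (rule assms(2))

lemma local_diffeo_inverse:
  assumes F: "local_diffeo P M F UNIV UNIV"
  obtains W V G where "open W" "q \<in> W" "open V" "F q \<in> V" "smooth_map_on M P V G"
    "\<And>p. p \<in> V \<Longrightarrow> F (G p) = p" "\<And>q. q \<in> W \<Longrightarrow> F q \<in> V \<and> G (F q) = q"
proof -
  have "\<exists>W W'. open W \<and> q \<in> W \<and> open W' \<and> F ` W = W' \<and> inj_on F W \<and> smooth_map_on_subset M P W' (inv_into W F)"
    using F unfolding local_diffeo_def by simp
  then obtain W W' where W: "open W" "q \<in> W" "open W'" "F ` W = W'" "inj_on F W"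
    and sm: "smooth_map_on_subset M P W' (inv_into W F)"
    by blast
  have FW: "F q \<in> W'" using W(2,4) by auto
  obtain W1 G where G: "F q \<in> W1" "smooth_map_on M P W1 G" "\<And>p. p \<in> W1 \<inter> W' \<Longrightarrow> G p = inv_into W F p"
    using bspec[OF sm[unfolded smooth_map_on_subset_def] FW] by (elim exE conjE) (simp add: that)
  have W1: "open W1" using G(2) by (auto simp: smooth_map_on_def)
  have cF: "continuous_on UNIV F" using F by (auto simp: local_diffeo_def smooth_map_on_def)
  show ?thesis
  proof (rule that[of "W \<inter> F -` (W1 \<inter> W')" "W1 \<inter> W'" G])
    show "open (W \<inter> F -` (W1 \<inter> W'))" by (rule open_Int[OF W(1) open_vimage[OF open_Int[OF W1 W(3)] cF]])
    show "q \<in> W \<inter> F -` (W1 \<inter> W')" using W(2) FW G(1) by simp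
    show "open (W1 \<inter> W')" by (rule open_Int[OF W1 W(3)])
    show "F q \<in> W1 \<inter> W'" using FW G(1) by simp
    show "smooth_map_on M P (W1 \<inter> W') G" by (rule smooth_map_on_open_subset[OF G(2) open_Int[OF W1 W(3)]]) blast
    show "F (G p) = p" if p: "p \<in> W1 \<inter> W'" for p
    proof -
      have "p \<in> F ` W" using p W(4) by blast
      then show ?thesis using G(3)[OF p] by (simp add: f_inv_into_f)
    qed
    show "F q \<in> W1 \<inter> W' \<and> G (F q) = q" if q: "q \<in> W \<inter> F -` (W1 \<inter> W')" for q
      using q G(3)[of "F q"] inv_into_f_f[OF W(5), of q] by simp
  qed
qed

text \<open>
  Applying the pushed-forward vector to the coordinate functions composed with a local inverse of \<open>F\<close>
  returns the components of \<open>w\<close>.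
\<close>

lemma local_diffeo_push_vec_inj:
  fixes P :: "('p::{t2_space,second_countable_topology}, 'z::euclidean_space) atlas"
  assumes M: "manifold M" and P: "manifold P" and F: "local_diffeo P M F UNIV UNIV" and c: "(U, \<phi>) \<in> P"
    and z: "z \<in> \<phi> ` U" and w: "push_vec M (\<lambda>z. F (inv_into U \<phi> z)) z w = (\<lambda>f. 0)"
  shows "w = 0"
proof -
  let ?i = "inv_into U \<phi>"
  note ch = manifoldD(1)[OF P c] and ip = smooth_param_inv_chart[OF P manifoldD(3)[OF P c]]
  obtain W V G where W: "open W" "?i z \<in> W" "open V" "F (?i z) \<in> V" and G: "smooth_map_on M P V G"
    and FG: "\<And>p. p \<in> V \<Longrightarrow> F (G p) = p" and GF: "\<And>q. q \<in> W \<Longrightarrow> F q \<in> V \<and> G (F q) = q"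
    using local_diffeo_inverse[OF F] by blast
  let ?Y = "\<phi> ` U \<inter> ?i -` W"
  have Y: "open ?Y" "z \<in> ?Y" using smooth_paramD(4)[OF ip W(1)] z W(2) by auto
  have iU: "?i y \<in> U" "\<phi> (?i y) = y" if "y \<in> \<phi> ` U" for y
    using that by (auto simp: is_chartD(6)[OF ch])
  show ?thesis
  proof (rule euclidean_eqI)
    fix b :: 'z
    let ?f = "\<lambda>p. \<phi> (G p) \<bullet> b"
    have GU: "smooth_near P (G (F (?i z))) (\<lambda>q. \<phi> q \<bullet> b)"
      unfolding smooth_near_def using chart_coordinate_smooth[OF P manifoldD(3)[OF P c]] GF[OF W(2)] iU(1)[OF z] by auto
    have sn: "smooth_near M (F (?i z)) ?f"
      by (rule smooth_near_compose[OF manifoldD(1)[OF M] P G W(4) GU])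
    have "((\<lambda>y. y \<bullet> b) has_derivative (\<lambda>w. w \<bullet> b)) (at z)" by (auto intro!: derivative_eq_intros)
    then have "((\<lambda>y. ?f (F (?i y))) has_derivative (\<lambda>w. w \<bullet> b)) (at z)"
      by (rule has_derivative_transform_within_open[OF _ Y]) (use GF iU in auto)
    from dirder_eq[OF this, of w] have "push_vec M (\<lambda>z. F (?i z)) z w ?f = w \<bullet> b"
      by (simp add: push_vec_def sn)
    then show "w \<bullet> b = 0 \<bullet> b" using w by simp
  qed
qed

text \<open>
  A tangent vector with components \<open>a\<close> in a chart is the image of the vector that the local inverse of \<open>F\<close>
  makes of \<open>a\<close>.
\<close>

lemma local_diffeo_push_vec_surj:
  fixes P :: "('p::{t2_space,second_countable_topology}, 'z::euclidean_space) atlas"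
  assumes M: "manifold M" and P: "manifold P" and F: "local_diffeo P M F UNIV UNIV" and c: "(U, \<phi>) \<in> P"
    and z: "z \<in> \<phi> ` U" and v: "v \<in> tangent_space M (F (inv_into U \<phi> z))"
  shows "\<exists>w. v = push_vec M (\<lambda>z. F (inv_into U \<phi> z)) z w"
proof -
  let ?i = "inv_into U \<phi>"
  note ch = manifoldD(1)[OF P c] and ip = smooth_param_inv_chart[OF P manifoldD(3)[OF P c]]
  obtain W V G where W: "open W" "?i z \<in> W" "open V" "F (?i z) \<in> V" and G: "smooth_map_on M P V G"
    and FG: "\<And>p. p \<in> V \<Longrightarrow> F (G p) = p" and GF: "\<And>q. q \<in> W \<Longrightarrow> F q \<in> V \<and> G (F q) = q"
    using local_diffeo_inverse[OF F] by blast
  have iU: "?i y \<in> U" "\<phi> (?i y) = y" if "y \<in> \<phi> ` U" for y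
    using that by (auto simp: is_chartD(6)[OF ch])
  let ?p = "F (?i z)"
  obtain U' \<psi> a where d: "(U', \<psi>) \<in> M" "?p \<in> U'" and va: "v = coord_vec M (U', \<psi>) ?p a"
    using v unfolding tangent_space_def by auto
  note dch = manifoldD(1)[OF M d(1)] and jp = smooth_param_inv_chart[OF M manifoldD(3)[OF M d(1)]]
  let ?j = "inv_into U' \<psi>"
  let ?x = "\<psi> ?p"
  have x: "?x \<in> \<psi> ` U'" "?j ?x = ?p" using d(2) is_chartD(6)[OF dch] by auto
  have Gp: "smooth_param P (\<psi> ` U' \<inter> ?j -` V) (\<lambda>x. G (?j x))"
    by (rule smooth_param_compose[OF manifoldD(1)[OF M] P G jp])
  have sF: "smooth_map P M F" using F by (simp add: local_diffeo_def)
  have Fp: "smooth_param M (\<phi> ` U \<inter> ?i -` UNIV) (\<lambda>z. F (?i z))"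
    by (rule smooth_param_compose[OF manifoldD(1)[OF P] M sF ip])
  let ?Y = "(\<psi> ` U' \<inter> ?j -` V) \<inter> (\<lambda>x. G (?j x)) -` U"
  have Y: "open ?Y" "?x \<in> ?Y"
    using smooth_paramD(4)[OF Gp is_chartD(1)[OF ch]] x W(4) GF[OF W(2)] iU(1)[OF z] by auto
  let ?h = "\<lambda>x. \<phi> (G (?j x))"
  have h: "smooth_on ?Y ?h" by (rule smooth_param_chart_smooth[OF P manifoldD(3)[OF P c] Gp])
  have hx: "?h ?x = z" using x(2) GF[OF W(2)] iU(2)[OF z] by simp
  have "v f = push_vec M (\<lambda>z. F (?i z)) z (dirder ?h ?x a) f" for f
  proof (cases "smooth_near M ?p f")
    case True
    have f': "((\<lambda>z. f (F (?i z))) has_derivative dirder (\<lambda>z. f (F (?i z))) z) (at (?h ?x))"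
      unfolding hx by (rule smooth_param_has_derivative[OF Fp _ True]) (use z in simp)
    have "((\<lambda>x. f (F (?i (?h x)))) has_derivative (\<lambda>a. dirder (\<lambda>z. f (F (?i z))) z (dirder ?h ?x a))) (at ?x)"
      by (rule has_derivative_compose[OF smooth_on_has_derivative[OF h Y] f'])
    then have "((\<lambda>x. f (?j x)) has_derivative (\<lambda>a. dirder (\<lambda>z. f (F (?i z))) z (dirder ?h ?x a))) (at ?x)"
    proof (rule has_derivative_transform_within_open[OF _ Y])
      fix y assume "y \<in> ?Y"
      then show "f (F (?i (?h y))) = f (?j y)" using FG is_chartD(6)[OF ch] by simp
    qed
    from dirder_eq[OF this, of a] show ?thesis by (simp add: va coord_vec_def push_vec_def True o_def)
  qed (simp add: va coord_vec_def push_vec_def)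
  then show ?thesis by blast
qed

lemma components_coord_vec:
  assumes M: "manifold M" and c: "(U, \<phi>) \<in> M" and p: "p \<in> U"
  shows "components (U, \<phi>) (coord_vec M (U, \<phi>) p w) = w"
proof -
  note ch = manifoldD(1)[OF M c]
  have "coord_vec M (U, \<phi>) p w (\<lambda>q. \<phi> q \<bullet> b) = w \<bullet> b" for b
  proof -
    have sn: "smooth_near M p (\<lambda>q. \<phi> q \<bullet> b)"
      unfolding smooth_near_def using chart_coordinate_smooth[OF M manifoldD(3)[OF M c]] p by blast
    have "((\<lambda>y. y \<bullet> b) has_derivative (\<lambda>w. w \<bullet> b)) (at (\<phi> p))" by (auto intro!: derivative_eq_intros)
    then have "((\<lambda>y. \<phi> (inv_into U \<phi> y) \<bullet> b) has_derivative (\<lambda>w. w \<bullet> b)) (at (\<phi> p))"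
      by (rule has_derivative_transform_within_open[OF _ is_chartD(2)[OF ch]]) (use p is_chartD(6)[OF ch] in auto)
    from dirder_eq[OF this, of w] show ?thesis by (simp add: coord_vec_def sn o_def)
  qed
  then show ?thesis by (simp add: components_def euclidean_representation)
qed

definition linear_form_at ::
    "('a::topological_space, 'e::euclidean_space) atlas \<Rightarrow> ('a \<Rightarrow> 'a tvec \<Rightarrow> real) \<Rightarrow> 'a \<Rightarrow> bool" where
  "linear_form_at M \<eta> p \<longleftrightarrow> (\<forall>u\<in>tangent_space M p. \<forall>v\<in>tangent_space M p. \<forall>a b.
     \<eta> p (\<lambda>f. a * u f + b * v f) = a * \<eta> p u + b * \<eta> p v)"

lemma linear_form_push_vec:
  assumes M: "manifold M" and s: "smooth_param M Z s" and z: "z \<in> Z" and \<eta>: "linear_form_at M \<eta> (s z)"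
  shows "linear (\<lambda>w. \<eta> (s z) (push_vec M s z w))"
proof -
  have *: "\<eta> (s z) (push_vec M s z (a *\<^sub>R v + b *\<^sub>R w)) = a * \<eta> (s z) (push_vec M s z v) + b * \<eta> (s z) (push_vec M s z w)" for a b v w
    using \<eta> push_vec_in_tangent_space[OF M s z] unfolding linear_form_at_def push_vec_linear[OF s z] by blast
  show ?thesis
    by (rule linearI) (use *[of 1 _ 1] *[of _ _ 0] in simp_all)
qed

text \<open>
  The pulled-back form in terms of the components of \<open>\<eta>\<close> in a chart and the derivative of the
  parametrization; it shows that the pulled-back form is smooth and constructible.
\<close>

lemma form_push_vec_eq_sum:
  assumes M: "manifold M" and s: "smooth_param M Z s" and z: "z \<in> Z" and \<eta>: "linear_form_at M \<eta> (s z)"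
    and c: "(U, \<phi>) \<in> M" "s z \<in> U"
  shows "\<eta> (s z) (push_vec M s z w) =
    (\<Sum>i\<in>Basis. (dirder (\<lambda>z. \<phi> (s z)) z w \<bullet> i) * form_in_chart M \<eta> (U, \<phi>) i (\<phi> (s z)))"
proof -
  note ch = manifoldD(1)[OF M c(1)] and cm = manifoldD(3)[OF M c(1)]
  have inv: "inv_into U \<phi> (\<phi> (s z)) = s z" by (rule is_chartD(6)[OF ch c(2)])
  have "linear (\<lambda>w. \<eta> (inv_into U \<phi> (\<phi> (s z))) (push_vec M (inv_into U \<phi>) (\<phi> (s z)) w))"
    by (rule linear_form_push_vec[OF M smooth_param_inv_chart[OF M cm]]) (use c(2) \<eta> in \<open>auto simp: inv\<close>)
  then have lin: "linear (\<lambda>w. \<eta> (s z) (coord_vec M (U, \<phi>) (s z) w))"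
    unfolding inv coord_vec_eq_push_vec[OF ch c(2)] .
  have "\<eta> (s z) (push_vec M s z w) = \<eta> (s z) (coord_vec M (U, \<phi>) (s z) (dirder (\<lambda>z. \<phi> (s z)) z w))"
    unfolding push_vec_eq_coord_vec[OF M cm s z c(2)] ..
  also have "\<dots> = (\<Sum>i\<in>Basis. (dirder (\<lambda>z. \<phi> (s z)) z w \<bullet> i) * \<eta> (s z) (coord_vec M (U, \<phi>) (s z) i))"
    by (rule linear_real_euclidean_sum[OF lin])
  finally show ?thesis by (simp add: form_in_chart_def Let_def inv)
qed

text \<open>
  Pulling back commutes with the exterior derivative: in the derivative of the pulled-back components
  the second derivatives of the parametrization cancel by symmetry. Only differentiability at the image
  point is required, so that the lemma applies to \<open>\<eta>/H\<close> where \<open>H \<noteq> 0\<close>.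
\<close>

lemma ext_deriv_push_vec:
  assumes M: "manifold M" and s: "smooth_param M Z s" and z: "z \<in> Z"
    and Q: "open Q" "s z \<in> Q" and \<eta>: "\<And>q. q \<in> Q \<Longrightarrow> linear_form_at M \<eta> q"
    and diff: "\<And>U \<phi> b. (U, \<phi>) \<in> M \<Longrightarrow> s z \<in> U \<Longrightarrow> form_in_chart M \<eta> (U, \<phi>) b differentiable (at (\<phi> (s z)))"
  shows "ext_deriv M \<eta> (s z) (push_vec M s z a) (push_vec M s z b) = ext_d (\<lambda>z w. \<eta> (s z) (push_vec M s z w)) z a b"
proof -
  obtain V \<phi> where ch: "chart_at M (s z) = (V, \<phi>)" by (cases "chart_at M (s z)")
  have "\<exists>c. c \<in> M \<and> s z \<in> fst c" using manifoldD(2)[OF M] by blast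
  then have "chart_at M (s z) \<in> M \<and> s z \<in> fst (chart_at M (s z))" unfolding chart_at_def by (rule someI_ex)
  then have c: "(V, \<phi>) \<in> M" "s z \<in> V" by (simp_all add: ch)
  note cm = manifoldD(3)[OF M c(1)] and V = is_chartD(1)[OF manifoldD(1)[OF M c(1)]] and dch = manifoldD(1)[OF M c(1)]
  let ?e = "form_in_chart M \<eta> (V, \<phi>)" and ?S = "\<lambda>z. \<phi> (s z)"
  let ?x = "\<phi> (s z)"
  let ?Y = "Z \<inter> s -` (V \<inter> Q)"
  have Y: "open ?Y" "z \<in> ?Y" using smooth_paramD(4)[OF s open_Int[OF V Q(1)]] z c(2) Q(2) by auto
  have S: "smooth_on ?Y ?S"
    by (rule smooth_on_subset[OF smooth_param_chart_smooth[OF M cm s]]) blast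
  have e': "(?e i has_derivative dirder (?e i) ?x) (at ?x)" for i
    using diff[OF c, of i] by (simp add: frechet_derivative_works)
  have S': "(?S has_derivative dirder ?S z) (at z)" by (rule smooth_on_has_derivative[OF S Y])
  \<comment> \<open>the second summand is symmetric in \<open>v\<close> and \<open>w\<close>\<close>
  have E': "dirder (\<lambda>z. \<eta> (s z) (push_vec M s z w)) z v =
      (\<Sum>i\<in>Basis. (dirder ?S z w \<bullet> i) * dirder (?e i) ?x (dirder ?S z v) + (dirder (\<lambda>z. dirder ?S z w) z v \<bullet> i) * ?e i ?x)" for w v
  proof -
    have "((\<lambda>z. \<Sum>i\<in>Basis. (dirder ?S z w \<bullet> i) * ?e i (?S z)) has_derivative
       (\<lambda>v. \<Sum>i\<in>Basis. (dirder ?S z w \<bullet> i) * dirder (?e i) ?x (dirder ?S z v) + (dirder (\<lambda>z. dirder ?S z w) z v \<bullet> i) * ?e i ?x)) (at z)"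
    proof (rule has_derivative_sum)
      fix i :: 'b
      show "((\<lambda>z. (dirder ?S z w \<bullet> i) * ?e i (?S z)) has_derivative
        (\<lambda>v. (dirder ?S z w \<bullet> i) * dirder (?e i) ?x (dirder ?S z v) + (dirder (\<lambda>z. dirder ?S z w) z v \<bullet> i) * ?e i ?x)) (at z)"
        by (rule has_derivative_mult[OF bounded_linear.has_derivative[OF bounded_linear_inner_left
              smooth_on_has_derivative[OF smooth_on_dirder[OF S] Y]] has_derivative_compose[OF S' e']])
    qed
    then have "((\<lambda>z. \<eta> (s z) (push_vec M s z w)) has_derivative
       (\<lambda>v. \<Sum>i\<in>Basis. (dirder ?S z w \<bullet> i) * dirder (?e i) ?x (dirder ?S z v) + (dirder (\<lambda>z. dirder ?S z w) z v \<bullet> i) * ?e i ?x)) (at z)"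
    proof (rule has_derivative_transform_within_open[OF _ Y])
      fix y assume "y \<in> ?Y"
      then show "(\<Sum>i\<in>Basis. (dirder ?S y w \<bullet> i) * ?e i (?S y)) = \<eta> (s y) (push_vec M s y w)"
        using \<eta> c by (intro form_push_vec_eq_sum[OF M s, symmetric]) auto
    qed
    then show ?thesis by (rule dirder_eq)
  qed
  have e_lin: "dirder (?e w) ?x v = (\<Sum>i\<in>Basis. (w \<bullet> i) * dirder (?e i) ?x v)" for w v
  proof -
    let ?T = "\<phi> ` (V \<inter> Q)"
    have T: "open ?T" "?x \<in> ?T" using chart_open_image[OF dch Q(1)] c(2) Q(2) by auto
    have "((\<lambda>x. \<Sum>i\<in>Basis. (w \<bullet> i) * ?e i x) has_derivative (\<lambda>v. \<Sum>i\<in>Basis. (w \<bullet> i) * dirder (?e i) ?x v)) (at ?x)"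
      by (intro has_derivative_sum has_derivative_mult_right e')
    then have "(?e w has_derivative (\<lambda>v. \<Sum>i\<in>Basis. (w \<bullet> i) * dirder (?e i) ?x v)) (at ?x)"
    proof (rule has_derivative_transform_within_open[OF _ T])
      fix x assume "x \<in> ?T"
      then obtain q where q: "q \<in> V" "q \<in> Q" "x = \<phi> q" by blast
      note iq = is_chartD(6)[OF dch q(1)]
      have "linear (\<lambda>w. \<eta> (inv_into V \<phi> x) (push_vec M (inv_into V \<phi>) x w))"
        by (rule linear_form_push_vec[OF M smooth_param_inv_chart[OF M cm]]) (use q iq \<eta> in auto)
      then have "linear (\<lambda>w. \<eta> q (coord_vec M (V, \<phi>) q w))"
        unfolding q(3) iq coord_vec_eq_push_vec[OF dch q(1)] .
      from linear_real_euclidean_sum[OF this, of w]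
      show "(\<Sum>i\<in>Basis. (w \<bullet> i) * ?e i x) = ?e w x"
        by (simp add: form_in_chart_def q(3) iq)
    qed
    then show ?thesis by (rule dirder_eq)
  qed
  have comp: "components (V, \<phi>) (push_vec M s z w) = dirder ?S z w" for w
    unfolding push_vec_eq_coord_vec[OF M cm s z c(2)] by (rule components_coord_vec[OF M c])
  have "ext_deriv M \<eta> (s z) (push_vec M s z a) (push_vec M s z b)
      = dirder (?e (dirder ?S z b)) ?x (dirder ?S z a) - dirder (?e (dirder ?S z a)) ?x (dirder ?S z b)"
    by (simp add: ext_deriv_def Let_def ch comp)
  also have "\<dots> = (\<Sum>i\<in>Basis. (dirder ?S z b \<bullet> i) * dirder (?e i) ?x (dirder ?S z a))
      - (\<Sum>i\<in>Basis. (dirder ?S z a \<bullet> i) * dirder (?e i) ?x (dirder ?S z b))"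
    by (simp only: e_lin[of "dirder ?S z b"] e_lin[of "dirder ?S z a"])
  also have "\<dots> = ext_d (\<lambda>z w. \<eta> (s z) (push_vec M s z w)) z a b"
    unfolding ext_d_def E' dirder_symmetric[OF Y(1) S Y(2), of a b] by (simp add: sum.distrib)
  finally show ?thesis .
qed

lemma one_form_linear_form_at: "one_form M \<eta> \<Longrightarrow> linear_form_at M \<eta> q"
  by (simp add: one_form_def linear_form_at_def)

lemma one_form_smooth_in_chart:
  assumes of: "one_form M \<eta>" and d: "(U, \<phi>) \<in> M"
  shows "smooth_on (\<phi> ` U) (form_in_chart M \<eta> (U, \<phi>) b)"
proof -
  have "smooth_fun_on M U (\<lambda>p. \<eta> p (coord_vec M (U, \<phi>) p b))" using of d unfolding one_form_def by force
  then have "smooth_on (\<phi> ` (U \<inter> U)) (\<lambda>x. \<eta> (inv_into U \<phi> x) (coord_vec M (U, \<phi>) (inv_into U \<phi> x) b))"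
    using d unfolding smooth_fun_on_iff by fastforce
  then show ?thesis by (simp add: form_in_chart_def[abs_def] Let_def)
qed

text \<open>
  The derivative of \<open>f \<circ> \<gamma>\<close> is \<open>X(f) \<circ> \<gamma>\<close>, and \<open>X(f)\<close> is again a smooth function, so \<open>f \<circ> \<gamma>\<close> is \<open>k\<close> times
  continuously differentiable for all \<open>f\<close> at once, by induction on \<open>k\<close>.
\<close>

lemma integral_curve_smooth:
  assumes M: "manifold M" and X: "vector_field M X" and J: "open J" and cont: "continuous_on J \<gamma>"
    and der: "\<And>t f. t \<in> J \<Longrightarrow> smooth_near M (\<gamma> t) f \<Longrightarrow> ((\<lambda>s. f (\<gamma> s)) has_real_derivative X (\<gamma> t) f) (at t)"
  shows "smooth_map_on euclidean_atlas M J \<gamma>"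
proof -
  have op: "open (J \<inter> \<gamma> -` W)" if "open W" for W by (rule continuous_open_preimage[OF cont J that])
  have Ck: "Ck_on k (\<lambda>t. f (\<gamma> t)) (J \<inter> \<gamma> -` W)" if "smooth_fun_on M W f" for k W f
    using that
  proof (induction k arbitrary: f)
    case 0
    then have "continuous_on W f" by (simp add: smooth_fun_on_iff)
    then have "continuous_on (J \<inter> \<gamma> -` W) (\<lambda>t. f (\<gamma> t))"
      by (rule continuous_on_compose2[OF _ continuous_on_subset[OF cont]]) auto
    then show ?case by simp
  next
    case (Suc k)
    have W: "open W" using Suc.prems by (simp add: smooth_fun_on_iff)
    show ?case
    proof (rule Ck_on_SucI[OF op[OF W], where f' = "\<lambda>t v. X (\<gamma> t) f * v"])
      fix t assume "t \<in> J \<inter> \<gamma> -` W"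
      then have "((\<lambda>s. f (\<gamma> s)) has_real_derivative X (\<gamma> t) f) (at t)"
        using Suc.prems by (intro der) (auto simp: smooth_near_def)
      then show "((\<lambda>s. f (\<gamma> s)) has_derivative (\<lambda>v. X (\<gamma> t) f * v)) (at t)"
        by (simp add: has_field_derivative_def)
    next
      fix v
      have "smooth_fun_on M W (\<lambda>p. X p f)" using X Suc.prems by (simp add: vector_field_def)
      from Suc.IH[OF this] show "Ck_on k (\<lambda>t. X (\<gamma> t) f * v) (J \<inter> \<gamma> -` W)"
        by (rule Ck_on_linear_compose[OF bounded_linear_mult_left op[OF W]])
    qed
  qed
  have "smooth_on (J \<inter> \<gamma> -` V) (\<lambda>t. \<psi> (\<gamma> t))" if c: "(V, \<psi>) \<in> M" for V \<psi>
  proof (rule smooth_on_componentwise[OF op[OF is_chartD(1)[OF manifoldD(1)[OF M c]]]])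
    fix b show "smooth_on (J \<inter> \<gamma> -` V) (\<lambda>t. \<psi> (\<gamma> t) \<bullet> b)"
      unfolding smooth_on_def using Ck[OF chart_coordinate_smooth[OF M manifoldD(3)[OF M c]]] by blast
  qed
  moreover have "inv_into UNIV id = (id :: real \<Rightarrow> real)" by (simp add: fun_eq_iff inv_id[unfolded id_def] id_def)
  ultimately show ?thesis
    unfolding smooth_map_on_def euclidean_atlas_def using J cont by (auto simp: o_def)
qed

section \<open>Nondegeneracy of contact forms\<close>

text \<open>
  Multilinearity in the entries below \<open>k\<close> and independence of the others.
\<close>

definition slot_linear :: "nat \<Rightarrow> ((nat \<Rightarrow> 'v::real_vector) \<Rightarrow> real) \<Rightarrow> bool" where
  "slot_linear k F \<longleftrightarrow>
     (\<forall>v i x y a b. i < k \<longrightarrow> F (v(i := a *\<^sub>R x + b *\<^sub>R y)) = a * F (v(i := x)) + b * F (v(i := y))) \<and>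
     (\<forall>v i x. k \<le> i \<longrightarrow> F (v(i := x)) = F v)"

definition slot_kills :: "nat \<Rightarrow> 'v \<Rightarrow> ((nat \<Rightarrow> 'v) \<Rightarrow> real) \<Rightarrow> bool" where
  "slot_kills k u F \<longleftrightarrow> (\<forall>v i. i < k \<longrightarrow> F (v(i := u)) = 0)"

lemma permuted_upd:
  assumes "\<pi> permutes S"
  shows "(\<lambda>i. (v(j := x)) (\<pi> i)) = (\<lambda>i. v (\<pi> i))(inv \<pi> j := x)"
  using permutes_inverses[OF assms] by (auto simp: fun_eq_iff)

lemma permuted_upd_shift:
  fixes \<pi> :: "nat \<Rightarrow> nat"
  assumes "\<pi> permutes S"
  shows "(\<lambda>i. (v(j := x)) (\<pi> (k + i))) =
    (if k \<le> inv \<pi> j then (\<lambda>i. v (\<pi> (k + i)))(inv \<pi> j - k := x) else (\<lambda>i. v (\<pi> (k + i))))"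
proof -
  define m where "m = inv \<pi> j"
  have m: "\<pi> (k + i) = j \<longleftrightarrow> m = k + i" for i
    unfolding m_def by (rule permutes_inv_eq[OF assms, symmetric])
  show ?thesis unfolding m_def[symmetric]
  proof (rule ext)
    fix i
    have "m = k + i \<longleftrightarrow> k \<le> m \<and> i = m - k" by auto
    then show "(v(j := x)) (\<pi> (k + i)) =
        (if k \<le> m then (\<lambda>i. v (\<pi> (k + i)))(m - k := x) else (\<lambda>i. v (\<pi> (k + i)))) i"
      unfolding fun_upd_apply m by simp
  qed
qed

text \<open>
  Under the permutation an entry ends up in exactly one of the two factors, and only that factor changes
  with it.
\<close>

lemma wedge_term_linear:
  assumes \<alpha>: "slot_linear k \<alpha>" and \<beta>: "slot_linear l \<beta>" and \<pi>: "\<pi> permutes {..<k + l}"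
  shows "slot_linear (k + l) (\<lambda>v. \<alpha> (\<lambda>i. v (\<pi> i)) * \<beta> (\<lambda>i. v (\<pi> (k + i))))"
proof -
  let ?F = "\<lambda>v. \<alpha> (\<lambda>i. v (\<pi> i)) * \<beta> (\<lambda>i. v (\<pi> (k + i)))"
  have al: "\<alpha> (w(m := a *\<^sub>R x + b *\<^sub>R y)) = a * \<alpha> (w(m := x)) + b * \<alpha> (w(m := y))" if "m < k" for w m a b x y
    using \<alpha> that by (simp add: slot_linear_def)
  have ac: "\<alpha> (w(m := x)) = \<alpha> w" if "k \<le> m" for w m x using \<alpha> that by (simp add: slot_linear_def)
  have bl: "\<beta> (w(m := a *\<^sub>R x + b *\<^sub>R y)) = a * \<beta> (w(m := x)) + b * \<beta> (w(m := y))" if "m < l" for w m a b x y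
    using \<beta> that by (simp add: slot_linear_def)
  have bc: "\<beta> (w(m := x)) = \<beta> w" if "l \<le> m" for w m x using \<beta> that by (simp add: slot_linear_def)
  show ?thesis unfolding slot_linear_def
  proof (intro conjI allI impI)
    fix v :: "nat \<Rightarrow> 'a" and j x y and a b :: real assume j: "j < k + l"
    have m: "inv \<pi> j < k + l" using permutes_in_image[OF permutes_inv[OF \<pi>], of j] j by simp
    show "?F (v(j := a *\<^sub>R x + b *\<^sub>R y)) = a * ?F (v(j := x)) + b * ?F (v(j := y))"
    proof (cases "inv \<pi> j < k")
      case True
      then show ?thesis unfolding permuted_upd[OF \<pi>] permuted_upd_shift[OF \<pi>] al[OF True]
        by (simp add: algebra_simps)
    next
      case False
      then have ml: "inv \<pi> j - k < l" and kj: "k \<le> inv \<pi> j" using m by auto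
      show ?thesis unfolding permuted_upd[OF \<pi>] permuted_upd_shift[OF \<pi>] if_P[OF kj] ac[OF kj] bl[OF ml]
        by (simp add: algebra_simps)
    qed
  next
    fix v :: "nat \<Rightarrow> 'a" and j x assume j: "k + l \<le> j"
    have m: "inv \<pi> j = j" using permutes_not_in[OF permutes_inv[OF \<pi>]] j by simp
    have kj: "k \<le> j" and lj: "l \<le> j - k" using j by auto
    show "?F (v(j := x)) = ?F v"
      unfolding permuted_upd[OF \<pi>] permuted_upd_shift[OF \<pi>] m if_P[OF kj] ac[OF kj] bc[OF lj] ..
  qed
qed

lemma slot_linear_wedge:
  assumes "slot_linear k \<alpha>" "slot_linear l \<beta>"
  shows "slot_linear (k + l) (wedge k l \<alpha> \<beta>)"
proof -
  have t: "slot_linear (k + l) (\<lambda>v. \<alpha> (\<lambda>i. v (\<pi> i)) * \<beta> (\<lambda>i. v (\<pi> (k + i))))" if "\<pi> permutes {..<k + l}" for \<pi>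
    by (rule wedge_term_linear[OF assms that])
  have eq: "wedge k l \<alpha> \<beta> = (\<lambda>v. (\<Sum>\<pi> | \<pi> permutes {..<k + l}. of_int (sign \<pi>) * (\<alpha> (\<lambda>i. v (\<pi> i)) * \<beta> (\<lambda>i. v (\<pi> (k + i))))) / (fact k * fact l))"
    by (simp add: wedge_def mult.assoc fun_eq_iff)
  let ?t = "\<lambda>v \<pi>. \<alpha> (\<lambda>i. v (\<pi> i)) * \<beta> (\<lambda>i. v (\<pi> (k + i)))"
  show ?thesis unfolding slot_linear_def
  proof (intro conjI allI impI)
    fix v :: "nat \<Rightarrow> 'a" and j x y and a b :: real assume j: "j < k + l"
    have "(\<Sum>\<pi> | \<pi> permutes {..<k + l}. of_int (sign \<pi>) * ?t (v(j := a *\<^sub>R x + b *\<^sub>R y)) \<pi>)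
        = (\<Sum>\<pi> | \<pi> permutes {..<k + l}. a * (of_int (sign \<pi>) * ?t (v(j := x)) \<pi>) + b * (of_int (sign \<pi>) * ?t (v(j := y)) \<pi>))"
    proof (rule sum.cong[OF refl])
      fix \<pi> assume "\<pi> \<in> {\<pi>. \<pi> permutes {..<k + l}}"
      then have \<pi>: "\<pi> permutes {..<k + l}" by simp
      have "?t (v(j := a *\<^sub>R x + b *\<^sub>R y)) \<pi> = a * ?t (v(j := x)) \<pi> + b * ?t (v(j := y)) \<pi>"
        using t[OF \<pi>, unfolded slot_linear_def] j by blast
      then show "of_int (sign \<pi>) * ?t (v(j := a *\<^sub>R x + b *\<^sub>R y)) \<pi>
          = a * (of_int (sign \<pi>) * ?t (v(j := x)) \<pi>) + b * (of_int (sign \<pi>) * ?t (v(j := y)) \<pi>)"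
        by (simp only: distrib_left mult.left_commute)
    qed
    then show "wedge k l \<alpha> \<beta> (v(j := a *\<^sub>R x + b *\<^sub>R y)) = a * wedge k l \<alpha> \<beta> (v(j := x)) + b * wedge k l \<alpha> \<beta> (v(j := y))"
      unfolding eq by (simp only: sum.distrib sum_distrib_left[symmetric] add_divide_distrib times_divide_eq_right)
  next
    fix v :: "nat \<Rightarrow> 'a" and j x assume j: "k + l \<le> j"
    have "?t (v(j := x)) \<pi> = ?t v \<pi>" if "\<pi> permutes {..<k + l}" for \<pi>
      using t[OF that, unfolded slot_linear_def] j by blast
    then show "wedge k l \<alpha> \<beta> (v(j := x)) = wedge k l \<alpha> \<beta> v"
      unfolding eq by (intro arg_cong2[where f = "(/)"] sum.cong refl) simp
  qed
qed

lemma slot_kills_wedge: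
  assumes \<alpha>: "slot_kills k u \<alpha>" and \<beta>: "slot_kills l u \<beta>"
  shows "slot_kills (k + l) u (wedge k l \<alpha> \<beta>)"
  unfolding slot_kills_def
proof (intro allI impI)
  fix v :: "nat \<Rightarrow> 'a" and j assume j: "j < k + l"
  have "of_int (sign \<pi>) * \<alpha> (\<lambda>i. (v(j := u)) (\<pi> i)) * \<beta> (\<lambda>i. (v(j := u)) (\<pi> (k + i))) = 0"
    if \<pi>: "\<pi> permutes {..<k + l}" for \<pi>
  proof -
    have m: "inv \<pi> j < k + l" using permutes_in_image[OF permutes_inv[OF \<pi>], of j] j by simp
    show ?thesis
    proof (cases "inv \<pi> j < k")
      case True
      then show ?thesis unfolding permuted_upd[OF \<pi>] using \<alpha> by (simp add: slot_kills_def)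
    next
      case False
      then have "inv \<pi> j - k < l" "k \<le> inv \<pi> j" using m by auto
      then show ?thesis unfolding permuted_upd_shift[OF \<pi>] using \<beta> by (simp add: slot_kills_def)
    qed
  qed
  then show "wedge k l \<alpha> \<beta> (v(j := u)) = 0"
    unfolding wedge_def by (subst sum.neutral) (simp_all del: fun_upd_apply)
qed

lemma wedge_power_slots:
  assumes "slot_linear 2 \<omega>" "slot_kills 2 u \<omega>"
  shows "slot_linear (2 * n) (wedge_power \<omega> n)" "slot_kills (2 * n) u (wedge_power \<omega> n)"
proof (induction n)
  case 0
  show "slot_linear (2 * 0) (wedge_power \<omega> 0)" "slot_kills (2 * 0) u (wedge_power \<omega> 0)"
    by (simp_all add: slot_linear_def slot_kills_def)
next
  case (Suc n)
  show "slot_linear (2 * Suc n) (wedge_power \<omega> (Suc n))" "slot_kills (2 * Suc n) u (wedge_power \<omega> (Suc n))"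
    using slot_linear_wedge[OF Suc(1) assms(1)] slot_kills_wedge[OF Suc(2) assms(2)] by (simp_all add: add.commute)
qed

text \<open>
  Composing all permutations with the transposition of the two positions changes the sign of every term.
\<close>

lemma wedge_repeated_entry:
  assumes ij: "i < k + l" "j < k + l" "i \<noteq> j" and eq: "v i = v j"
  shows "wedge k l \<alpha> \<beta> v = 0"
proof -
  let ?q = "Transposition.transpose i j"
  let ?g = "\<lambda>\<pi>. of_int (sign \<pi>) * \<alpha> (\<lambda>i. v (\<pi> i)) * \<beta> (\<lambda>i. v (\<pi> (k + i)))"
  have q: "?q permutes {..<k + l}" by (rule permutes_swap_id) (use ij in auto)
  have vq: "v (?q m) = v m" for m using eq by (simp add: Transposition.transpose_def)
  have "sum ?g {\<pi>. \<pi> permutes {..<k + l}} = (\<Sum>\<pi> | \<pi> permutes {..<k + l}. ?g (?q \<circ> \<pi>))"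
    by (rule setum_permutations_compose_left[OF q])
  also have "\<dots> = (\<Sum>\<pi> | \<pi> permutes {..<k + l}. - ?g \<pi>)"
  proof (rule sum.cong[OF refl])
    fix \<pi> assume "\<pi> \<in> {\<pi>. \<pi> permutes {..<k + l}}"
    then have \<pi>: "permutation \<pi>" using permutes_imp_permutation[of "{..<k + l}" \<pi>] by simp
    have "sign (?q \<circ> \<pi>) = - sign \<pi>"
      using sign_compose[OF permutation_swap_id \<pi>, of i j] ij(3) by (simp add: sign_swap_id)
    then show "?g (?q \<circ> \<pi>) = - ?g \<pi>" by (simp add: vq)
  qed
  finally have "sum ?g {\<pi>. \<pi> permutes {..<k + l}} = 0" by (simp add: sum_negf)
  then show ?thesis by (simp add: wedge_def)
qed

lemma slot_linear_combination:
  assumes F: "slot_linear N F" and alt: "\<And>v i j. i < N \<Longrightarrow> j < N \<Longrightarrow> i \<noteq> j \<Longrightarrow> v i = v j \<Longrightarrow> F v = 0"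
    and j: "j < N"
  shows "F (w(j := (\<Sum>i<N. c i *\<^sub>R w i))) = c j * F w"
proof -
  have lin: "F (w(j := a *\<^sub>R x + b *\<^sub>R y)) = a * F (w(j := x)) + b * F (w(j := y))" for a b x y
    using F j by (simp add: slot_linear_def)
  have "F (w(j := (\<Sum>i\<in>I. c i *\<^sub>R w i))) = (\<Sum>i\<in>I. c i * F (w(j := w i)))" if "finite I" for I
    using that
  proof (induction I)
    case empty
    show ?case using lin[of 0 0 0 0] by (simp del: fun_upd_apply)
  next
    case (insert i I)
    then show ?case using lin[of "c i" "w i" 1 "\<Sum>i\<in>I. c i *\<^sub>R w i"] by (simp del: fun_upd_apply)
  qed
  from this[of "{..<N}"] have "F (w(j := (\<Sum>i<N. c i *\<^sub>R w i))) = (\<Sum>i<N. c i * F (w(j := w i)))" by simp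
  also have "\<dots> = (\<Sum>i<N. if i = j then c j * F w else 0)"
  proof (rule sum.cong[OF refl])
    fix i assume i: "i \<in> {..<N}"
    show "c i * F (w(j := w i)) = (if i = j then c j * F w else 0)"
    proof (cases "i = j")
      case False
      then have "F (w(j := w i)) = 0" using i j by (intro alt[of i j]) auto
      with False show ?thesis by simp
    qed simp
  qed
  also have "\<dots> = c j * F w" using j by simp
  finally show ?thesis .
qed

text \<open>
  Entries on which a form of top degree does not vanish are a basis. Replacing one of them by \<open>u\<close>
  multiplies the value by the corresponding coordinate of \<open>u\<close>; if the result is always zero, so is \<open>u\<close>.
\<close>

lemma top_form_nondegenerate:
  fixes F :: "(nat \<Rightarrow> 'e::euclidean_space) \<Rightarrow> real"
  assumes F: "slot_linear DIM('e) F"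
    and alt: "\<And>v i j. i < DIM('e) \<Longrightarrow> j < DIM('e) \<Longrightarrow> i \<noteq> j \<Longrightarrow> v i = v j \<Longrightarrow> F v = 0"
    and u: "slot_kills DIM('e) u F" and w: "F w \<noteq> 0"
  shows "u = 0"
proof -
  let ?N = "DIM('e)"
  have comb: "F (w(j := (\<Sum>i<?N. c i *\<^sub>R w i))) = c j * F w" if "j < ?N" for w c j
    by (rule slot_linear_combination[OF F _ that]) (rule alt)
  have rel: "c j = 0" if "(\<Sum>i<?N. c i *\<^sub>R w i) = 0" "j < ?N" for c j
  proof -
    have "F (w(j := 0)) = 0"
    proof -
      have "F (w(j := 0 *\<^sub>R 0 + 0 *\<^sub>R 0)) = 0 * F (w(j := 0)) + 0 * F (w(j := 0))"
        using F that(2) unfolding slot_linear_def by blast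
      then show ?thesis by (simp del: fun_upd_apply)
    qed
    then show ?thesis using comb[OF that(2), of w c] that(1) w by (simp del: fun_upd_apply)
  qed
  have inj: "inj_on w {..<?N}"
  proof (rule inj_onI)
    fix i j assume ij: "i \<in> {..<?N}" "j \<in> {..<?N}" "w i = w j"
    show "i = j" using alt[of i j w] ij w by auto
  qed
  have ind: "independent (w ` {..<?N})"
  proof (rule ccontr)
    assume "\<not> independent (w ` {..<?N})"
    then obtain c where c: "\<exists>v\<in>w ` {..<?N}. c v \<noteq> 0" "(\<Sum>v\<in>w ` {..<?N}. c v *\<^sub>R v) = 0"
      by (auto simp: dependent_finite)
    have "(\<Sum>i<?N. c (w i) *\<^sub>R w i) = 0" using c(2) by (simp add: sum.reindex[OF inj])
    from rel[OF this] c(1) show False by auto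
  qed
  have "dim (w ` {..<?N}) = ?N"
    using dim_eq_card_independent[OF ind] card_image[OF inj] by simp
  then have "span (w ` {..<?N}) = UNIV" by (simp add: dim_eq_full)
  then obtain c where c: "u = (\<Sum>v\<in>w ` {..<?N}. c v *\<^sub>R v)"
    using span_finite[of "w ` {..<?N}"] by auto
  have uc: "u = (\<Sum>i<?N. c (w i) *\<^sub>R w i)" using c by (simp add: sum.reindex[OF inj])
  have "c (w j) = 0" if "j < ?N" for j
  proof -
    have "F (w(j := u)) = 0" using u that by (simp add: slot_kills_def)
    then have "F (w(j := (\<Sum>i<?N. c (w i) *\<^sub>R w i))) = 0" by (simp only: uc)
    moreover have "F (w(j := (\<Sum>i<?N. c (w i) *\<^sub>R w i))) = c (w j) * F w" by (rule comb[OF that])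
    ultimately show ?thesis using w by simp
  qed
  then show ?thesis using uc by simp
qed

lemma wedge_power_compose:
  "wedge_power \<omega> n (\<lambda>i. C (w i)) = wedge_power (\<lambda>w. \<omega> (\<lambda>i. C (w i))) n w"
proof (induction n arbitrary: w)
  case (Suc n)
  have "wedge_power \<omega> n (\<lambda>i. C (w (\<pi> i))) = wedge_power (\<lambda>w. \<omega> (\<lambda>i. C (w i))) n (\<lambda>i. w (\<pi> i))" for \<pi>
    using Suc.IH[of "\<lambda>i. w (\<pi> i)"] .
  then show ?case by (simp add: wedge_def)
qed simp

text \<open>
  A vector annihilated by \<open>\<eta>\<close> and \<open>d\<eta>\<close> makes every term of \<open>(d\<eta>)\<^sup>n \<and> \<eta>\<close> vanish when it is inserted in one
  entry, while that form of top degree has a nonzero value.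
\<close>

lemma contact_nondegenerate:
  fixes M :: "('a::{t2_space,second_countable_topology}, 'e::euclidean_space) atlas"
  assumes contact: "contact_manifold n M \<eta>" and u: "u \<in> tangent_space M p"
    and \<eta>u: "\<eta> p u = 0" and du: "\<And>v. v \<in> tangent_space M p \<Longrightarrow> ext_deriv M \<eta> p u v = 0"
  shows "u = (\<lambda>f. 0)"
proof -
  have M: "manifold M" and dim: "DIM('e) = 2 * n + 1" and of: "one_form M \<eta>"
    using contact by (auto simp: contact_manifold_def)
  obtain v where v: "\<And>i. v i \<in> tangent_space M p"
    and nz: "wedge (2 * n) 1 (wedge_power (\<lambda>v. ext_deriv M \<eta> p (v 0) (v 1)) n) (\<lambda>v. \<eta> p (v 0)) v \<noteq> 0"
    using contact unfolding contact_manifold_def by blast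
  obtain U \<phi> where c: "(U, \<phi>) \<in> M" "p \<in> U" using manifold_chart[OF M] .
  note ch = manifoldD(1)[OF M c(1)] and cm = manifoldD(3)[OF M c(1)]
  note inv = is_chartD(6)[OF ch]
  let ?i = "inv_into U \<phi>"
  let ?x = "\<phi> p"
  note ip = smooth_param_inv_chart[OF M cm]
  have x: "?x \<in> \<phi> ` U" "?i ?x = p" using c(2) inv by auto
  define C where "C = push_vec M ?i ?x"
  have C_ts: "C w \<in> tangent_space M p" for w
    using push_vec_in_tangent_space[OF M ip x(1), of w] by (simp add: C_def x(2))
  have C_surj: "\<exists>w. t = C w" if t: "t \<in> tangent_space M p" for t
  proof -
    obtain U' \<psi> a where d: "(U', \<psi>) \<in> M" "p \<in> U'" "t = coord_vec M (U', \<psi>) p a"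
      using t unfolding tangent_space_def by auto
    note dch = manifoldD(1)[OF M d(1)] and jp = smooth_param_inv_chart[OF M manifoldD(3)[OF M d(1)]]
    have y: "\<psi> p \<in> \<psi> ` U'" "inv_into U' \<psi> (\<psi> p) = p" using d(2) is_chartD(6)[OF dch] by auto
    have "t = push_vec M (inv_into U' \<psi>) (\<psi> p) a" unfolding d(3) by (rule coord_vec_eq_push_vec[OF dch d(2)])
    also have "\<dots> = coord_vec M (U, \<phi>) p (dirder (\<lambda>z. \<phi> (inv_into U' \<psi> z)) (\<psi> p) a)"
      using push_vec_eq_coord_vec[OF M cm jp y(1)] y(2) c(2) by simp
    also have "\<dots> = C (dirder (\<lambda>z. \<phi> (inv_into U' \<psi> z)) (\<psi> p) a)"
      unfolding C_def by (rule coord_vec_eq_push_vec[OF ch c(2)])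
    finally show ?thesis by blast
  qed
  define E where "E = (\<lambda>z w. \<eta> (?i z) (push_vec M ?i z w))"
  note lf = one_form_linear_form_at[OF of]
  have E_lin: "linear (E z)" if "z \<in> \<phi> ` U" for z
    unfolding E_def by (rule linear_form_push_vec[OF M ip that lf])
  note fic = one_form_smooth_in_chart[OF of]
  have E_smooth: "smooth_on (\<phi> ` U) (\<lambda>z. E z w)" for w
  proof (rule smooth_on_cong[OF is_chartD(2)[OF ch] _ fic[OF c(1)]])
    fix z assume "z \<in> \<phi> ` U"
    then obtain q where q: "q \<in> U" "z = \<phi> q" by blast
    show "form_in_chart M \<eta> (U, \<phi>) w z = E z w"
      by (simp add: form_in_chart_def E_def q inv coord_vec_eq_push_vec[OF ch q(1)])
  qed
  have \<omega>: "ext_deriv M \<eta> p (C a) (C b) = ext_d E ?x a b" for a b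
  proof -
    have "ext_deriv M \<eta> (?i ?x) (push_vec M ?i ?x a) (push_vec M ?i ?x b) = ext_d (\<lambda>z w. \<eta> (?i z) (push_vec M ?i z w)) ?x a b"
    proof (rule ext_deriv_push_vec[OF M ip x(1) open_UNIV])
      fix V \<phi>' and b :: 'e assume d: "(V, \<phi>') \<in> M" "?i ?x \<in> V"
      show "form_in_chart M \<eta> (V, \<phi>') b differentiable at (\<phi>' (?i ?x))"
        by (rule differentiableI[OF smooth_on_has_derivative[OF fic[OF d(1)] is_chartD(2)[OF manifoldD(1)[OF M d(1)]]]])
           (use d(2) in blast)
    qed (simp_all add: lf)
    then show ?thesis by (simp add: C_def E_def x(2))
  qed
  have \<alpha>: "\<eta> p (C a) = E ?x a" for a by (simp add: C_def E_def x(2))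
  obtain a where a: "u = C a" using C_surj[OF u] by blast
  have "\<forall>i. \<exists>w. v i = C w" using C_surj[OF v] by blast
  then obtain w where w: "\<And>i. v i = C (w i)" by metis
  define A where "A = (\<lambda>v. ext_d E ?x (v (0::nat)) (v 1))"
  define B where "B = (\<lambda>v. E ?x (v (0::nat)))"
  have l1: "linear (ext_d E ?x b)" for b
    by (rule linear_ext_d[OF is_chartD(2)[OF ch] x(1) E_lin E_smooth])
  have l2: "ext_d E ?x (r *\<^sub>R y + s *\<^sub>R z) b = r * ext_d E ?x y b + s * ext_d E ?x z b" for r s y z b
    using linear_add[OF l1[of b]] linear_scale[OF l1[of b]] ext_d_swap[of E ?x _ b] by simp
  have Ea: "E ?x a = 0" using \<eta>u by (simp add: a \<alpha>)
  have da: "ext_d E ?x a b = 0" for b using du[OF C_ts[of b]] by (simp add: a \<omega>)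
  then have da': "ext_d E ?x b a = 0" for b using ext_d_swap[of E ?x b a] by simp
  have A_lin: "slot_linear 2 A" unfolding slot_linear_def A_def
    using linear_add[OF l1] linear_scale[OF l1] l2 by (auto simp: less_2_cases_iff)
  have A_kills: "slot_kills 2 a A" unfolding slot_kills_def A_def using da da' by (auto simp: less_2_cases_iff)
  have B_lin: "slot_linear 1 B" unfolding slot_linear_def B_def
    using linear_add[OF E_lin[OF x(1)]] linear_scale[OF E_lin[OF x(1)]] by auto
  have B_kills: "slot_kills 1 a B" unfolding slot_kills_def B_def using Ea by auto
  let ?F = "wedge (2 * n) 1 (wedge_power A n) B"
  have "v = (\<lambda>i. C (w i))" using w by blast
  then have "?F w \<noteq> 0"
    using nz wedge_power_compose[of "\<lambda>v. ext_deriv M \<eta> p (v 0) (v 1)" n C]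
    by (simp add: wedge_def \<omega> \<alpha> A_def B_def)
  moreover have "slot_linear DIM('e) ?F" unfolding dim
    by (rule slot_linear_wedge[OF wedge_power_slots(1)[OF A_lin A_kills] B_lin])
  moreover have "slot_kills DIM('e) a ?F" unfolding dim
    by (rule slot_kills_wedge[OF wedge_power_slots(2)[OF A_lin A_kills] B_kills])
  moreover have "?F v = 0" if "i < DIM('e)" "j < DIM('e)" "i \<noteq> j" "v i = v j" for v i j
    using wedge_repeated_entry[of i "2 * n" 1 j v] that dim by simp
  ultimately have "a = 0" by (intro top_form_nondegenerate[of ?F a w]) auto
  then show ?thesis
    using push_vec_linear[OF ip x(1), of 0 0 0 0] by (simp add: a C_def)
qed

section \<open>Coordinates given by a complete solution\<close>

lemma push_vec_cong:
  assumes s: "smooth_param M Z s" and z: "z \<in> Z" and eq: "\<And>y. y \<in> Z \<Longrightarrow> s y = t y"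
  shows "push_vec M s z w = push_vec M t z w"
proof
  fix f
  have "dirder (\<lambda>z. f (s z)) z w = dirder (\<lambda>z. f (t z)) z w" if f: "smooth_near M (s z) f"
  proof -
    have "((\<lambda>z. f (t z)) has_derivative dirder (\<lambda>z. f (s z)) z) (at z)"
      by (rule has_derivative_transform_within_open[OF smooth_param_has_derivative[OF s z f] smooth_paramD(1)[OF s] z])
         (simp add: eq)
    then show ?thesis by (rule dirder_eq[symmetric])
  qed
  then show "push_vec M s z w f = push_vec M t z w f" by (simp add: push_vec_def eq[OF z])
qed

text \<open>
  The setting of the theorem with a chart chosen on each of the three manifolds. In it \<open>sol\<close> is the complete
  solution in coordinates of \<open>N\<close> and \<open>\<Lambda>\<close>, \<open>form\<close> and \<open>ham\<close> are \<open>\<eta>\<close> and \<open>H\<close> pulled back along it, and \<open>vel\<close> is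
  the component of \<open>X\<close> along the leaves, which exists by \<open>X_eq_push_vec\<close>.
\<close>

locale complete_solution_chart =
  fixes n :: nat
    and M :: "('a::{t2_space,second_countable_topology}, 'm::euclidean_space) atlas"
    and N :: "('b::{t2_space,second_countable_topology}, 'n::euclidean_space) atlas"
    and L :: "('c::{t2_space,second_countable_topology}, 'l::euclidean_space) atlas"
    and \<eta> :: "'a \<Rightarrow> 'a tvec \<Rightarrow> real" and \<xi> X :: "'a \<Rightarrow> 'a tvec"
    and H :: "'a \<Rightarrow> real" and pr :: "'a \<Rightarrow> 'b" and \<Sigma> :: "'b \<times> 'c \<Rightarrow> 'a"
    and U and \<phi> :: "'a \<Rightarrow> 'm" and Nd and \<psi> :: "'b \<Rightarrow> 'n" and Ld and \<theta> :: "'c \<Rightarrow> 'l"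
  assumes contactM: "contact_manifold n M \<eta>" and reebM: "reeb_field M \<eta> \<xi>"
    and N: "manifold N" and pr: "smooth_map M N pr"
    and H: "smooth_map M euclidean_atlas H" and \<xi>H: "\<And>p. \<xi> p H \<noteq> 0"
    and X: "contact_field M \<eta> \<xi> H X"
    and L: "manifold L" and \<Sigma>: "complete_solution M N L pr X UNIV UNIV UNIV \<Sigma>"
    and c: "(U, \<phi>) \<in> M" and cn: "(Nd, \<psi>) \<in> N" and cl: "(Ld, \<theta>) \<in> L"
begin

definition "domain = \<psi> ` Nd \<times> \<theta> ` Ld"
definition "param = (\<lambda>z. (inv_into Nd \<psi> (fst z), inv_into Ld \<theta> (snd z)))"
definition "sol = (\<lambda>z. \<Sigma> (param z))"
definition "form = (\<lambda>z w. \<eta> (sol z) (push_vec M sol z w))"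
definition "ham = (\<lambda>z. H (sol z))"
definition "vel = (\<lambda>z. SOME u. X (sol z) = push_vec M sol z (u, 0))"

end

lemma (in complete_solution_chart) M: "manifold M" and one_form: "one_form M \<eta>"
  using contactM by (auto simp: contact_manifold_def)

lemma (in complete_solution_chart) P: "manifold (prod_atlas N L)"
  by (rule manifold_prod[OF N L])

lemma (in complete_solution_chart) cp: "(Nd \<times> Ld, map_prod \<psi> \<theta>) \<in> prod_atlas N L"
  using cn cl unfolding prod_atlas_def by blast

lemma (in complete_solution_chart) local_diffeo_sol: "local_diffeo (prod_atlas N L) M \<Sigma> UNIV UNIV"
  using \<Sigma> by (simp add: complete_solution_def)

lemma (in complete_solution_chart) domain_eq: "domain = map_prod \<psi> \<theta> ` (Nd \<times> Ld)"
  by (auto simp: domain_def)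

lemma (in complete_solution_chart) param_eq: "z \<in> domain \<Longrightarrow> inv_into (Nd \<times> Ld) (map_prod \<psi> \<theta>) z = param z"
  unfolding domain_def param_def by (rule inv_into_map_prod[OF manifoldD(1)[OF N cn] manifoldD(1)[OF L cl]])

lemma (in complete_solution_chart) param_smooth: "smooth_param (prod_atlas N L) domain param"
proof -
  note ip = smooth_param_inv_chart[OF P manifoldD(3)[OF P cp], folded domain_eq]
  show ?thesis unfolding smooth_param_def
  proof (intro conjI allI impI)
    show "open domain" by (rule smooth_paramD(1)[OF ip])
    show "continuous_on domain param"
      by (rule continuous_on_eq[OF smooth_paramD(2)[OF ip]]) (rule param_eq)
    fix W and f :: "'b \<times> 'c \<Rightarrow> real" assume f: "smooth_fun_on (prod_atlas N L) W f"
    then have W: "open W" by (simp add: smooth_fun_on_iff)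
    have eq: "domain \<inter> inv_into (Nd \<times> Ld) (map_prod \<psi> \<theta>) -` W = domain \<inter> param -` W" using param_eq by auto
    have o: "open (domain \<inter> param -` W)" using smooth_paramD(4)[OF ip W] by (simp only: eq)
    show "smooth_on (domain \<inter> param -` W) (\<lambda>z. f (param z))"
      by (rule smooth_on_cong[OF o _ smooth_paramD(3)[OF ip f, unfolded eq]]) (simp add: param_eq)
  qed
qed

lemma (in complete_solution_chart) sol_smooth: "smooth_param M domain sol"
proof -
  have "smooth_map (prod_atlas N L) M \<Sigma>" using local_diffeo_sol by (simp add: local_diffeo_def)
  from smooth_param_compose[OF manifoldD(1)[OF P] M this param_smooth] show ?thesis by (simp add: sol_def)
qed

lemma (in complete_solution_chart) sol_push_eq:
  assumes "z \<in> domain"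
  shows "push_vec M (\<lambda>z. \<Sigma> (inv_into (Nd \<times> Ld) (map_prod \<psi> \<theta>) z)) z w = push_vec M sol z w"
  by (rule push_vec_cong[OF sol_smooth assms, symmetric]) (simp add: sol_def param_eq)

lemma (in complete_solution_chart) push_vec_sol_inj:
  assumes z: "z \<in> domain" and w: "push_vec M sol z w = (\<lambda>f. 0)"
  shows "w = 0"
proof (rule local_diffeo_push_vec_inj[OF M P local_diffeo_sol cp])
  show "z \<in> map_prod \<psi> \<theta> ` (Nd \<times> Ld)" using z by (simp only: domain_eq)
  show "push_vec M (\<lambda>z. \<Sigma> (inv_into (Nd \<times> Ld) (map_prod \<psi> \<theta>) z)) z w = (\<lambda>f. 0)"
    unfolding sol_push_eq[OF z] by (rule w)
qed

lemma (in complete_solution_chart) push_vec_sol_surj: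
  assumes z: "z \<in> domain" and v: "v \<in> tangent_space M (sol z)"
  shows "\<exists>w. v = push_vec M sol z w"
  using local_diffeo_push_vec_surj[OF M P local_diffeo_sol cp, of z v] z v sol_push_eq[OF z]
  by (simp add: domain_eq[symmetric] sol_def param_eq)

lemma (in complete_solution_chart) domainD:
  assumes "(x, y) \<in> domain"
  shows "x \<in> \<psi> ` Nd" "y \<in> \<theta> ` Ld" "sol (x, y) = \<Sigma> (inv_into Nd \<psi> x, inv_into Ld \<theta> y)"
  using assms by (auto simp: domain_def sol_def param_def)

lemma (in complete_solution_chart) HJE:
  "HJE_solution M N pr X UNIV UNIV (partial_solution \<Sigma> l)"
  using \<Sigma> by (simp add: complete_solution_def)

lemma (in complete_solution_chart) pushforward_partial_solution:
  assumes z: "(x, y) \<in> domain"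
  shows "pushforward M (partial_solution \<Sigma> (inv_into Ld \<theta> y)) (inv_into Nd \<psi> x) (push_vec N (inv_into Nd \<psi>) x v)
    = push_vec M sol (x, y) (v, 0)"
proof -
  have \<sigma>: "smooth_map N M (partial_solution \<Sigma> (inv_into Ld \<theta> y))" using HJE by (simp add: HJE_solution_def)
  have "pushforward M (partial_solution \<Sigma> (inv_into Ld \<theta> y)) (inv_into Nd \<psi> x) (push_vec N (inv_into Nd \<psi>) x v)
      = push_vec M (\<lambda>x. \<Sigma> (inv_into Nd \<psi> x, inv_into Ld \<theta> y)) x v"
    by (rule pushforward_push_vec[OF manifoldD(1)[OF N] M \<sigma> UNIV_I])
  also have "(\<lambda>x. \<Sigma> (inv_into Nd \<psi> x, inv_into Ld \<theta> y)) = (\<lambda>x. sol (x, y))"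
    by (simp add: sol_def param_def)
  also have "push_vec M (\<lambda>x. sol (x, y)) x v = push_vec M sol (x, y) (v, 0)"
    by (rule push_vec_slice[OF sol_smooth z])
  finally show ?thesis .
qed

text \<open>
  This is the Hamilton-Jacobi equation: \<open>X\<close> is the image under a partial solution of the projection of \<open>X\<close>
  to \<open>N\<close>.
\<close>

lemma (in complete_solution_chart) X_eq_push_vec:
  assumes z: "z \<in> domain"
  shows "X (sol z) = push_vec M sol z (vel z, 0)"
proof -
  obtain x y where xy: "z = (x, y)" by (cases z)
  let ?q = "sol z" and ?n = "inv_into Nd \<psi> x" and ?\<sigma> = "partial_solution \<Sigma> (inv_into Ld \<theta> y)"
  note d = domainD[OF z[unfolded xy]]
  have q: "?q = ?\<sigma> ?n" by (simp add: xy d(3))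
  note nch = manifoldD(1)[OF N cn]
  have n: "?n \<in> Nd" "\<psi> ?n = x" using d(1) is_chartD(6)[OF nch] by auto
  have prq: "pr ?q = ?n" and hje: "pushforward M ?\<sigma> ?n (pushforward N pr ?q (X ?q)) = X ?q"
    using HJE[of "inv_into Ld \<theta> y"] unfolding HJE_solution_def q by blast+
  have "X ?q \<in> tangent_space M ?q" using X by (simp add: contact_field_def vector_field_def)
  then obtain V \<phi>' a where m: "(V, \<phi>') \<in> M" "?q \<in> V" "X ?q = coord_vec M (V, \<phi>') ?q a"
    unfolding tangent_space_def by auto
  note mch = manifoldD(1)[OF M m(1)] and jp = smooth_param_inv_chart[OF M manifoldD(3)[OF M m(1)]]
  let ?j = "inv_into V \<phi>'"
  have j: "\<phi>' ?q \<in> \<phi>' ` V" "?j (\<phi>' ?q) = ?q" using m(2) is_chartD(6)[OF mch] by auto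
  have prp: "smooth_param N (\<phi>' ` V) (\<lambda>x. pr (?j x))"
    using smooth_param_compose[OF manifoldD(1)[OF M] N pr jp] by simp
  have "pushforward N pr (?j (\<phi>' ?q)) (push_vec M ?j (\<phi>' ?q) a) = push_vec N (\<lambda>x. pr (?j x)) (\<phi>' ?q) a"
    by (rule pushforward_push_vec[OF manifoldD(1)[OF M] N pr UNIV_I])
  then have "pushforward N pr ?q (X ?q) = push_vec N (\<lambda>x. pr (?j x)) (\<phi>' ?q) a"
    using j(2) by (simp add: m(3) coord_vec_eq_push_vec[OF mch m(2)])
  also have "\<dots> = coord_vec N (Nd, \<psi>) ?n (dirder (\<lambda>x. \<psi> (pr (?j x))) (\<phi>' ?q) a)"
    using push_vec_eq_coord_vec[OF N manifoldD(3)[OF N cn] prp j(1)] j(2) prq n(1) by simp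
  also have "\<dots> = push_vec N (inv_into Nd \<psi>) x (dirder (\<lambda>x. \<psi> (pr (?j x))) (\<phi>' ?q) a)"
    using coord_vec_eq_push_vec[OF nch n(1)] n(2) by simp
  finally have "X ?q = push_vec M sol (x, y) (dirder (\<lambda>x. \<psi> (pr (?j x))) (\<phi>' ?q) a, 0)"
    using hje pushforward_partial_solution[OF z[unfolded xy]] by simp
  then have "\<exists>u. X ?q = push_vec M sol z (u, 0)" unfolding xy by blast
  then show ?thesis unfolding vel_def by (rule someI_ex)
qed

lemma (in complete_solution_chart) ext_deriv_form:
  assumes z: "z \<in> domain"
  shows "ext_deriv M \<eta> (sol z) (push_vec M sol z a) (push_vec M sol z b) = ext_d form z a b"
  unfolding form_def
proof (rule ext_deriv_push_vec[OF M sol_smooth z open_UNIV])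
  fix V \<phi>' and b :: 'm assume d: "(V, \<phi>') \<in> M" "sol z \<in> V"
  show "form_in_chart M \<eta> (V, \<phi>') b differentiable at (\<phi>' (sol z))"
    by (rule differentiableI[OF smooth_on_has_derivative[OF one_form_smooth_in_chart[OF one_form d(1)]
          is_chartD(2)[OF manifoldD(1)[OF M d(1)]]]]) (use d(2) in blast)
qed (simp_all add: one_form_linear_form_at[OF one_form])

lemma (in complete_solution_chart) smooth_near_H: "smooth_near M p H"
  using H unfolding smooth_near_def by blast

lemma (in complete_solution_chart) dirder_ham: "dirder ham z w = push_vec M sol z w H"
  by (simp add: push_vec_def smooth_near_H ham_def)

lemma (in complete_solution_chart) ext_deriv_form_over_ham:
  assumes z: "z \<in> domain" and nz: "ham z \<noteq> 0"
  shows "ext_deriv M (\<lambda>p v. \<eta> p v / H p) (sol z) (push_vec M sol z a) (push_vec M sol z b)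
    = ext_d (\<lambda>z w. form z w / ham z) z a b"
proof -
  have H_cont: "continuous_on UNIV H" using H by (simp add: smooth_map_on_def)
  have o: "open (H -` (- {0}))" by (rule open_vimage[OF open_Compl[OF closed_singleton] H_cont])
  have "ext_deriv M (\<lambda>p v. \<eta> p v / H p) (sol z) (push_vec M sol z a) (push_vec M sol z b)
    = ext_d (\<lambda>z w. (\<lambda>p v. \<eta> p v / H p) (sol z) (push_vec M sol z w)) z a b"
  proof (rule ext_deriv_push_vec[OF M sol_smooth z o])
    show "sol z \<in> H -` (- {0})" using nz by (simp add: ham_def)
    show "linear_form_at M (\<lambda>p v. \<eta> p v / H p) q" for q
      using one_form_linear_form_at[OF one_form, of q] by (simp add: linear_form_at_def add_divide_distrib)
    fix V \<phi>' and b :: 'm assume d: "(V, \<phi>') \<in> M" "sol z \<in> V"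
    note dch = manifoldD(1)[OF M d(1)]
    let ?x = "\<phi>' (sol z)"
    have x: "?x \<in> \<phi>' ` V" "inv_into V \<phi>' ?x = sol z" using d(2) is_chartD(6)[OF dch] by auto
    have e: "(form_in_chart M \<eta> (V, \<phi>') b has_derivative dirder (form_in_chart M \<eta> (V, \<phi>') b) ?x) (at ?x)"
      by (rule smooth_on_has_derivative[OF one_form_smooth_in_chart[OF one_form d(1)] is_chartD(2)[OF dch] x(1)])
    have h: "((\<lambda>x. H (inv_into V \<phi>' x)) has_derivative dirder (\<lambda>x. H (inv_into V \<phi>' x)) ?x) (at ?x)"
      by (rule smooth_param_has_derivative[OF smooth_param_inv_chart[OF M manifoldD(3)[OF M d(1)]] x(1) smooth_near_H])
    have "H (inv_into V \<phi>' ?x) \<noteq> 0" using nz by (simp add: x(2) ham_def)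
    from has_derivative_divide'[OF e h this]
    have "(\<lambda>x. form_in_chart M \<eta> (V, \<phi>') b x / H (inv_into V \<phi>' x)) differentiable at ?x" by (rule differentiableI)
    then show "form_in_chart M (\<lambda>p v. \<eta> p v / H p) (V, \<phi>') b differentiable at ?x"
      by (simp add: form_in_chart_def[abs_def] Let_def)
  qed
  then show ?thesis by (simp add: form_def ham_def)
qed

lemma (in complete_solution_chart) data_subset:
  shows "form_data M \<eta> \<subseteq> known_data M N L \<eta> H pr \<Sigma>" "map_data M euclidean_atlas H \<subseteq> known_data M N L \<eta> H pr \<Sigma>"
    "map_data (prod_atlas N L) M \<Sigma> \<subseteq> known_data M N L \<eta> H pr \<Sigma>"
  unfolding known_data_def by blast+

lemma (in complete_solution_chart) sol_constructible:
  assumes Z: "open Z" "Z \<subseteq> domain \<inter> sol -` U" and b: "b \<in> Basis"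
  shows "constructible_on (known_data M N L \<eta> H pr \<Sigma>) Z (\<lambda>z. \<phi> (sol z) \<bullet> b)"
proof -
  let ?Y = "map_prod \<psi> \<theta> ` ((Nd \<times> Ld) \<inter> \<Sigma> -` U)"
  have "component_funs ?Y (\<phi> \<circ> \<Sigma> \<circ> inv_into (Nd \<times> Ld) (map_prod \<psi> \<theta>)) \<subseteq> map_data (prod_atlas N L) M \<Sigma>"
    unfolding map_data_def using cp c by fastforce
  then have "component_funs ?Y (\<phi> \<circ> \<Sigma> \<circ> inv_into (Nd \<times> Ld) (map_prod \<psi> \<theta>)) \<subseteq> known_data M N L \<eta> H pr \<Sigma>"
    using data_subset(3) by (rule subset_trans)
  from constructible_on_component_funs[OF this b]
  have k: "constructible_on (known_data M N L \<eta> H pr \<Sigma>) ?Y (\<lambda>z. (\<phi> \<circ> \<Sigma> \<circ> inv_into (Nd \<times> Ld) (map_prod \<psi> \<theta>)) z \<bullet> b)" .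
  have "Z \<subseteq> ?Y"
  proof
    fix z assume "z \<in> Z"
    then have z: "z \<in> domain" "sol z \<in> U" using Z(2) by auto
    have "z = map_prod \<psi> \<theta> (param z)" "param z \<in> Nd \<times> Ld"
      using z(1) is_chartD(6)[OF manifoldD(1)[OF N cn]] is_chartD(6)[OF manifoldD(1)[OF L cl]]
      by (auto simp: domain_def param_def)
    then show "z \<in> ?Y" using z(2) by (intro image_eqI[of z _ "param z"]) (auto simp: sol_def)
  qed
  then show ?thesis
    by (rule constructible_on_subset[OF k Z(1)]) (use Z(2) in \<open>auto simp: sol_def param_eq\<close>)
qed

text \<open>
  Every tangent vector of \<open>M\<close> is the image of a coordinate vector, so the equations that characterize the
  contact form, its Reeb field and \<open>X\<close> can be pulled back along \<open>sol\<close>. The chart \<open>\<phi>\<close> enters only to express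
  the pulled-back objects through the known data.
\<close>

lemma (in complete_solution_chart) contact_coords_sol:
  assumes Z: "open Z" "Z \<subseteq> domain \<inter> sol -` U" and z0: "(x0, y0) \<in> Z"
  shows "contact_coords (known_data M N L \<eta> H pr \<Sigma>) Z form ham (\<lambda>z. \<xi> (sol z) H) vel x0 y0"
proof (rule contact_coords.intro)
  let ?D = "known_data M N L \<eta> H pr \<Sigma>"
  let ?S = "\<lambda>z. \<phi> (sol z)" and ?e = "form_in_chart M \<eta> (U, \<phi>)"
  note cm = manifoldD(3)[OF M c] and ch = manifoldD(1)[OF M c]
  have dom: "z \<in> domain" "sol z \<in> U" if "z \<in> Z" for z using that Z(2) by auto
  have Zd: "Z \<subseteq> domain" using dom by blast
  note sZ = smooth_param_subset[OF sol_smooth Z(1) Zd]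
  show "open Z" "(x0, y0) \<in> Z" by (rule Z(1), rule z0)
  show lin: "linear (form z)" if "z \<in> Z" for z
    unfolding form_def by (rule linear_form_push_vec[OF M sol_smooth dom(1)[OF that] one_form_linear_form_at[OF one_form]])
  have form_eq: "form z w = (\<Sum>i\<in>Basis. (dirder ?S z w \<bullet> i) * ?e i (?S z))" if "z \<in> Z" for z w
    unfolding form_def
    by (rule form_push_vec_eq_sum[OF M sol_smooth dom(1)[OF that] one_form_linear_form_at[OF one_form] c dom(2)[OF that]])
  have S_smooth: "smooth_on Z ?S"
    by (rule smooth_on_subset[OF smooth_param_chart_smooth[OF M cm sol_smooth] Z(2)])
  have SU: "?S ` Z \<subseteq> \<phi> ` U" using dom(2) by blast
  have e_smooth: "smooth_on Z (\<lambda>z. ?e i (?S z))" for i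
    by (rule smooth_on_compose[OF Z(1) is_chartD(2)[OF ch] SU S_smooth one_form_smooth_in_chart[OF one_form c]])
  show "smooth_on Z (\<lambda>z. form z w)" for w
  proof -
    have "smooth_on Z (\<lambda>z. \<Sum>i\<in>Basis. (dirder ?S z w \<bullet> i) * ?e i (?S z))"
      by (rule smooth_on_sum[OF Z(1)], rule smooth_on_mult[OF Z(1)
            smooth_on_linear_compose[OF bounded_linear_inner_left Z(1) smooth_on_dirder[OF S_smooth]] e_smooth])
    then show ?thesis by (rule smooth_on_cong[OF Z(1), rotated]) (simp only: form_eq)
  qed
  have Hs: "smooth_fun_on M UNIV H" by (rule H)
  show "smooth_on Z ham"
    unfolding ham_def by (rule smooth_on_subset[OF smooth_paramD(3)[OF sol_smooth Hs]]) (use Zd in blast)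
  have Scon: "constructible_on ?D Z (\<lambda>z. ?S z \<bullet> b)" if "b \<in> Basis" for b by (rule sol_constructible[OF Z that])
  show "constructible_on ?D Z (\<lambda>z. form z w)" for w
  proof -
    have S'con: "constructible_on ?D Z (\<lambda>z. dirder ?S z w \<bullet> i)" if "i \<in> Basis" for i
      by (rule constructible_on_derivative[OF Z(1) Scon[OF that] bounded_linear.has_derivative[OF bounded_linear_inner_left
            smooth_on_has_derivative[OF S_smooth Z(1)]]])
    have "component_funs (\<phi> ` U) (\<lambda>x. \<Sum>b\<in>Basis. ?e b x *\<^sub>R b) \<subseteq> form_data M \<eta>"
      unfolding form_data_def using c by fastforce
    then have cf: "component_funs (\<phi> ` U) (\<lambda>x. \<Sum>b\<in>Basis. ?e b x *\<^sub>R b) \<subseteq> ?D"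
      using data_subset(1) by (rule subset_trans)
    have econ: "constructible_on ?D (\<phi> ` U) (?e i)" if i: "i \<in> Basis" for i
      using constructible_on_component_funs[OF cf i] i by simp
    have "constructible_on ?D Z (\<lambda>z. ?e i (?S z))" if "i \<in> Basis" for i
      by (rule constructible_on_compose[OF Z(1) econ[OF that] SU Scon])
    then have "constructible_on ?D Z (\<lambda>z. \<Sum>i\<in>Basis. (dirder ?S z w \<bullet> i) * ?e i (?S z))"
      by (intro constructible_on_sum[OF Z(1)] constructible_on_mult S'con)
    then show ?thesis by (rule constructible_on_subset[OF _ Z(1) subset_refl]) (rule form_eq)
  qed
  show "constructible_on ?D Z ham"
  proof -
    have "component_funs (\<phi> ` (U \<inter> H -` UNIV)) (id \<circ> H \<circ> inv_into U \<phi>) \<subseteq> map_data M euclidean_atlas H"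
      unfolding map_data_def euclidean_atlas_def using c by fastforce
    then have cf: "component_funs (\<phi> ` (U \<inter> H -` UNIV)) (id \<circ> H \<circ> inv_into U \<phi>) \<subseteq> ?D"
      using data_subset(2) by (rule subset_trans)
    have k: "constructible_on ?D (\<phi> ` U) (\<lambda>x. H (inv_into U \<phi> x))"
      using constructible_on_component_funs[OF cf, of 1] by simp
    have "constructible_on ?D Z (\<lambda>z. H (inv_into U \<phi> (?S z)))"
      by (rule constructible_on_compose[OF Z(1) k SU Scon])
    then show ?thesis
      by (rule constructible_on_subset[OF _ Z(1) subset_refl]) (simp add: ham_def is_chartD(6)[OF ch] dom(2))
  qed
  show "a = 0" if z: "z \<in> Z" and a0: "form z a = 0" and ab: "\<And>b. ext_d form z a b = 0" for z a
  proof (rule push_vec_sol_inj[OF dom(1)[OF z]], rule contact_nondegenerate[OF contactM])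
    show "push_vec M sol z a \<in> tangent_space M (sol z)" by (rule push_vec_in_tangent_space[OF M sol_smooth dom(1)[OF z]])
    show "\<eta> (sol z) (push_vec M sol z a) = 0" using a0 by (simp add: form_def)
    fix v assume "v \<in> tangent_space M (sol z)"
    then obtain b where "v = push_vec M sol z b" using push_vec_sol_surj[OF dom(1)[OF z]] by blast
    then show "ext_deriv M \<eta> (sol z) (push_vec M sol z a) v = 0"
      using ab[of b] ext_deriv_form[OF dom(1)[OF z]] by simp
  qed
  show "\<exists>r. form z r = 1 \<and> (\<forall>b. ext_d form z r b = 0) \<and> dirder ham z r = \<xi> (sol z) H" if z: "z \<in> Z" for z
  proof -
    have "\<xi> (sol z) \<in> tangent_space M (sol z)" using reebM by (simp add: reeb_field_def vector_field_def)
    then obtain r where r: "\<xi> (sol z) = push_vec M sol z r" using push_vec_sol_surj[OF dom(1)[OF z]] by blast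
    have "\<eta> (sol z) (\<xi> (sol z)) = 1" and i0: "\<And>v. v \<in> tangent_space M (sol z) \<Longrightarrow> ext_deriv M \<eta> (sol z) (\<xi> (sol z)) v = 0"
      using reebM by (auto simp: reeb_field_def)
    then have "form z r = 1" by (simp add: r form_def)
    moreover have "ext_d form z r b = 0" for b
      using i0[OF push_vec_in_tangent_space[OF M sol_smooth dom(1)[OF z], of b]] ext_deriv_form[OF dom(1)[OF z], of r b]
      by (simp add: r)
    moreover have "dirder ham z r = \<xi> (sol z) H" by (simp add: dirder_ham r)
    ultimately show ?thesis by blast
  qed
  show "\<xi> (sol z) H \<noteq> 0" for z by (rule \<xi>H)
  show "continuous_on Z (\<lambda>z. \<xi> (sol z) H)"
  proof -
    have "smooth_fun_on M UNIV (\<lambda>p. \<xi> p H)" using reebM Hs by (simp add: reeb_field_def vector_field_def)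
    from smooth_on_continuous_on[OF smooth_paramD(3)[OF sol_smooth this]] show ?thesis
      by (rule continuous_on_subset) (use Zd in blast)
  qed
  have Xd: "ext_deriv M \<eta> q (X q) v = - v H + \<xi> q H * \<eta> q v" if "v \<in> tangent_space M q" for q v
    using X that unfolding contact_field_def by blast
  show "ext_d form z (vel z, 0) b = - dirder ham z b + \<xi> (sol z) H * form z b" if z: "z \<in> Z" for z b
    using Xd[OF push_vec_in_tangent_space[OF M sol_smooth dom(1)[OF z], of b]]
    unfolding X_eq_push_vec[OF dom(1)[OF z]] ext_deriv_form[OF dom(1)[OF z]] dirder_ham
    by (simp add: form_def)
  have XH: "\<eta> q (X q) = H q" for q using X unfolding contact_field_def by blast
  show "form z (vel z, 0) = ham z" if z: "z \<in> Z" for z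
    using XH[of "sol z"] unfolding X_eq_push_vec[OF dom(1)[OF z]] by (simp add: form_def ham_def)
qed

lemma (in complete_solution_chart) integral_curve_of_solution:
  assumes Z: "open Z" "Z \<subseteq> domain \<inter> sol -` U"
    and solved: "solved_by_quadratures (known_data M N L \<eta> H pr \<Sigma>) Z vel x0 y0"
  shows "\<exists>\<epsilon>>0. \<exists>\<gamma>. \<gamma> 0 = sol (x0, y0) \<and> integral_curve M X {-\<epsilon><..<\<epsilon>} \<gamma> \<and> \<gamma> ` {-\<epsilon><..<\<epsilon>} \<subseteq> U \<and>
     (\<forall>b\<in>Basis. known (known_data M N L \<eta> H pr \<Sigma>) 1 {y \<in> topspace (Euclidean_space 1). y 0 \<in> {-\<epsilon><..<\<epsilon>}}
        (\<lambda>y. \<phi> (\<gamma> (y 0)) \<bullet> b))"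
proof -
  let ?D = "known_data M N L \<eta> H pr \<Sigma>"
  obtain \<epsilon> x where e: "\<epsilon> > 0" "x 0 = x0"
    and x: "\<forall>t\<in>{-\<epsilon><..<\<epsilon>}. (x t, y0) \<in> Z \<and> (x has_vector_derivative vel (x t, y0)) (at t)"
    and con: "\<forall>b\<in>Basis. constructible_on ?D {-\<epsilon><..<\<epsilon>} (\<lambda>t. x t \<bullet> b)"
    using solved unfolding solved_by_quadratures_def by blast
  let ?J = "{-\<epsilon><..<\<epsilon>}"
  define \<gamma> where "\<gamma> = (\<lambda>t. sol (x t, y0))"
  have xZ: "(x t, y0) \<in> Z" and x': "(x has_vector_derivative vel (x t, y0)) (at t)" if "t \<in> ?J" for t
    using x that by auto
  have dom: "(x t, y0) \<in> domain" "\<gamma> t \<in> U" if "t \<in> ?J" for t using xZ[OF that] Z(2) by (auto simp: \<gamma>_def)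
  have x_cont: "continuous_on ?J x"
    using x' by (intro continuous_at_imp_continuous_on ballI has_vector_derivative_continuous) auto
  have cont: "continuous_on ?J \<gamma>" unfolding \<gamma>_def
    by (rule continuous_on_compose2[OF smooth_paramD(2)[OF sol_smooth], where f = "\<lambda>t. (x t, y0)"])
       (use dom(1) in \<open>auto intro!: continuous_intros x_cont\<close>)
  have der: "((\<lambda>s. f (\<gamma> s)) has_real_derivative X (\<gamma> t) f) (at t)" if t: "t \<in> ?J" and f: "smooth_near M (\<gamma> t) f" for t f
  proof -
    let ?z = "(x t, y0)"
    have f0: "smooth_near M (sol ?z) f" using f by (simp add: \<gamma>_def)
    note f' = smooth_param_has_derivative[OF sol_smooth dom(1)[OF t] f0]
    have "((\<lambda>t. (x t, y0)) has_derivative (\<lambda>h. (h *\<^sub>R vel ?z, 0))) (at t)"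
      using x'[OF t] unfolding has_vector_derivative_def by (auto intro!: derivative_eq_intros)
    from has_derivative_compose[OF this f']
    have "((\<lambda>t. f (\<gamma> t)) has_derivative (\<lambda>h. dirder (\<lambda>z. f (sol z)) ?z (h *\<^sub>R (vel ?z, 0)))) (at t)"
      by (simp add: \<gamma>_def)
    then have "((\<lambda>t. f (\<gamma> t)) has_real_derivative dirder (\<lambda>z. f (sol z)) ?z (vel ?z, 0)) (at t)"
      unfolding linear_scale[OF has_derivative_linear[OF f']] has_field_derivative_def
      by (simp add: mult.commute[of _ "dirder _ _ _"])
    moreover have "X (\<gamma> t) f = dirder (\<lambda>z. f (sol z)) ?z (vel ?z, 0)"
      using X_eq_push_vec[OF dom(1)[OF t]] f0 by (simp add: \<gamma>_def push_vec_def)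
    ultimately show ?thesis by simp
  qed
  have Xv: "vector_field M X" using X by (simp add: contact_field_def)
  have "integral_curve M X ?J \<gamma>"
    unfolding integral_curve_def
    using integral_curve_smooth[OF M Xv open_greaterThanLessThan cont der] der by blast
  moreover have "known ?D 1 {y \<in> topspace (Euclidean_space 1). y 0 \<in> ?J} (\<lambda>y. \<phi> (\<gamma> (y 0)) \<bullet> b)" if b: "b \<in> Basis" for b
  proof (rule constructible_on_real_imp_known)
    show "constructible_on ?D ?J (\<lambda>t. \<phi> (\<gamma> t) \<bullet> b)"
      unfolding \<gamma>_def
      by (rule constructible_on_curve_in_slice[OF sol_constructible[OF Z b] open_greaterThanLessThan xZ])
         (use con in auto)
  qed
  ultimately show ?thesis using e dom(2) by (intro exI[of _ \<epsilon>] conjI exI[of _ \<gamma>]) (auto simp: \<gamma>_def)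
qed

section \<open>Integral curves off and on the zero level\<close>

text \<open>
  Near a point of \<open>N' \<times> L'\<close> the preimage of \<open>M'\<close> is \<open>N' \<times> L'\<close>. Off the zero level this makes \<open>N'\<close> and \<open>L'\<close> open;
  on it, it makes the zero set of \<open>ham\<close> a product.
\<close>

lemma (in complete_solution_chart) restricted_domain:
  assumes r: "restricts_to M N L pr X \<Sigma> M' N' L'" and z0: "z0 \<in> domain" and s0: "sol z0 \<in> U"
    and p0: "param z0 \<in> N' \<times> L'"
  obtains Z where "open Z" "z0 \<in> Z" "Z \<subseteq> domain \<inter> sol -` U"
    "\<And>z. z \<in> Z \<Longrightarrow> sol z \<in> M' \<longleftrightarrow> param z \<in> N' \<times> L'"
proof -
  have rel: "local_diffeo (prod_atlas N L) M \<Sigma> (N' \<times> L') M'" and im: "\<Sigma> ` (N' \<times> L') = M'"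
    using r by (auto simp: restricts_to_def complete_solution_def)
  obtain Q where Q: "open Q" "param z0 \<in> Q" "\<And>q. q \<in> Q \<Longrightarrow> \<Sigma> q \<in> M' \<longleftrightarrow> q \<in> N' \<times> L'"
    using local_restriction[OF local_diffeo_sol rel im p0] by blast
  have oU: "open U" by (rule is_chartD(1)[OF manifoldD(1)[OF M c]])
  let ?Z = "(domain \<inter> sol -` U) \<inter> (domain \<inter> param -` Q)"
  show ?thesis
  proof (rule that[of ?Z])
    show "open ?Z" by (rule open_Int[OF smooth_paramD(4)[OF sol_smooth oU] smooth_paramD(4)[OF param_smooth Q(1)]])
    show "z0 \<in> ?Z" using z0 s0 Q(2) by simp
    show "?Z \<subseteq> domain \<inter> sol -` U" by blast
    show "sol z \<in> M' \<longleftrightarrow> param z \<in> N' \<times> L'" if "z \<in> ?Z" for z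
      using Q(3)[of "param z"] that by (simp add: sol_def)
  qed
qed

lemma (in complete_solution_chart) curve_tangent_to:
  assumes "submanifold N k N'" and z: "(x, y) \<in> domain"
    and curve: "c 0 = x" "(c has_vector_derivative v) (at 0)" "\<forall>\<^sub>F t in nhds 0. inv_into Nd \<psi> (c t) \<in> N'"
  shows "push_vec N (inv_into Nd \<psi>) x v \<in> tangent_to N N' (inv_into Nd \<psi> x)"
  by (rule tangent_to_of_curve[OF N cn assms(1) domainD(1)[OF z] curve])

text \<open>
  The submanifold of \<open>N\<close> contains a neighbourhood in the leaf, so it contains the lines in coordinates and
  all leaf directions are tangent to it.
\<close>

lemma (in complete_solution_chart) solved_on_energy_nonzero:
  assumes r: "restricts_to M N L pr X \<Sigma> {m. H m \<noteq> 0} N\<^sub>1 L\<^sub>1"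
    and isotropic: "\<forall>l\<in>L\<^sub>1. \<forall>n\<in>N\<^sub>1. \<forall>u\<in>tangent_to N N\<^sub>1 n. \<forall>v\<in>tangent_to N N\<^sub>1 n.
           let \<sigma> = partial_solution \<Sigma> l in
             ext_deriv M (\<lambda>p v. \<eta> p v / H p) (\<sigma> n) (pushforward M \<sigma> n u) (pushforward M \<sigma> n v) = 0"
    and z0: "(x0, y0) \<in> domain" "sol (x0, y0) \<in> U" "param (x0, y0) \<in> N\<^sub>1 \<times> L\<^sub>1"
  shows "\<exists>Z. open Z \<and> Z \<subseteq> domain \<inter> sol -` U \<and> solved_by_quadratures (known_data M N L \<eta> H pr \<Sigma>) Z vel x0 y0"
proof -
  obtain Z1 where Z1: "open Z1" "(x0, y0) \<in> Z1" "Z1 \<subseteq> domain \<inter> sol -` U"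
    and eq1: "\<And>z. z \<in> Z1 \<Longrightarrow> sol z \<in> {m. H m \<noteq> 0} \<longleftrightarrow> param z \<in> N\<^sub>1 \<times> L\<^sub>1"
    using restricted_domain[OF r z0] by blast
  have H_cont: "continuous_on UNIV H" using H by (simp add: smooth_map_on_def)
  have o: "open (H -` (- {0}))" by (rule open_vimage[OF open_Compl[OF closed_singleton] H_cont])
  define Z where "Z = Z1 \<inter> (domain \<inter> sol -` (H -` (- {0})))"
  have Z: "open Z" "Z \<subseteq> domain \<inter> sol -` U"
    unfolding Z_def using open_Int[OF Z1(1) smooth_paramD(4)[OF sol_smooth o]] Z1(3) by blast+
  have z0Z: "(x0, y0) \<in> Z" using eq1[OF Z1(2)] z0 Z1(2) by (simp add: Z_def)
  have ZN: "param z \<in> N\<^sub>1 \<times> L\<^sub>1" if "z \<in> Z" for z using eq1[of z] that by (simp add: Z_def)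
  have nz: "ham z \<noteq> 0" if "z \<in> Z" for z using that by (simp add: Z_def ham_def)
  obtain k where sub: "submanifold N k N\<^sub>1" using r by (auto simp: restricts_to_def complete_solution_def)
  interpret cc: contact_coords "known_data M N L \<eta> H pr \<Sigma>" Z form ham "\<lambda>z. \<xi> (sol z) H" vel x0 y0
    by (rule contact_coords_sol[OF Z z0Z])
  have "solved_by_quadratures (known_data M N L \<eta> H pr \<Sigma>) Z vel x0 y0"
  proof (rule cc.solved_where_K_nonzero[OF nz])
    fix z a b assume z: "z \<in> Z"
    obtain x y where xy: "z = (x, y)" by (cases z)
    have d: "(x, y) \<in> domain" using z Z(2) xy by blast
    let ?n = "inv_into Nd \<psi> x" and ?l = "inv_into Ld \<theta> y"
    have t: "push_vec N (inv_into Nd \<psi>) x v \<in> tangent_to N N\<^sub>1 ?n" for v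
    proof (rule curve_tangent_to[OF sub d, where c = "\<lambda>t. x + t *\<^sub>R v"])
      show "x + 0 *\<^sub>R v = x" by simp
      show "((\<lambda>t. x + t *\<^sub>R v) has_vector_derivative v) (at 0)" by (auto intro!: derivative_eq_intros)
      have "continuous_on UNIV (\<lambda>t. (x + t *\<^sub>R v, y))" by (intro continuous_intros)
      then have o: "open ((\<lambda>t. (x + t *\<^sub>R v, y)) -` Z)" by (rule open_vimage[OF Z(1)])
      have 0: "0 \<in> (\<lambda>t. (x + t *\<^sub>R v, y)) -` Z" using z xy by simp
      show "\<forall>\<^sub>F t in nhds 0. inv_into Nd \<psi> (x + t *\<^sub>R v) \<in> N\<^sub>1"
        unfolding eventually_nhds
      proof (intro exI[of _ "(\<lambda>t. (x + t *\<^sub>R v, y)) -` Z"] conjI ballI)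
        fix t assume "t \<in> (\<lambda>t. (x + t *\<^sub>R v, y)) -` Z"
        then show "inv_into Nd \<psi> (x + t *\<^sub>R v) \<in> N\<^sub>1" using ZN[of "(x + t *\<^sub>R v, y)"] by (simp add: param_def)
      qed (rule o, rule 0)
    qed
    have nl: "?n \<in> N\<^sub>1" "?l \<in> L\<^sub>1" using ZN[OF z] by (auto simp: xy param_def)
    have "ext_deriv M (\<lambda>p v. \<eta> p v / H p) (sol (x, y)) (push_vec M sol (x, y) (a, 0)) (push_vec M sol (x, y) (b, 0)) = 0"
      using bspec[OF bspec[OF bspec[OF bspec[OF isotropic nl(2)] nl(1)] t[of a]] t[of b]]
      unfolding Let_def pushforward_partial_solution[OF d] by (simp add: domainD(3)[OF d])
    then show "ext_d (\<lambda>z w. form z w / ham z) z (a, 0) (b, 0) = 0"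
      using ext_deriv_form_over_ham[OF d, of "(a, 0)" "(b, 0)"] nz[OF z] by (simp add: xy)
  qed
  with Z show ?thesis by (intro exI[of _ Z] conjI)
qed

lemma (in complete_solution_chart) solved_on_energy_zero:
  assumes r: "restricts_to M N L pr X \<Sigma> {m. H m = 0} N\<^sub>0 L\<^sub>0"
    and isotropic: "\<forall>l\<in>L\<^sub>0. \<forall>n\<in>N\<^sub>0. \<forall>v\<in>tangent_to N N\<^sub>0 n.
           let \<sigma> = partial_solution \<Sigma> l in \<eta> (\<sigma> n) (pushforward M \<sigma> n v) = 0"
    and z0: "(x0, y0) \<in> domain" "sol (x0, y0) \<in> U" "param (x0, y0) \<in> N\<^sub>0 \<times> L\<^sub>0"
  shows "\<exists>Z. open Z \<and> Z \<subseteq> domain \<inter> sol -` U \<and> solved_by_quadratures (known_data M N L \<eta> H pr \<Sigma>) Z vel x0 y0"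
proof -
  obtain Z where Z: "open Z" "(x0, y0) \<in> Z" "Z \<subseteq> domain \<inter> sol -` U"
    and eq: "\<And>z. z \<in> Z \<Longrightarrow> sol z \<in> {m. H m = 0} \<longleftrightarrow> param z \<in> N\<^sub>0 \<times> L\<^sub>0"
    using restricted_domain[OF r z0] by blast
  obtain k where sub: "submanifold N k N\<^sub>0" using r by (auto simp: restricts_to_def complete_solution_def)
  interpret cc: contact_coords "known_data M N L \<eta> H pr \<Sigma>" Z form ham "\<lambda>z. \<xi> (sol z) H" vel x0 y0
    by (rule contact_coords_sol[OF Z(1,3,2)])
  let ?A = "{x. inv_into Nd \<psi> x \<in> N\<^sub>0}" and ?B = "{y. inv_into Ld \<theta> y \<in> L\<^sub>0}"
  have zs: "ham (x, y) = 0 \<longleftrightarrow> x \<in> ?A \<and> y \<in> ?B" if "(x, y) \<in> Z" for x y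
    using eq[OF that] by (simp add: ham_def param_def)
  have "solved_by_quadratures (known_data M N L \<eta> H pr \<Sigma>) Z vel x0 y0"
  proof (rule cc.solved_where_K_zero[OF _ zs])
    show "ham (x0, y0) = 0" using eq[OF Z(2)] z0(3) by (simp add: ham_def)
  next
    fix x y c v assume z: "(x, y) \<in> Z" and x: "x \<in> ?A" and y: "y \<in> ?B"
      and c: "c 0 = x" "(c has_vector_derivative v) (at 0)" "\<forall>\<^sub>F s in nhds 0. c s \<in> ?A"
    have d: "(x, y) \<in> domain" using z Z(3) by blast
    have t: "push_vec N (inv_into Nd \<psi>) x v \<in> tangent_to N N\<^sub>0 (inv_into Nd \<psi> x)"
      by (rule curve_tangent_to[OF sub d c(1,2)]) (use c(3) in simp)
    have nl: "inv_into Nd \<psi> x \<in> N\<^sub>0" "inv_into Ld \<theta> y \<in> L\<^sub>0" using x y by simp_all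
    show "form (x, y) (v, 0) = 0"
      using bspec[OF bspec[OF bspec[OF isotropic nl(2)] nl(1)] t]
      unfolding Let_def pushforward_partial_solution[OF d] by (simp add: form_def domainD(3)[OF d])
  qed
  with Z(1,3) show ?thesis by (intro exI[of _ Z] conjI)
qed

theorem theorem8:
  fixes M :: "('a::{t2_space,second_countable_topology}, 'm::euclidean_space) atlas"
    and N :: "('b::{t2_space,second_countable_topology}, 'n::euclidean_space) atlas"
    and L :: "('c::{t2_space,second_countable_topology}, 'l::euclidean_space) atlas"
    and n :: nat
    and \<eta> :: "'a \<Rightarrow> 'a tvec \<Rightarrow> real" and \<xi> X :: "'a \<Rightarrow> 'a tvec"
    and H :: "'a \<Rightarrow> real" and pr :: "'a \<Rightarrow> 'b" and \<Sigma> :: "'b \<times> 'c \<Rightarrow> 'a"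
  assumes "contact_manifold n M \<eta>" and "reeb_field M \<eta> \<xi>"
    and "manifold N" and "fibration M N pr UNIV UNIV"
    and "smooth_map M euclidean_atlas H" and "\<And>p. \<xi> p H \<noteq> 0"
    and "contact_field M \<eta> \<xi> H X"
    and "manifold L" and "complete_solution M N L pr X UNIV UNIV UNIV \<Sigma>"
    and "bi_isotropic M N L \<eta> H pr X \<Sigma>"
  shows "integrable_by_quadratures (known_data M N L \<eta> H pr \<Sigma>) M X"
  unfolding integrable_by_quadratures_def
proof (intro allI ballI, clarify)
  fix p U \<phi> assume c: "(U, \<phi>) \<in> M" and p: "p \<in> U"
  obtain N\<^sub>0 L\<^sub>0 where r0: "restricts_to M N L pr X \<Sigma> {m. H m = 0} N\<^sub>0 L\<^sub>0"
    and i0: "\<forall>l\<in>L\<^sub>0. \<forall>n\<in>N\<^sub>0. \<forall>v\<in>tangent_to N N\<^sub>0 n.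
           let \<sigma> = partial_solution \<Sigma> l in \<eta> (\<sigma> n) (pushforward M \<sigma> n v) = 0"
    using assms(10) unfolding bi_isotropic_def by blast
  obtain N\<^sub>1 L\<^sub>1 where r1: "restricts_to M N L pr X \<Sigma> {m. H m \<noteq> 0} N\<^sub>1 L\<^sub>1"
    and i1: "\<forall>l\<in>L\<^sub>1. \<forall>n\<in>N\<^sub>1. \<forall>u\<in>tangent_to N N\<^sub>1 n. \<forall>v\<in>tangent_to N N\<^sub>1 n.
           let \<sigma> = partial_solution \<Sigma> l in
             ext_deriv M (\<lambda>p v. \<eta> p v / H p) (\<sigma> n) (pushforward M \<sigma> n u) (pushforward M \<sigma> n v) = 0"
    using assms(10) unfolding bi_isotropic_def by blast
  have im0: "\<Sigma> ` (N\<^sub>0 \<times> L\<^sub>0) = {m. H m = 0}" and im1: "\<Sigma> ` (N\<^sub>1 \<times> L\<^sub>1) = {m. H m \<noteq> 0}"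
    using r0 r1 by (auto simp: restricts_to_def complete_solution_def)
  have "\<exists>q. \<Sigma> q = p \<and> (if H p = 0 then q \<in> N\<^sub>0 \<times> L\<^sub>0 else q \<in> N\<^sub>1 \<times> L\<^sub>1)"
  proof (cases "H p = 0")
    case True
    then have "p \<in> \<Sigma> ` (N\<^sub>0 \<times> L\<^sub>0)" by (simp add: im0)
    with True show ?thesis by force
  next
    case False
    then have "p \<in> \<Sigma> ` (N\<^sub>1 \<times> L\<^sub>1)" by (simp add: im1)
    with False show ?thesis by force
  qed
  then obtain q where q: "\<Sigma> q = p" "if H p = 0 then q \<in> N\<^sub>0 \<times> L\<^sub>0 else q \<in> N\<^sub>1 \<times> L\<^sub>1" by blast
  obtain Nd \<psi> where cN: "(Nd, \<psi>) \<in> N" "fst q \<in> Nd" using manifold_chart[OF assms(3)] .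
  obtain Ld \<theta> where cL: "(Ld, \<theta>) \<in> L" "snd q \<in> Ld" using manifold_chart[OF assms(8)] .
  interpret complete_solution_chart n M N L \<eta> \<xi> X H pr \<Sigma> U \<phi> Nd \<psi> Ld \<theta>
    by (rule complete_solution_chart.intro)
       (use assms c cN cL in \<open>simp_all add: fibration_def\<close>)
  let ?x0 = "\<psi> (fst q)" and ?y0 = "\<theta> (snd q)"
  have z0: "(?x0, ?y0) \<in> domain" using cN cL by (simp add: domain_def)
  have pq: "param (?x0, ?y0) = q"
    using is_chartD(6)[OF manifoldD(1)[OF N cN(1)] cN(2)] is_chartD(6)[OF manifoldD(1)[OF L cL(1)] cL(2)]
    by (simp add: param_def)
  then have s0: "sol (?x0, ?y0) = p" by (simp add: sol_def q(1))
  then have sU: "sol (?x0, ?y0) \<in> U" using p by simp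
  have "\<exists>Z. open Z \<and> Z \<subseteq> domain \<inter> sol -` U \<and> solved_by_quadratures (known_data M N L \<eta> H pr \<Sigma>) Z vel ?x0 ?y0"
  proof (cases "H p = 0")
    case True
    show ?thesis by (rule solved_on_energy_zero[OF r0 i0 z0 sU]) (use q(2) True pq in simp)
  next
    case False
    show ?thesis by (rule solved_on_energy_nonzero[OF r1 i1 z0 sU]) (use q(2) False pq in simp)
  qed
  then obtain Z where Z: "open Z" "Z \<subseteq> domain \<inter> sol -` U"
    and solved: "solved_by_quadratures (known_data M N L \<eta> H pr \<Sigma>) Z vel ?x0 ?y0" by blast
  from integral_curve_of_solution[OF Z solved] s0
  show "\<exists>\<epsilon>>0. \<exists>\<gamma>. \<gamma> 0 = p \<and> integral_curve M X {-\<epsilon><..<\<epsilon>} \<gamma> \<and> \<gamma> ` {-\<epsilon><..<\<epsilon>} \<subseteq> U \<and>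
       (\<forall>b\<in>Basis. known (known_data M N L \<eta> H pr \<Sigma>) 1
          {y \<in> topspace (Euclidean_space 1). y 0 \<in> {-\<epsilon><..<\<epsilon>}} (\<lambda>y. \<phi> (\<gamma> (y 0)) \<bullet> b))"
    by simp
qed

end
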